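(* Suppose that for each $J\subseteq[n]$, $\mathcal B_n(J)$ is a set of homogeneous polynomials in $\mathbb C[\mathbf x_n]$ whose images form a basis of $\mathbb C[\mathbf x_n]/(I^B_n:f_J)$. Then the images of $\mathcal B_n=\bigsqcup_{J\subseteq[n]}\mathcal B_n(J)\cdot\theta_J$ form a basis of $SR^B_n$.
   Context: $\mathbb C[\mathbf x_n]=\mathbb C[x_1,\dots,x_n]$; $\Omega_n=\mathbb C[\mathbf x_n]\otimes\wedge\{\theta_1,\dots,\theta_n\}$ with anticommuting $\theta_i$ commuting with the $x_j$; $\theta_J=\theta_{j_1}\cdots\theta_{j_k}$ for $J=\{j_1<\dots<j_k\}$. $\mathfrak B_n$ (signed permutations) acts by $\pi(x_i)=x_{\pi(i)}$, $\pi(\theta_i)=\theta_{\pi(i)}$, $x_{-i}=-x_i$, $\theta_{-i}=-\theta_i$. $SI^B_n$ is the ideal of $\Omega_n$ generated by the invariants with zero constant term, $SR^B_n=\Omega_n/SI^B_n$; $I^B_n$ is the ideal of $\mathbb C[\mathbf x_n]$ generated by invariant polynomials with zero constant term. $(I:f)=\{g:fg\in I\}$. $f_J=\prod_{j\in J}x_j\prod_{j<i\le n}(x_j^2-x_i^2)$. *)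

theory Defs
  imports Complex_Main "HOL-Library.Poly_Mapping"
begin

type_synonym mono = "nat \<Rightarrow>\<^sub>0 nat"
type_synonym cpoly = "mono \<Rightarrow>\<^sub>0 complex"

definition Xv :: "nat \<Rightarrow> cpoly" where
  "Xv i = Poly_Mapping.single (Poly_Mapping.single i 1) 1"

definition cconst :: "complex \<Rightarrow> cpoly" where
  "cconst c = Poly_Mapping.single 0 c"

definition Pn :: "nat \<Rightarrow> cpoly set" where
  "Pn n = {p. \<forall>a\<in>Poly_Mapping.keys p. Poly_Mapping.keys a \<subseteq> {1..n}}"

definition mdeg :: "mono \<Rightarrow> nat" where
  "mdeg a = (\<Sum>i\<in>Poly_Mapping.keys a. Poly_Mapping.lookup a i)"

definition homogeneous :: "cpoly \<Rightarrow> bool" where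
  "homogeneous p \<longleftrightarrow> (\<exists>d. \<forall>a\<in>Poly_Mapping.keys p. mdeg a = d)"

(* pi i = +-k encodes pi(i) = +-k; x_{-k} = -x_k, theta_{-k} = -theta_k *)
definition signed_perms :: "nat \<Rightarrow> (nat \<Rightarrow> int) set" where
  "signed_perms n = {\<pi>. (\<forall>i. i \<notin> {1..n} \<longrightarrow> \<pi> i = int i)
       \<and> bij_betw (\<lambda>i. nat \<bar>\<pi> i\<bar>) {1..n} {1..n}}"

definition Xs :: "int \<Rightarrow> cpoly" where
  "Xs k = (if k \<ge> 0 then Xv (nat k) else - Xv (nat (- k)))"

definition act_mono :: "(nat \<Rightarrow> int) \<Rightarrow> mono \<Rightarrow> cpoly" where
  "act_mono \<pi> a = (\<Prod>i\<in>Poly_Mapping.keys a. Xs (\<pi> i) ^ Poly_Mapping.lookup a i)"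

definition pact :: "(nat \<Rightarrow> int) \<Rightarrow> cpoly \<Rightarrow> cpoly" where
  "pact \<pi> p = (\<Sum>a\<in>Poly_Mapping.keys p. cconst (Poly_Mapping.lookup p a) * act_mono \<pi> a)"

section \<open>Superspace ring Omega_n = C[x_n] (x) wedge{theta_1..theta_n}\<close>

(* coefficient of x^a theta_J, theta_J = theta_{j1}...theta_{jk}, j1<...<jk *)
type_synonym omega = "(mono \<times> nat set) \<Rightarrow>\<^sub>0 complex"

definition Omega :: "nat \<Rightarrow> omega set" where
  "Omega n = {f. \<forall>(a, J)\<in>Poly_Mapping.keys f. Poly_Mapping.keys a \<subseteq> {1..n} \<and> J \<subseteq> {1..n}}"

(* theta_I theta_J = sgn * theta_{I \<union> J} if disjoint *)
definition wsign :: "nat set \<Rightarrow> nat set \<Rightarrow> complex" where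
  "wsign I J = (-1) ^ card {(i, j). i \<in> I \<and> j \<in> J \<and> j < i}"

definition mono_mul :: "mono \<times> nat set \<Rightarrow> mono \<times> nat set \<Rightarrow> omega" where
  "mono_mul m m' = (case (m, m') of ((a, I), (b, J)) \<Rightarrow>
     (if I \<inter> J = {} then Poly_Mapping.single (a + b, I \<union> J) (wsign I J) else 0))"

definition omul :: "omega \<Rightarrow> omega \<Rightarrow> omega" (infixl "\<star>" 70) where
  "f \<star> g = (\<Sum>m\<in>Poly_Mapping.keys f. \<Sum>m'\<in>Poly_Mapping.keys g.
       Poly_Mapping.map (\<lambda>c. Poly_Mapping.lookup f m * Poly_Mapping.lookup g m' * c) (mono_mul m m'))"

definition oconst :: "complex \<Rightarrow> omega" where
  "oconst c = Poly_Mapping.single (0, {}) c"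

definition emb :: "cpoly \<Rightarrow> omega" where
  "emb p = (\<Sum>a\<in>Poly_Mapping.keys p. Poly_Mapping.single (a, {}) (Poly_Mapping.lookup p a))"

definition times_theta :: "cpoly \<Rightarrow> nat set \<Rightarrow> omega" where
  "times_theta p J = (\<Sum>a\<in>Poly_Mapping.keys p. Poly_Mapping.single (a, J) (Poly_Mapping.lookup p a))"

definition Th :: "nat \<Rightarrow> omega" where
  "Th i = Poly_Mapping.single (0, {i}) 1"

definition Ths :: "int \<Rightarrow> omega" where
  "Ths k = (if k \<ge> 0 then Th (nat k) else - Th (nat (- k)))"

definition oact :: "(nat \<Rightarrow> int) \<Rightarrow> omega \<Rightarrow> omega" where
  "oact \<pi> f = (\<Sum>(a, J)\<in>Poly_Mapping.keys f. oconst (Poly_Mapping.lookup f (a, J)) \<star>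
       (emb (act_mono \<pi> a) \<star> foldr (\<lambda>j r. Ths (\<pi> j) \<star> r) (sorted_list_of_set J) (oconst 1)))"

definition pideal :: "nat \<Rightarrow> cpoly set \<Rightarrow> cpoly set" where
  "pideal n S = {(\<Sum>k<(m::nat). c k * s k) | m c s. \<forall>k<m. c k \<in> Pn n \<and> s k \<in> S}"

definition oideal :: "nat \<Rightarrow> omega set \<Rightarrow> omega set" where
  "oideal n S = {(\<Sum>k<(m::nat). c k \<star> s k \<star> d k) | m c s d.
       \<forall>k<m. c k \<in> Omega n \<and> s k \<in> S \<and> d k \<in> Omega n}"

definition IB :: "nat \<Rightarrow> cpoly set" where
  "IB n = pideal n {p \<in> Pn n. Poly_Mapping.lookup p 0 = 0 \<and> (\<forall>\<pi>\<in>signed_perms n. pact \<pi> p = p)}"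

definition SIB :: "nat \<Rightarrow> omega set" where
  "SIB n = oideal n {f \<in> Omega n. Poly_Mapping.lookup f (0, {}) = 0 \<and> (\<forall>\<pi>\<in>signed_perms n. oact \<pi> f = f)}"

definition colon :: "nat \<Rightarrow> cpoly set \<Rightarrow> cpoly \<Rightarrow> cpoly set" where
  "colon n I f = {g \<in> Pn n. f * g \<in> I}"

definition fJ :: "nat \<Rightarrow> nat set \<Rightarrow> cpoly" where
  "fJ n J = (\<Prod>j\<in>J. Xv j * (\<Prod>i\<in>{j<..n}. Xv j ^ 2 - Xv i ^ 2))"

definition pbasis_mod :: "cpoly set \<Rightarrow> cpoly set \<Rightarrow> ('i \<Rightarrow> cpoly) \<Rightarrow> 'i set \<Rightarrow> bool" where
  "pbasis_mod V I v Idx \<longleftrightarrow>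
     (\<forall>F c. finite F \<longrightarrow> F \<subseteq> Idx \<longrightarrow> (\<Sum>i\<in>F. cconst (c i) * v i) \<in> I \<longrightarrow> (\<forall>i\<in>F. c i = 0))
   \<and> (\<forall>f\<in>V. \<exists>F c. finite F \<and> F \<subseteq> Idx \<and> f - (\<Sum>i\<in>F. cconst (c i) * v i) \<in> I)"

definition obasis_mod :: "omega set \<Rightarrow> omega set \<Rightarrow> ('i \<Rightarrow> omega) \<Rightarrow> 'i set \<Rightarrow> bool" where
  "obasis_mod V I v Idx \<longleftrightarrow>
     (\<forall>F c. finite F \<longrightarrow> F \<subseteq> Idx \<longrightarrow> (\<Sum>i\<in>F. oconst (c i) \<star> v i) \<in> I \<longrightarrow> (\<forall>i\<in>F. c i = 0))
   \<and> (\<forall>f\<in>V. \<exists>F c. finite F \<and> F \<subseteq> Idx \<and> f - (\<Sum>i\<in>F. oconst (c i) \<star> v i) \<in> I)"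

end

theory Submission
  imports Defs "HOL-Computational_Algebra.Polynomial"
begin

text \<open>Write \<open>y\<^sub>i = x\<^sub>i\<^sup>2\<close> and \<open>p\<^sub>m = \<Sum>\<^sub>i y\<^sub>i\<^sup>m\<close>; the ideal \<open>I\<close> of the invariants is contained in
  \<open>(p\<^sub>1, \<dots>, p\<^sub>n)\<close>.

  Independence. The vector fields \<open>E\<^sub>r = \<Sum>\<^sub>i x\<^sub>i y\<^sub>i\<^sup>r \<partial>\<^sub>i\<close> are invariant, so the evaluation of an invariant
  form without constant term on them has values in \<open>I\<close>. The combinations
  \<open>\<eta>\<^sub>j = \<Sum>\<^sub>i x\<^sub>i \<Prod>\<^sub>m\<^sub>>\<^sub>j (y\<^sub>i - y\<^sub>m) \<partial>\<^sub>i\<close> of the \<open>E\<^sub>r\<close> are triangular, and evaluation on \<open>(\<eta>\<^sub>j)\<close>, \<open>j \<in> J\<close>, sends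
  \<open>\<theta>\<^sub>J\<close> to \<open>f\<^sub>J\<close> and kills every other \<open>\<theta>\<^sub>K\<close> for which the sum of the elements of \<open>K\<close> is not smaller than that
  of \<open>J\<close>. Hence a relation modulo the ideal of the invariant forms has a leading coefficient in \<open>(I : f\<^sub>J)\<close>.

  Spanning. Put \<open>u\<^sub>j = x\<^sub>j \<Prod> (y\<^sub>j - y\<^sub>l)\<close>, the product over \<open>l < j\<close> outside \<open>J\<close>. Multiplying a combination of
  the invariant forms \<open>\<Sum>\<^sub>i x\<^sub>i y\<^sub>i\<^sup>r \<theta>\<^sub>i\<close> by \<open>\<theta>\<close> with index set \<open>J - {j}\<close> rewrites \<open>u\<^sub>j \<theta>\<^sub>J\<close> in terms of the \<open>\<theta>\<^sub>K\<close>
  with larger element sum. So it suffices that \<open>(I : f\<^sub>J)\<close> lies in the ideal generated by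
  \<open>p\<^sub>1, \<dots>, p\<^sub>n\<^sub>-\<^sub>k\<close> (\<open>k\<close> the size of \<open>J\<close>) and the \<open>u\<^sub>j\<close>. Adding the elements \<open>j\<close> of \<open>J\<close> in increasing order,
  the last power sum \<open>p\<^sub>N\<close> is congruent to \<open>f\<^sub>j u\<^sub>j\<close> modulo the other generators, because
  \<open>\<Sum>\<^sub>a y\<^sub>a \<Prod>\<^sub>i (y\<^sub>a - y\<^sub>i)\<close>, the product over a set of \<open>N - 1\<close> indices, is congruent to \<open>p\<^sub>N\<close> modulo
  \<open>p\<^sub>1, \<dots>, p\<^sub>N\<^sub>-\<^sub>1\<close>; thus dividing by \<open>f\<^sub>j\<close> replaces \<open>p\<^sub>N\<close> by \<open>u\<^sub>j\<close> as soon as the other generators and any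
  linear factor of \<open>f\<^sub>j\<close> form a regular sequence. Homogeneous regular sequences may be permuted, and the
  products \<open>u\<^sub>j\<close> may be replaced by their linear factors. These only set variables to zero or identify
  them up to sign, which turns the \<open>p\<^sub>m\<close> into power sums with positive weights in fewer variables, and the
  identity above allows an induction on the number of variables.\<close>

abbreviation lookup where "lookup \<equiv> Poly_Mapping.lookup"
abbreviation keys where "keys \<equiv> Poly_Mapping.keys"
abbreviation single where "single \<equiv> Poly_Mapping.single"

section \<open>Polynomials\<close>

lemma poly_mapping_sum_singles:
  fixes p :: "'a \<Rightarrow>\<^sub>0 'b::comm_monoid_add"
  shows "p = (\<Sum>k\<in>keys p. single k (lookup p k))"
proof (rule poly_mapping_eqI)
  fix a
  have "lookup (\<Sum>k\<in>keys p. single k (lookup p k)) a = (\<Sum>k\<in>keys p. if k = a then lookup p k else 0)"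
    by (simp add: lookup_sum lookup_single when_def)
  also have "\<dots> = lookup p a"
    by (simp add: sum.delta in_keys_iff)
  finally show "lookup p a = lookup (\<Sum>k\<in>keys p. single k (lookup p k)) a" by simp
qed

lemma poly_mapping_single_add_induct [case_names single add]:
  fixes p :: "'a \<Rightarrow>\<^sub>0 'b::comm_monoid_add"
  assumes s: "\<And>a c. P (single a c)" and a: "\<And>p q. P p \<Longrightarrow> P q \<Longrightarrow> P (p + q)"
  shows "P p"
proof -
  have z: "P 0" using s[of undefined 0] by simp
  have "finite A \<Longrightarrow> P (\<Sum>k\<in>A. single k (lookup p k))" for A
    by (induction A rule: finite_induct) (auto intro: z s a)
  then show ?thesis using poly_mapping_sum_singles[of p] by (metis finite_keys)
qed

lemma cconst_mult: "cconst (c * d) = cconst c * cconst d"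
  by (simp add: cconst_def mult_single)

lemma cconst_add: "cconst (c + d) = cconst c + cconst d"
  by (simp add: cconst_def single_add)

lemma cconst_0 [simp]: "cconst 0 = 0"
  by (simp add: cconst_def)

lemma cconst_1 [simp]: "cconst 1 = 1"
  by (simp add: cconst_def)

lemma cconst_of_nat: "cconst (of_nat k) = of_nat k"
  by (induction k) (simp_all add: cconst_add)

lemma single_mono_prod:
  "single a (1::complex) = (\<Prod>i\<in>keys a. Xv i ^ lookup a i)" for a :: mono
proof -
  have pw: "Xv i ^ k = single (single i k) 1" for i k
    by (induction k) (simp_all add: Xv_def mult_single single_add[symmetric])
  have "finite A \<Longrightarrow> (\<Prod>i\<in>A. Xv i ^ lookup a i) = single (\<Sum>i\<in>A. single i (lookup a i)) 1" for A
    by (induction A rule: finite_induct) (simp_all add: pw mult_single)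
  then show ?thesis using poly_mapping_sum_singles[of a] by simp
qed

lemma cpoly_induct [case_names const var add mult]:
  assumes c: "\<And>c. P (cconst c)" and v: "\<And>i. P (Xv i)"
    and a: "\<And>p q. P p \<Longrightarrow> P q \<Longrightarrow> P (p + q)" and m: "\<And>p q. P p \<Longrightarrow> P q \<Longrightarrow> P (p * q)"
  shows "P p"
proof (induction p rule: poly_mapping_single_add_induct)
  case (single b d)
  have o: "P 1" using c[of 1] by simp
  have pw: "P (Xv i ^ k)" for i k by (induction k) (auto intro: o v m)
  have prd: "finite A \<Longrightarrow> P (\<Prod>i\<in>A. Xv i ^ lookup b i)" for A
    by (induction A rule: finite_induct) (auto intro: o m pw)
  have "P (cconst d * single b 1)" unfolding single_mono_prod by (intro c m prd) simp
  then show ?case by (simp add: cconst_def mult_single)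
qed (rule a)

section \<open>Substitution homomorphisms of the polynomial ring\<close>

definition psubst :: "(nat \<Rightarrow> cpoly) \<Rightarrow> cpoly \<Rightarrow> cpoly" where
  "psubst \<phi> p = (\<Sum>a\<in>keys p. cconst (lookup p a) * (\<Prod>i\<in>keys a. \<phi> i ^ lookup a i))"

lemma psubst_add: "psubst \<phi> (p + q) = psubst \<phi> p + psubst \<phi> q"
  unfolding psubst_def
  by (rule setsum_keys_plus_distrib) (simp_all add: cconst_add distrib_right)

lemma psubst_single: "psubst \<phi> (single a c) = cconst c * (\<Prod>i\<in>keys a. \<phi> i ^ lookup a i)"
  by (simp add: psubst_def)

lemma mono_prod_superset:
  fixes \<phi> :: "nat \<Rightarrow> 'a::comm_monoid_mult" and a :: mono
  shows "finite A \<Longrightarrow> keys a \<subseteq> A \<Longrightarrow> (\<Prod>i\<in>keys a. \<phi> i ^ lookup a i) = (\<Prod>i\<in>A. \<phi> i ^ lookup a i)"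
  by (rule prod.mono_neutral_left) (auto simp: in_keys_iff)

lemma mono_prod_add:
  fixes \<phi> :: "nat \<Rightarrow> 'a::comm_monoid_mult" and a b :: mono
  shows "(\<Prod>i\<in>keys (a + b). \<phi> i ^ lookup (a + b) i) =
    (\<Prod>i\<in>keys a. \<phi> i ^ lookup a i) * (\<Prod>i\<in>keys b. \<phi> i ^ lookup b i)"
proof -
  let ?A = "keys a \<union> keys b"
  have "keys (a + b) \<subseteq> ?A" by (rule keys_add)
  then show ?thesis
    using mono_prod_superset[of ?A a \<phi>] mono_prod_superset[of ?A b \<phi>] mono_prod_superset[of ?A "a + b" \<phi>]
    by (simp add: lookup_add power_add prod.distrib)
qed

lemma psubst_mult: "psubst \<phi> (p * q) = psubst \<phi> p * psubst \<phi> q"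
proof (induction p rule: poly_mapping_single_add_induct)
  case (single a c)
  show ?case
  proof (induction q rule: poly_mapping_single_add_induct)
    case (single b d)
    show ?case
      by (simp add: mult_single psubst_single mono_prod_add cconst_mult ac_simps)
  qed (simp add: distrib_left psubst_add)
qed (simp add: distrib_right psubst_add)

lemma psubst_cconst [simp]: "psubst \<phi> (cconst c) = cconst c"
  by (simp add: cconst_def psubst_single)

lemma psubst_Xv [simp]: "psubst \<phi> (Xv i) = \<phi> i"
  by (simp add: Xv_def psubst_single)

lemma psubst_0 [simp]: "psubst \<phi> 0 = 0" and psubst_1 [simp]: "psubst \<phi> 1 = 1"
  using psubst_cconst[of \<phi> 0] psubst_cconst[of \<phi> 1] by simp_all

lemma psubst_uminus: "psubst \<phi> (- p) = - psubst \<phi> p"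
  using psubst_add[of \<phi> p "- p"] by (simp add: eq_neg_iff_add_eq_0 add.commute)

lemma psubst_diff: "psubst \<phi> (p - q) = psubst \<phi> p - psubst \<phi> q"
  using psubst_add[of \<phi> p "- q"] by (simp add: psubst_uminus)

lemma psubst_sum: "psubst \<phi> (sum f A) = (\<Sum>i\<in>A. psubst \<phi> (f i))"
  by (induction A rule: infinite_finite_induct) (simp_all add: psubst_add)

lemma psubst_prod: "psubst \<phi> (prod f A) = (\<Prod>i\<in>A. psubst \<phi> (f i))"
  by (induction A rule: infinite_finite_induct) (simp_all add: psubst_mult)

lemma psubst_power: "psubst \<phi> (p ^ k) = psubst \<phi> p ^ k"
  by (induction k) (simp_all add: psubst_mult)

lemmas psubst_simps = psubst_add psubst_mult psubst_uminus psubst_diff psubst_sum psubst_prod psubst_power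

lemma pact_eq_psubst: "pact \<pi> p = psubst (\<lambda>i. Xs (\<pi> i)) p"
  by (simp add: pact_def psubst_def act_mono_def)

lemma psubst_fix:
  assumes "p \<in> Pn n" "\<And>i. i \<in> {1..n} \<Longrightarrow> \<phi> i = Xv i"
  shows "psubst \<phi> p = p"
proof -
  have "\<phi> i = Xv i" if "a \<in> keys p" "i \<in> keys a" for a i
    using assms that unfolding Pn_def by blast
  then have "psubst \<phi> p = (\<Sum>a\<in>keys p. cconst (lookup p a) * single a 1)"
    unfolding psubst_def single_mono_prod
    by (intro sum.cong refl arg_cong2[of _ _ _ _ "(*)"] prod.cong) auto
  also have "\<dots> = (\<Sum>a\<in>keys p. single a (lookup p a))"
    by (simp add: cconst_def mult_single)
  finally show ?thesis using poly_mapping_sum_singles[of p] by simp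
qed

subsection \<open>The subring of polynomials in the first variables\<close>

lemma Pn_0 [simp]: "0 \<in> Pn n" and Pn_cconst [simp]: "cconst c \<in> Pn n" and Pn_1 [simp]: "1 \<in> Pn n"
  by (auto simp: Pn_def cconst_def)

lemma Pn_add: "p \<in> Pn n \<Longrightarrow> q \<in> Pn n \<Longrightarrow> p + q \<in> Pn n"
  using keys_add[of p q] by (fastforce simp: Pn_def)

lemma Pn_uminus: "p \<in> Pn n \<Longrightarrow> - p \<in> Pn n"
  by (auto simp: Pn_def in_keys_iff)

lemma Pn_mult: "p \<in> Pn n \<Longrightarrow> q \<in> Pn n \<Longrightarrow> p * q \<in> Pn n"
proof -
  assume p: "p \<in> Pn n" and q: "q \<in> Pn n"
  have "keys c \<subseteq> {1..n}" if c: "c \<in> keys (p * q)" for c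
  proof -
    obtain a b where ab: "c = a + b" "a \<in> keys p" "b \<in> keys q" using keys_mult[of p q] c by blast
    then have "keys a \<subseteq> {1..n}" "keys b \<subseteq> {1..n}" using p q by (auto simp: Pn_def)
    then show ?thesis using keys_add[of a b] ab by blast
  qed
  then show ?thesis by (auto simp: Pn_def)
qed

lemma Pn_diff: "p \<in> Pn n \<Longrightarrow> q \<in> Pn n \<Longrightarrow> p - q \<in> Pn n"
  using Pn_add[of p n "- q"] Pn_uminus[of q n] by simp

lemma Pn_Xv: "i \<in> {1..n} \<Longrightarrow> Xv i \<in> Pn n"
  by (auto simp: Pn_def Xv_def)

lemma Pn_sum: "(\<And>i. i \<in> A \<Longrightarrow> f i \<in> Pn n) \<Longrightarrow> sum f A \<in> Pn n"
  by (induction A rule: infinite_finite_induct) (auto intro: Pn_add)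

lemma Pn_prod: "(\<And>i. i \<in> A \<Longrightarrow> f i \<in> Pn n) \<Longrightarrow> prod f A \<in> Pn n"
  by (induction A rule: infinite_finite_induct) (auto intro: Pn_mult)

lemma Pn_power: "p \<in> Pn n \<Longrightarrow> p ^ k \<in> Pn n"
  by (induction k) (auto intro: Pn_mult)

lemma Pn_psubst:
  assumes "\<And>i. \<phi> i \<in> Pn n" shows "psubst \<phi> p \<in> Pn n"
  unfolding psubst_def by (intro Pn_sum Pn_mult Pn_prod Pn_power Pn_cconst assms)

text \<open>Polynomials here have infinitely many variables. This retraction onto
  \<open>Pn n\<close> moves the cofactors of an ideal combination into the ring in the first
  \<open>n\<close> variables.\<close>

definition pproj :: "nat \<Rightarrow> cpoly \<Rightarrow> cpoly" where
  "pproj n = psubst (\<lambda>i. if i \<in> {1..n} then Xv i else 0)"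

lemma pproj_Pn: "pproj n p \<in> Pn n"
  unfolding pproj_def by (rule Pn_psubst) (auto intro: Pn_Xv)

lemma pproj_id: "p \<in> Pn n \<Longrightarrow> pproj n p = p"
  unfolding pproj_def by (rule psubst_fix) auto

lemma lookup_mult_0: "lookup (p * q) 0 = lookup p 0 * lookup q (0::mono)" for p q :: cpoly
proof (induction p rule: poly_mapping_single_add_induct)
  case (single a c)
  show ?case
  proof (induction q rule: poly_mapping_single_add_induct)
    case (single b d)
    have "a + b = 0 \<longleftrightarrow> a = 0 \<and> b = 0"
      by (auto simp: poly_mapping_eq_iff lookup_add fun_eq_iff)
    then show ?case by (auto simp: mult_single lookup_single when_def)
  qed (simp add: distrib_left lookup_add)
qed (simp add: distrib_right lookup_add)

subsection \<open>Ideals\<close>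

lemma module_mult: "module ((*) :: 'a::comm_ring_1 \<Rightarrow> 'a \<Rightarrow> 'a)"
  by unfold_locales (simp_all add: algebra_simps)

text \<open>Ideals are the submodules of the ring over itself, so the span theory of modules
  supplies their closure rules.\<close>

abbreviation idl :: "'a::comm_ring_1 set \<Rightarrow> 'a set" where
  "idl \<equiv> module.span (*)"

lemmas idl_zero = module.span_zero[OF module_mult]
  and idl_add = module.span_add[OF module_mult]
  and idl_diff = module.span_diff[OF module_mult]
  and idl_neg = module.span_neg[OF module_mult]
  and idl_sum = module.span_sum[OF module_mult]
  and idl_base = module.span_base[OF module_mult]
  and idl_mono = module.span_mono[OF module_mult]
  and idl_insert_iff = module.span_breakdown_eq[OF module_mult]
  and idl_induct [consumes 1, case_names base step] = module.span_induct_alt[OF module_mult]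

lemma idl_mult_left: "x \<in> idl S \<Longrightarrow> c * x \<in> idl S"
  by (rule module.span_scale[OF module_mult])

lemma idl_mult_right: "x \<in> idl S \<Longrightarrow> x * c \<in> idl S"
  using module.span_scale[OF module_mult, of x S c] by (simp add: mult.commute)

lemma idl_dvd: "x \<in> idl S \<Longrightarrow> x dvd y \<Longrightarrow> y \<in> idl S"
  by (auto simp: dvd_def intro: idl_mult_right)

lemma idl_subset: "S \<subseteq> idl T \<Longrightarrow> idl S \<subseteq> idl T"
  by (rule module.span_minimal[OF module_mult]) (auto intro: module.subspace_span[OF module_mult])

lemma idl_cong_mem: "x - y \<in> idl S \<Longrightarrow> x \<in> idl S \<longleftrightarrow> y \<in> idl S"
  using idl_add[of "x - y" S y] idl_diff[of x S "x - y"] by auto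

text \<open>Applying \<open>pproj n\<close> to a combination fixes the generators and the element
  and moves the cofactors into \<open>Pn n\<close>. Hence ideals can be handled in the full ring and
  contracted at the end.\<close>

lemma pideal_eq:
  assumes S: "S \<subseteq> Pn n"
  shows "pideal n S = idl S \<inter> Pn n"
proof (intro equalityI subsetI)
  fix p assume "p \<in> pideal n S"
  then obtain m c s where p: "p = (\<Sum>k<(m::nat). c k * s k)" and cs: "\<forall>k<m. c k \<in> Pn n \<and> s k \<in> S"
    by (auto simp: pideal_def)
  show "p \<in> idl S \<inter> Pn n" unfolding p
    using cs S by (auto intro!: idl_sum idl_mult_left Pn_sum Pn_mult intro: idl_base)
next
  have "pproj n p \<in> pideal n S" if "p \<in> idl S" for p
    using that
  proof (induction p rule: idl_induct)
    case base
    have "pproj n 0 = (\<Sum>k<(0::nat). 0 * 0)" by (simp add: pproj_def)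
    then show ?case unfolding pideal_def by (intro CollectI exI conjI) auto
  next
    case (step c x y)
    then obtain m d s where y: "pproj n y = (\<Sum>k<(m::nat). d k * s k)" and ds: "\<forall>k<m. d k \<in> Pn n \<and> s k \<in> S"
      by (auto simp: pideal_def)
    have x: "pproj n x = x" using step S by (auto intro: pproj_id)
    have "pproj n (c * x + y) = pproj n c * x + pproj n y"
      using x by (simp add: pproj_def psubst_simps)
    also have "\<dots> = (\<Sum>k<Suc m. (d(m := pproj n c)) k * (s(m := x)) k)"
      by (simp add: y)
    finally show ?case unfolding pideal_def using ds step(1) pproj_Pn
      by (intro CollectI exI[of _ "Suc m"] exI[of _ "d(m := pproj n c)"] exI[of _ "s(m := x)"] conjI) (auto simp: less_Suc_eq)
  qed
  moreover fix p assume "p \<in> idl S \<inter> Pn n"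
  ultimately show "p \<in> pideal n S" using pproj_id[of p n] by force
qed

subsection \<open>Homogeneous components\<close>

definition hom_of_deg :: "nat \<Rightarrow> cpoly \<Rightarrow> bool" where
  "hom_of_deg d p \<longleftrightarrow> (\<forall>a\<in>keys p. mdeg a = d)"

definition hcomp :: "nat \<Rightarrow> cpoly \<Rightarrow> cpoly" where
  "hcomp d = Poly_Mapping.mapp (\<lambda>a c. c when mdeg a = d)"

lemma lookup_hcomp: "lookup (hcomp d p) a = (if mdeg a = d then lookup p a else 0)"
  by (simp add: hcomp_def lookup_mapp when_def in_keys_iff)

lemma hcomp_add: "hcomp d (p + q) = hcomp d p + hcomp d q"
  by (rule poly_mapping_eqI) (simp add: lookup_hcomp lookup_add)

lemma hcomp_0 [simp]: "hcomp d 0 = 0"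
  by (rule poly_mapping_eqI) (simp add: lookup_hcomp)

lemma hcomp_sum: "hcomp d (sum f A) = (\<Sum>i\<in>A. hcomp d (f i))"
  by (induction A rule: infinite_finite_induct) (simp_all add: hcomp_add)

lemma hom_hcomp: "hom_of_deg d (hcomp d p)"
  by (auto simp: hom_of_deg_def in_keys_iff lookup_hcomp split: if_splits)

lemma hcomp_hom: "hom_of_deg e p \<Longrightarrow> hcomp d p = (if d = e then p else 0)"
  by (rule poly_mapping_eqI) (auto simp: hom_of_deg_def in_keys_iff lookup_hcomp)

lemma mdeg_add: "mdeg (a + b) = mdeg a + mdeg b"
  unfolding mdeg_def by (rule setsum_keys_plus_distrib) simp_all

lemma hcomp_sum_all: "\<exists>N. p = (\<Sum>d<N. hcomp d p)"
proof -
  have fin: "finite (mdeg ` keys p)" by simp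
  then obtain N where "mdeg ` keys p \<subseteq> {..<N}"
    unfolding finite_nat_iff_bounded by blast
  then have N: "\<And>a. a \<in> keys p \<Longrightarrow> mdeg a < N" by blast
  have "p = (\<Sum>d<N. hcomp d p)"
  proof (rule poly_mapping_eqI)
    fix a
    show "lookup p a = lookup (\<Sum>d<N. hcomp d p) a"
      using N[of a] by (cases "a \<in> keys p") (auto simp: lookup_sum lookup_hcomp in_keys_iff)
  qed
  then show ?thesis ..
qed

lemma hom_mult:
  assumes "hom_of_deg d p" "hom_of_deg e q" shows "hom_of_deg (d + e) (p * q)"
  unfolding hom_of_deg_def
proof
  fix c assume "c \<in> keys (p * q)"
  then obtain a b where "c = a + b" "a \<in> keys p" "b \<in> keys q" using keys_mult[of p q] by blast
  then show "mdeg c = d + e" using assms by (simp add: mdeg_add hom_of_deg_def)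
qed

lemma hom_add: "hom_of_deg d p \<Longrightarrow> hom_of_deg d q \<Longrightarrow> hom_of_deg d (p + q)"
  using keys_add[of p q] unfolding hom_of_deg_def by blast

lemma hom_uminus: "hom_of_deg d p \<Longrightarrow> hom_of_deg d (- p)"
  by (simp add: hom_of_deg_def in_keys_iff)

lemma hom_diff: "hom_of_deg d p \<Longrightarrow> hom_of_deg d q \<Longrightarrow> hom_of_deg d (p - q)"
  using hom_add[of d p "- q"] hom_uminus[of d q] by simp

lemma hom_0 [simp]: "hom_of_deg d 0" and hom_1: "hom_of_deg 0 1"
  by (simp_all add: hom_of_deg_def mdeg_def)

lemma hom_sum: "(\<And>i. i \<in> A \<Longrightarrow> hom_of_deg d (f i)) \<Longrightarrow> hom_of_deg d (sum f A)"
  by (induction A rule: infinite_finite_induct) (auto intro: hom_add)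

lemma hom_prod: "(\<And>i. i \<in> A \<Longrightarrow> hom_of_deg (d i) (f i)) \<Longrightarrow> hom_of_deg (sum d A) (prod f A)"
  by (induction A rule: infinite_finite_induct) (auto intro: hom_mult hom_1)

lemma hom_power: "hom_of_deg d p \<Longrightarrow> hom_of_deg (k * d) (p ^ k)"
  by (induction k) (auto intro: hom_mult hom_1)

lemma hom_Xv: "hom_of_deg 1 (Xv i)"
  by (simp add: hom_of_deg_def Xv_def mdeg_def)

lemma hcomp_mult_hom:
  assumes a: "hom_of_deg d a"
  shows "hcomp e (a * p) = (if d \<le> e then a * hcomp (e - d) p else 0)"
proof -
  obtain N where p: "p = (\<Sum>i<N. hcomp i p)" using hcomp_sum_all by blast
  \<comment> \<open>Components beyond the cutoff vanish; this covers the case that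
    \<open>e - d\<close> is not below \<open>N\<close>.\<close>
  have N0: "hcomp j p = 0" if "\<not> j < N" for j
  proof -
    have "hcomp j p = (\<Sum>i<N. hcomp j (hcomp i p))" by (subst p) (simp add: hcomp_sum)
    also have "\<dots> = (\<Sum>i<N. 0)" using that by (intro sum.cong refl) (auto simp: hcomp_hom[OF hom_hcomp])
    finally show ?thesis by simp
  qed
  have "hcomp e (a * p) = (\<Sum>i<N. hcomp e (a * hcomp i p))"
    by (subst p) (simp add: sum_distrib_left hcomp_sum)
  also have "\<dots> = (\<Sum>i<N. if e = d + i then a * hcomp i p else 0)"
    by (intro sum.cong refl hcomp_hom hom_mult a hom_hcomp)
  also have "\<dots> = (\<Sum>i<N. if i = e - d then (if d \<le> e then a * hcomp i p else 0) else 0)"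
    by (intro sum.cong refl) auto
  also have "\<dots> = (if d \<le> e then a * hcomp (e - d) p else 0)"
    using N0[of "e - d"] by (auto simp: sum.delta)
  finally show ?thesis .
qed

lemma idl_hcomp:
  assumes S: "\<And>s. s \<in> S \<Longrightarrow> \<exists>d. hom_of_deg d s" and p: "p \<in> idl S"
  shows "hcomp e p \<in> idl S"
  using p
proof (induction p rule: idl_induct)
  case base then show ?case by (simp add: idl_zero)
next
  case (step c x y)
  obtain d where d: "hom_of_deg d x" using S step by blast
  have "hcomp e (x * c) \<in> idl S"
    using step(1) by (auto simp: hcomp_mult_hom[OF d] intro: idl_mult_right idl_base idl_zero)
  then show ?case using step by (simp add: hcomp_add idl_add mult.commute)
qed

section \<open>Regular sequences\<close>

definition nzd :: "'a::comm_ring_1 set \<Rightarrow> 'a \<Rightarrow> bool" where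
  "nzd I a \<longleftrightarrow> (\<forall>g. a * g \<in> I \<longrightarrow> g \<in> I)"

text \<open>The sequence is read from the right: the head of the list is the last element.\<close>
fun regular :: "'a::comm_ring_1 list \<Rightarrow> bool" where
  "regular [] \<longleftrightarrow> True"
| "regular (a # L) \<longleftrightarrow> nzd (idl (set L)) a \<and> regular L"

lemma nzd_mult: "nzd I a \<Longrightarrow> nzd I b \<Longrightarrow> nzd I (a * b)"
  unfolding nzd_def by (metis mult.assoc)

lemma nzd_one: "nzd I 1"
  by (simp add: nzd_def)

lemma nzd_prod: "(\<And>i. i \<in> A \<Longrightarrow> nzd I (f i)) \<Longrightarrow> nzd I (prod f A)"
  by (induction A rule: infinite_finite_induct) (auto intro: nzd_one nzd_mult)

lemma nzd_cong:
  assumes "nzd (idl S) a" "a - b \<in> idl S" shows "nzd (idl S) b"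
  unfolding nzd_def
proof (intro allI impI)
  fix g assume "b * g \<in> idl S"
  moreover have "a * g - b * g \<in> idl S" using idl_mult_right[OF assms(2), of g] by (simp add: left_diff_distrib)
  ultimately have "a * g \<in> idl S" using idl_cong_mem by metis
  then show "g \<in> idl S" using assms(1) by (simp add: nzd_def)
qed

definition pos_hom :: "cpoly \<Rightarrow> bool" where
  "pos_hom p \<longleftrightarrow> (\<exists>d>0. hom_of_deg d p)"

text \<open>Induction on the degree of \<open>g\<close>. If \<open>b * g\<close> lies in the ideal
  of \<open>S\<close>, then \<open>g = a * m\<close> modulo \<open>S\<close>, so
  \<open>a * (b * m)\<close> lies there and cancelling \<open>a\<close> gives \<open>b * m\<close>.
  As \<open>a\<close> has positive degree, \<open>m\<close> has smaller degree than
  \<open>g\<close>.\<close>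

lemma nzd_swap_graded:
  assumes S: "\<forall>s\<in>S. pos_hom s" and a: "pos_hom a" and b: "pos_hom b"
    and na: "nzd (idl S) a" and nb: "nzd (idl (insert a S)) b"
  shows "nzd (idl S) b"
proof -
  obtain d where d: "d > 0" "hom_of_deg d a" using a by (auto simp: pos_hom_def)
  obtain e where e: "e > 0" "hom_of_deg e b" using b by (auto simp: pos_hom_def)
  have hS: "\<And>s. s \<in> S \<Longrightarrow> \<exists>d. hom_of_deg d s" using S by (auto simp: pos_hom_def)
  have key: "hom_of_deg k g \<Longrightarrow> b * g \<in> idl S \<Longrightarrow> g \<in> idl S" for k g
  proof (induction k arbitrary: g rule: less_induct)
    case (less k)
    have "b * g \<in> idl (insert a S)" using less(3) idl_mono[of S "insert a S"] by blast
    then have "g \<in> idl (insert a S)" using nb by (simp add: nzd_def)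
    then obtain m where m: "g - m * a \<in> idl S" using idl_insert_iff by blast
    have "hcomp k (g - m * a) \<in> idl S" using idl_hcomp[OF hS m] .
    moreover have "hcomp k (g - m * a) = g - hcomp k (a * m)"
      using hcomp_add[of k "g - m * a" "m * a"] hcomp_hom[OF less(2), of k] by (simp add: algebra_simps)
    ultimately have gm: "g - hcomp k (a * m) \<in> idl S" by simp
    show ?case
    proof (cases "d \<le> k")
      case False
      then show ?thesis using gm by (simp add: hcomp_mult_hom[OF d(2)])
    next
      case True
      let ?m = "hcomp (k - d) m"
      have gm: "g - a * ?m \<in> idl S" using gm True by (simp add: hcomp_mult_hom[OF d(2)])
      then have "b * (g - a * ?m) \<in> idl S" by (rule idl_mult_left)
      moreover have "b * (g - a * ?m) = b * g - a * (b * ?m)"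
        by (simp add: right_diff_distrib mult.left_commute)
      ultimately have "b * g - a * (b * ?m) \<in> idl S" by simp
      from idl_cong_mem[OF this] have "a * (b * ?m) \<in> idl S" using less(3) by simp
      then have "b * ?m \<in> idl S" using na by (simp add: nzd_def)
      then have "?m \<in> idl S" using less(1)[of "k - d" ?m] True d(1) hom_hcomp by simp
      then have "a * ?m \<in> idl S" by (rule idl_mult_left)
      then show ?thesis using idl_cong_mem[OF gm] by simp
    qed
  qed
  show ?thesis unfolding nzd_def
  proof (intro allI impI)
    fix g assume g: "b * g \<in> idl S"
    \<comment> \<open>The homogeneous case suffices: since \<open>b\<close> is homogeneous, the
      components of \<open>b * g\<close> are \<open>b\<close> times the components of
      \<open>g\<close>.\<close>
    have "hcomp k g \<in> idl S" for k
    proof (rule key[OF hom_hcomp])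
      have "hcomp (k + e) (b * g) \<in> idl S" by (rule idl_hcomp[OF hS g])
      then show "b * hcomp k g \<in> idl S" by (simp add: hcomp_mult_hom[OF e(2)])
    qed
    then show "g \<in> idl S" using hcomp_sum_all[of g] by (metis idl_sum)
  qed
qed

text \<open>If \<open>a * g = m * b\<close> modulo \<open>S\<close>, then cancelling
  \<open>b\<close> modulo \<open>a\<close> and \<open>S\<close> gives \<open>m = k * a\<close>
  modulo \<open>S\<close>, and cancelling \<open>a\<close> leaves \<open>g = k * b\<close>.\<close>

lemma nzd_swap:
  assumes na: "nzd (idl S) a" and nb: "nzd (idl (insert a S)) b" and nb': "nzd (idl S) b"
  shows "nzd (idl (insert b S)) a"
  unfolding nzd_def
proof (intro allI impI)
  fix g assume "a * g \<in> idl (insert b S)"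
  then obtain m where m: "a * g - m * b \<in> idl S" using idl_insert_iff by blast
  have "m * b \<in> idl (insert a S)"
    unfolding idl_insert_iff using m idl_neg[OF m]
    by (intro exI[of _ g]) (simp add: algebra_simps)
  then have "b * m \<in> idl (insert a S)" by (simp add: mult.commute)
  then have "m \<in> idl (insert a S)" using nb by (simp add: nzd_def)
  then obtain k where k: "m - k * a \<in> idl S" using idl_insert_iff by blast
  have "a * (g - k * b) = (a * g - m * b) + (m - k * a) * b" by (simp add: algebra_simps)
  then have "a * (g - k * b) \<in> idl S" using m k by (auto intro: idl_add idl_mult_right)
  then have "g - k * b \<in> idl S" using na by (simp add: nzd_def)
  then show "g \<in> idl (insert b S)" using idl_insert_iff by blast
qed

lemma regular_swap:
  assumes "regular (b # a # L)" "\<forall>s\<in>set (b # a # L). pos_hom s"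
  shows "regular (a # b # L)"
proof -
  have *: "nzd (idl (set L)) a" "nzd (idl (insert a (set L))) b" "regular L"
    using assms(1) by auto
  moreover have "nzd (idl (set L)) b"
    using nzd_swap_graded[OF _ _ _ *(1,2)] assms(2) by simp
  ultimately show ?thesis using nzd_swap by auto
qed

lemma regular_to_front:
  "regular (L1 @ a # L2) \<Longrightarrow> \<forall>s\<in>set (L1 @ a # L2). pos_hom s \<Longrightarrow> regular (a # L1 @ L2)"
proof (induction L1)
  case (Cons x L1)
  then have r: "regular (a # L1 @ L2)" by simp
  have "insert a (set L1 \<union> set L2) = set (L1 @ a # L2)" by auto
  then have "regular (x # a # L1 @ L2)" using Cons.prems(1) r by simp
  then show ?case using regular_swap[of x a "L1 @ L2"] Cons.prems(2) by simp
qed simp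

text \<open>The wanted head is moved to the front by adjacent swaps, each legitimate because all
  entries are homogeneous of positive degree.\<close>

lemma regular_perm:
  "mset L = mset M \<Longrightarrow> regular M \<Longrightarrow> \<forall>s\<in>set M. pos_hom s \<Longrightarrow> regular L"
proof (induction L arbitrary: M)
  case (Cons a L)
  have "set (a # L) = set M" using mset_eq_setD[OF Cons.prems(1)] .
  then have "a \<in> set M" by auto
  then obtain M1 M2 where M: "M = M1 @ a # M2" using split_list by metis
  then have mL: "mset L = mset (M1 @ M2)" using Cons.prems(1) by simp
  have "regular (a # M1 @ M2)" using regular_to_front Cons.prems M by blast
  then have r: "nzd (idl (set (M1 @ M2))) a" "regular (M1 @ M2)" by auto
  then have "regular L" using Cons.IH[OF mL] Cons.prems(3) M by auto
  then show ?case using r(1) mset_eq_setD[OF mL] by simp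
qed simp

section \<open>Colon ideals\<close>

definition psum :: "nat \<Rightarrow> nat \<Rightarrow> cpoly" where
  "psum n r = (\<Sum>i\<in>{1..n}. Xv i ^ (2 * r))"

text \<open>The coefficients are those of a monic univariate polynomial and do not depend on
  \<open>t\<close>, so one expansion serves all evaluation points.\<close>

lemma prod_diff_expand:
  fixes y :: "'b \<Rightarrow> 'a::comm_ring_1"
  assumes "finite V"
  shows "\<exists>a. \<forall>t. (\<Prod>i\<in>V. t - y i) = t ^ card V + (\<Sum>r<card V. a r * t ^ r)"
proof -
  define P where "P = (\<Prod>i\<in>V. [:- y i, 1:])"
  have "degree P = card V \<and> coeff P (card V) = 1" unfolding P_def using assms
  proof (induction V rule: finite_induct)
    case (insert x V)
    let ?Q = "\<Prod>i\<in>V. [:- y i, 1:]"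
    define R where "R = smult (- y x) ?Q"
    have "(\<Prod>i\<in>insert x V. [:- y i, 1:]) = pCons 0 ?Q + R" using insert by (simp add: R_def)
    moreover have "degree R < Suc (card V)"
      using degree_smult_le[of "- y x" ?Q] insert.IH by (simp add: R_def)
    moreover have Q: "degree (pCons 0 ?Q) = Suc (card V)"
      using insert.IH by (metis coeff_0 degree_pCons_eq zero_neq_one)
    ultimately have "degree (\<Prod>i\<in>insert x V. [:- y i, 1:]) = Suc (card V)"
      "coeff (\<Prod>i\<in>insert x V. [:- y i, 1:]) (Suc (card V)) = 1"
      using insert.IH by (simp_all add: degree_add_eq_left coeff_eq_0)
    then show ?case using insert by simp
  qed simp
  then have "poly P t = t ^ card V + (\<Sum>r<card V. coeff P r * t ^ r)" for t
    by (simp add: poly_altdef lessThan_Suc_atMost[symmetric])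
  moreover have "poly P t = (\<Prod>i\<in>V. t - y i)" for t
    by (simp add: P_def poly_prod)
  ultimately show ?thesis by metis
qed

text \<open>Expand the product in powers of \<open>y t\<close> and sum over \<open>t\<close>: the
  leading term is the power sum of exponent \<open>card V + 1\<close>, the others are multiples of
  lower ones. The weights serve as multiplicities after elimination and as powers
  \<open>y t ^ k\<close> when high power sums are reduced.\<close>

lemma weighted_power_sum_mem:
  fixes y w :: "'b \<Rightarrow> 'a::comm_ring_1"
  assumes V: "finite V"
  shows "(\<Sum>t\<in>T. w t * y t ^ Suc (card V)) - (\<Sum>t\<in>T. w t * (y t * (\<Prod>i\<in>V. y t - y i)))
    \<in> idl ((\<lambda>s. \<Sum>t\<in>T. w t * y t ^ s) ` {1..card V})"
proof -
  obtain a where a: "\<And>t. (\<Prod>i\<in>V. t - y i) = t ^ card V + (\<Sum>r<card V. a r * t ^ r)"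
    using prod_diff_expand[OF V, of y] by blast
  have "(\<Sum>t\<in>T. w t * (y t * (\<Prod>i\<in>V. y t - y i)))
      = (\<Sum>t\<in>T. w t * y t ^ Suc (card V)) + (\<Sum>t\<in>T. \<Sum>r<card V. a r * (w t * y t ^ Suc r))"
    unfolding a by (simp add: algebra_simps sum_distrib_left sum.distrib)
  also have "(\<Sum>t\<in>T. \<Sum>r<card V. a r * (w t * y t ^ Suc r)) = (\<Sum>r<card V. a r * (\<Sum>t\<in>T. w t * y t ^ Suc r))"
    by (subst sum.swap) (simp add: sum_distrib_left)
  finally have "(\<Sum>t\<in>T. w t * y t ^ Suc (card V)) - (\<Sum>t\<in>T. w t * (y t * (\<Prod>i\<in>V. y t - y i)))
      = - (\<Sum>r<card V. a r * (\<Sum>t\<in>T. w t * y t ^ Suc r))" by simp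
  also have "\<dots> \<in> idl ((\<lambda>s. \<Sum>t\<in>T. w t * y t ^ s) ` {1..card V})"
    by (intro idl_neg idl_sum idl_mult_left idl_base imageI) auto
  finally show ?thesis .
qed

section \<open>Elimination of variables by linear forms\<close>

lemma psubst_psubst: "psubst \<psi> (psubst \<phi> f) = psubst (\<lambda>i. psubst \<psi> (\<phi> i)) f"
  by (induction f rule: cpoly_induct) (simp_all add: psubst_simps)

lemma diff_psubst_mem:
  assumes "\<And>i. Xv i - \<phi> i \<in> idl S" shows "f - psubst \<phi> f \<in> idl S"
proof (induction f rule: cpoly_induct)
  case (const c) then show ?case by (simp add: idl_zero)
next
  case (var i) then show ?case by (simp add: assms)
next
  case (add p q)
  have "p + q - psubst \<phi> (p + q) = (p - psubst \<phi> p) + (q - psubst \<phi> q)" by (simp add: psubst_add)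
  then show ?case using add by (metis idl_add)
next
  case (mult p q)
  have "p * q - psubst \<phi> (p * q) = (p - psubst \<phi> p) * q + psubst \<phi> p * (q - psubst \<phi> q)"
    by (simp add: psubst_mult algebra_simps)
  then show ?case using mult by (metis idl_add idl_mult_left idl_mult_right)
qed

lemma psubst_idl_zero:
  assumes "\<And>s. s \<in> S \<Longrightarrow> psubst \<phi> s = 0" "f \<in> idl S" shows "psubst \<phi> f = 0"
  using assms(2) by (induction f rule: idl_induct) (simp_all add: psubst_simps assms(1))

text \<open>Lists of linear forms that eliminate one variable after the other, each either set to zero or
  identified up to sign with a surviving variable; \<open>T\<close> is the set of surviving indices.\<close>
inductive eliminates :: "nat \<Rightarrow> nat set \<Rightarrow> cpoly list \<Rightarrow> bool" for n where
  base: "eliminates n {1..n} []"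
| step: "eliminates n T L \<Longrightarrow> j \<in> T \<Longrightarrow> q \<in> insert 0 (\<Union>i\<in>T - {j}. {Xv i, - Xv i})
    \<Longrightarrow> eliminates n (T - {j}) ((Xv j - q) # L)"

lemma eliminates_subset: "eliminates n T L \<Longrightarrow> T \<subseteq> {1..n}"
  by (induction rule: eliminates.induct) auto

lemma hom_linear_form:
  assumes "q \<in> insert 0 (\<Union>i\<in>A. {Xv i, - Xv i})" shows "hom_of_deg 1 (Xv j - q)"
  using assms hom_Xv by (auto intro!: hom_diff hom_uminus)

lemma eliminates_pos_hom: "eliminates n T L \<Longrightarrow> \<forall>l\<in>set L. pos_hom l"
proof (induction rule: eliminates.induct)
  case (step T L j q)
  have "pos_hom (Xv j - q)" using hom_linear_form[OF step(3)] by (auto simp: pos_hom_def)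
  then show ?case using step by simp
qed simp

text \<open>The ideal of \<open>L\<close> is exactly the kernel of \<open>psubst \<phi>\<close>, the
  second clause giving one inclusion and the third the other.\<close>

lemma eliminates_psubst:
  "eliminates n T L \<Longrightarrow> \<exists>\<phi>. (\<forall>t\<in>T. \<phi> t = Xv t) \<and> (\<forall>l\<in>set L. psubst \<phi> l = 0)
    \<and> (\<forall>f. f - psubst \<phi> f \<in> idl (set L))"
proof (induction rule: eliminates.induct)
  case base
  have "f - psubst Xv f = 0" for f using diff_psubst_mem[of Xv "{}" f]
    by (simp add: idl_zero module.span_empty[OF module_mult])
  then show ?case by (intro exI[of _ Xv]) (simp add: idl_zero)
next
  case (step T L j q)
  then obtain \<phi> where \<phi>: "\<forall>t\<in>T. \<phi> t = Xv t" "\<forall>l\<in>set L. psubst \<phi> l = 0" "\<And>f. f - psubst \<phi> f \<in> idl (set L)"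
    by blast
  \<comment> \<open>\<open>\<psi>\<close> solves the new form for \<open>Xv j\<close>. It is applied
    after \<open>\<phi>\<close>, so the earlier forms still vanish; \<open>q\<close> involves
    surviving variables other than \<open>Xv j\<close> only and is fixed by both.\<close>
  define \<psi> where "\<psi> = Xv(j := q)"
  define \<phi>' where "\<phi>' = (\<lambda>i. psubst \<psi> (\<phi> i))"
  let ?L = "(Xv j - q) # L"
  have qq: "psubst \<phi> q = q" "psubst \<psi> q = q"
    using step(3) \<phi>(1) by (auto simp: psubst_uminus \<psi>_def split: if_splits)
  have 1: "\<forall>t\<in>T - {j}. \<phi>' t = Xv t" by (simp add: \<phi>'_def \<phi>(1) \<psi>_def)
  have comp: "psubst \<phi>' f = psubst \<psi> (psubst \<phi> f)" for f by (simp add: psubst_psubst \<phi>'_def)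
  have "psubst \<phi> (Xv j - q) = Xv j - q" using \<phi>(1) step(2) qq by (simp add: psubst_diff)
  then have 2: "\<forall>l\<in>set ?L. psubst \<phi>' l = 0"
    using \<phi>(2) qq by (simp add: comp psubst_diff) (simp add: \<psi>_def)
  have 3: "f - psubst \<phi>' f \<in> idl (set ?L)" for f
  proof -
    let ?g = "psubst \<phi> f"
    have "f - ?g \<in> idl (set ?L)" using \<phi>(3) idl_mono[of "set L" "set ?L"] by auto
    moreover have "?g - psubst \<psi> ?g \<in> idl (set ?L)"
      by (rule diff_psubst_mem) (auto simp: \<psi>_def idl_zero intro: idl_base)
    ultimately have "(f - ?g) + (?g - psubst \<psi> ?g) \<in> idl (set ?L)" by (rule idl_add)
    then show ?thesis by (simp add: comp)
  qed
  show ?case using 1 2 3 by blast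
qed

text \<open>Setting \<open>Xv j\<close> to one and all other variables to zero kills
  \<open>q\<close> but not \<open>Xv j\<close>.\<close>

lemma linear_form_nonzero:
  assumes "q \<in> insert 0 (\<Union>i\<in>T - {j}. {Xv i, - Xv i})" shows "Xv j - q \<noteq> 0"
proof
  let ?\<phi> = "(\<lambda>_. 0)(j := 1)"
  assume "Xv j - q = 0"
  then have "psubst ?\<phi> (Xv j - q) = 0" by simp
  moreover have "psubst ?\<phi> q = 0" using assms by (auto simp: psubst_uminus split: if_splits)
  ultimately show False by (simp add: psubst_diff)
qed

text \<open>The quotient by the earlier forms embeds, through \<open>\<phi>\<close>, into a
  polynomial ring. This is a domain in which the next form is still nonzero.\<close>

lemma eliminates_regular: "eliminates n T L \<Longrightarrow> regular L"
proof (induction rule: eliminates.induct)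
  case (step T L j q)
  obtain \<phi> where \<phi>: "\<forall>t\<in>T. \<phi> t = Xv t" "\<forall>l\<in>set L. psubst \<phi> l = 0" "\<And>f. f - psubst \<phi> f \<in> idl (set L)"
    using eliminates_psubst[OF step(1)] by blast
  have "psubst \<phi> q = q" using step(3) \<phi>(1) by (auto simp: psubst_uminus)
  then have a: "psubst \<phi> (Xv j - q) = Xv j - q" using \<phi>(1) step(2) by (simp add: psubst_diff)
  have "nzd (idl (set L)) (Xv j - q)" unfolding nzd_def
  proof (intro allI impI)
    fix g assume "(Xv j - q) * g \<in> idl (set L)"
    then have "psubst \<phi> ((Xv j - q) * g) = 0" using psubst_idl_zero[of "set L" \<phi>] \<phi>(2) by blast
    then have "psubst \<phi> g = 0" using a linear_form_nonzero[OF step(3)] by (simp add: psubst_mult)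
    then show "g \<in> idl (set L)" using \<phi>(3)[of g] by simp
  qed
  then show ?case using step by simp
qed simp

text \<open>Even powers do not see signs, so identifying two variables adds their weights and
  setting one to zero drops its weight; hence the weights stay positive. For exponent zero the
  latter would fail.\<close>

lemma eliminates_psum:
  "eliminates n T L \<Longrightarrow> \<exists>c. (\<forall>t\<in>T. c t > (0::nat)) \<and>
     (\<forall>r>0. psum n r - (\<Sum>t\<in>T. of_nat (c t) * Xv t ^ (2 * r)) \<in> idl (set L))"
proof (induction rule: eliminates.induct)
  case base
  show ?case by (intro exI[of _ "\<lambda>_. 1"]) (simp add: psum_def idl_zero)
next
  case (step T L j q)
  then obtain c where c: "\<forall>t\<in>T. c t > (0::nat)"
    "\<And>r. r > 0 \<Longrightarrow> psum n r - (\<Sum>t\<in>T. of_nat (c t) * Xv t ^ (2 * r)) \<in> idl (set L)" by blast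
  let ?L = "(Xv j - q) # L" and ?T = "T - {j}"
  have finT: "finite T" using eliminates_subset[OF step(1)] finite_subset by blast
  have jq: "Xv j ^ (2 * r) - q ^ (2 * r) \<in> idl (set ?L)" for r
  proof -
    have "Xv j ^ (2 * r) - psubst (Xv(j := q)) (Xv j ^ (2 * r)) \<in> idl (set ?L)"
      by (rule diff_psubst_mem) (auto simp: idl_zero intro: idl_base)
    then show ?thesis by (simp add: psubst_power)
  qed
  have red: "psum n r - ((\<Sum>t\<in>?T. of_nat (c t) * Xv t ^ (2 * r)) + of_nat (c j) * q ^ (2 * r)) \<in> idl (set ?L)"
    if "r > 0" for r
  proof -
    have "psum n r - (\<Sum>t\<in>T. of_nat (c t) * Xv t ^ (2 * r)) \<in> idl (set ?L)"
      using c(2)[OF that] idl_mono[of "set L" "set ?L"] by auto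
    moreover have "of_nat (c j) * (Xv j ^ (2 * r) - q ^ (2 * r)) \<in> idl (set ?L)"
      by (rule idl_mult_left[OF jq])
    ultimately have "psum n r - (\<Sum>t\<in>T. of_nat (c t) * Xv t ^ (2 * r))
        + of_nat (c j) * (Xv j ^ (2 * r) - q ^ (2 * r)) \<in> idl (set ?L)" by (rule idl_add)
    moreover have "(\<Sum>t\<in>T. of_nat (c t) * Xv t ^ (2 * r))
        = of_nat (c j) * Xv j ^ (2 * r) + (\<Sum>t\<in>?T. of_nat (c t) * Xv t ^ (2 * r))"
      by (rule sum.remove[OF finT step(2)])
    ultimately show ?thesis by (simp add: algebra_simps)
  qed
  show ?case
  proof (cases "q = 0")
    case True
    then show ?thesis using c(1) red by (intro exI[of _ c]) (auto simp: zero_power)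
  next
    case False
    then obtain i where i: "i \<in> ?T" "q = Xv i \<or> q = - Xv i" using step(3) by blast
    have qp: "q ^ (2 * r) = Xv i ^ (2 * r)" for r using i(2) by auto
    let ?c = "c(i := c i + c j)"
    have eq: "(\<Sum>t\<in>?T. of_nat (?c t) * Xv t ^ (2 * r))
        = (\<Sum>t\<in>?T. of_nat (c t) * Xv t ^ (2 * r)) + of_nat (c j) * q ^ (2 * r)" for r
    proof -
      have f: "finite ?T" using finT by simp
      have "(\<Sum>t\<in>?T - {i}. of_nat (?c t) * Xv t ^ (2 * r)) = (\<Sum>t\<in>?T - {i}. of_nat (c t) * Xv t ^ (2 * r))"
        by (rule sum.cong) auto
      then show ?thesis
        by (subst (1 2) sum.remove[OF f i(1)]) (simp add: qp distrib_right add_ac)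
    qed
    show ?thesis using c(1) red by (intro exI[of _ ?c]) (simp add: eq del: fun_upd_apply, simp)
  qed
qed

section \<open>Regular sequences of linear forms and power sums\<close>

lemma hom_psum: "hom_of_deg (2 * r) (psum n r)"
  unfolding psum_def using hom_power[OF hom_Xv] by (intro hom_sum) (metis mult.right_neutral)

lemma pos_hom_psum: "r > 0 \<Longrightarrow> pos_hom (psum n r)"
  using hom_psum[of r n] unfolding pos_hom_def by (metis mult_pos_pos zero_less_numeral)

lemma nzd_of_nat:
  assumes "c > 0" shows "nzd (idl S) (of_nat c :: cpoly)"
  unfolding nzd_def
proof (intro allI impI)
  fix g assume "of_nat c * g \<in> idl S"
  then have "cconst (1 / of_nat c) * (of_nat c * g) \<in> idl S" by (rule idl_mult_left)
  moreover have "cconst (1 / of_nat c) * (of_nat c :: cpoly) = 1"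
    using assms by (simp add: cconst_of_nat[symmetric] cconst_mult[symmetric])
  ultimately show "g \<in> idl S" by (simp add: mult.assoc[symmetric])
qed

text \<open>Differences of squares split into \<open>Xv j - Xv i\<close> and
  \<open>Xv j + Xv i\<close>; the value \<open>q = 0\<close> accounts for the factor
  \<open>Xv j\<close>.\<close>

lemma nzd_linear_forms:
  assumes fin: "finite V" and j: "\<And>q. q \<in> insert 0 (\<Union>i\<in>V. {Xv i, - Xv i}) \<Longrightarrow> nzd I (Xv j - q)"
  shows "nzd I (Xv j * (\<Prod>i\<in>V. Xv j ^ 2 - Xv i ^ 2))"
proof (intro nzd_mult nzd_prod)
  show "nzd I (Xv j)" using j[of 0] by simp
next
  fix i assume i: "i \<in> V"
  have eq: "Xv j ^ 2 - Xv i ^ 2 = (Xv j - Xv i) * (Xv j - (- Xv i))"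
    by (simp add: power2_eq_square algebra_simps)
  show "nzd I (Xv j ^ 2 - Xv i ^ 2)" unfolding eq
    by (intro nzd_mult j) (use i in auto)
qed

text \<open>Induction on the number of surviving variables. For any survivor \<open>j\<close>, the
  next power sum is, modulo the other entries, a positive multiple of \<open>Xv j ^ 2\<close> times
  the differences of squares with the other survivors. Each linear factor of this prolongs
  \<open>L\<close> by an elimination step, where the induction hypothesis applies.\<close>

lemma regular_eliminates_psum:
  "eliminates n T L \<Longrightarrow> card T = m \<Longrightarrow> regular (L @ map (psum n) [1..<Suc m])"
proof (induction m arbitrary: T L)
  case 0
  then show ?case using eliminates_regular by simp
next
  case (Suc m)
  let ?R = "L @ map (psum n) [1..<Suc m]"
  have finT: "finite T" using eliminates_subset[OF Suc.prems(1)] finite_subset by blast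
  obtain j where j: "j \<in> T" using Suc.prems(2) by fastforce
  have r: "regular ((Xv j - q) # ?R)" if "q \<in> insert 0 (\<Union>i\<in>T - {j}. {Xv i, - Xv i})" for q
    using Suc.IH[OF eliminates.step[OF Suc.prems(1) j that]] Suc.prems(2) j by simp
  then have nl: "nzd (idl (set ?R)) (Xv j - q)" if "q \<in> insert 0 (\<Union>i\<in>T - {j}. {Xv i, - Xv i})" for q
    using that regular.simps(2) by blast
  have reg: "regular ?R" using r[of 0] by simp
  obtain c where c: "\<forall>t\<in>T. c t > (0::nat)"
    "\<And>r. r > 0 \<Longrightarrow> psum n r - (\<Sum>t\<in>T. of_nat (c t) * Xv t ^ (2 * r)) \<in> idl (set L)"
    using eliminates_psum[OF Suc.prems(1)] by blast
  let ?w = "\<lambda>r. \<Sum>t\<in>T. of_nat (c t) * (Xv t ^ 2) ^ r"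
  have w: "psum n r - ?w r \<in> idl (set ?R)" if "r > 0" for r
    using c(2)[OF that] idl_mono[of "set L" "set ?R"] by (auto simp: power_mult)
  have w0: "?w s \<in> idl (set ?R)" if "s \<in> {1..m}" for s
  proof -
    have "psum n s \<in> set ?R" using that by (auto simp del: upt_Suc)
    then have "psum n s \<in> idl (set ?R)" by (rule idl_base)
    moreover have "s > 0" using that by simp
    ultimately show ?thesis using idl_cong_mem[OF w[of s]] by blast
  qed
  let ?V = "T - {j}"
  have cV: "card ?V = m" using Suc.prems(2) j by simp
  let ?F = "of_nat (c j) * (Xv j ^ 2 * (\<Prod>i\<in>?V. Xv j ^ 2 - Xv i ^ 2))"
  \<comment> \<open>All summands with \<open>t\<close> other than \<open>j\<close> contain the
    factor with \<open>i = t\<close> and vanish.\<close>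
  have "(\<Sum>t\<in>T. of_nat (c t) * (Xv t ^ 2 * (\<Prod>i\<in>?V. Xv t ^ 2 - Xv i ^ 2))) = ?F"
  proof -
    have "(\<Sum>t\<in>?V. of_nat (c t) * (Xv t ^ 2 * (\<Prod>i\<in>?V. Xv t ^ 2 - Xv i ^ 2))) = (0::cpoly)"
    proof (rule sum.neutral, rule ballI)
      fix t assume "t \<in> ?V"
      then have "(\<Prod>i\<in>?V. Xv t ^ 2 - Xv i ^ 2) = 0" using finT by (intro prod_zero) auto
      then show "of_nat (c t) * (Xv t ^ 2 * (\<Prod>i\<in>?V. Xv t ^ 2 - Xv i ^ 2)) = (0::cpoly)" by simp
    qed
    then show ?thesis by (subst sum.remove[OF finT j]) simp
  qed
  moreover have "idl ((\<lambda>s. ?w s) ` {1..card ?V}) \<subseteq> idl (set ?R)"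
    unfolding cV by (intro idl_subset image_subsetI w0)
  ultimately have "?w (Suc m) - ?F \<in> idl (set ?R)"
    using weighted_power_sum_mem[of ?V "\<lambda>t. of_nat (c t)" "\<lambda>t. Xv t ^ 2" T] finT cV by auto
  from idl_add[OF this w[of "Suc m"]] have "psum n (Suc m) - ?F \<in> idl (set ?R)" by simp
  from idl_neg[OF this] have F: "?F - psum n (Suc m) \<in> idl (set ?R)" by simp
  have "nzd (idl (set ?R)) ?F"
  proof -
    have "nzd (idl (set ?R)) (Xv j * (\<Prod>i\<in>?V. Xv j ^ 2 - Xv i ^ 2))"
      by (rule nzd_linear_forms) (use finT nl in auto)
    \<comment> \<open>The square in \<open>Xv j ^ 2\<close> calls for \<open>Xv j\<close> once more
      than \<open>nzd_linear_forms\<close> provides.\<close>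
    moreover have "nzd (idl (set ?R)) (Xv j)" using nl[of 0] unfolding diff_0_right by blast
    ultimately have "nzd (idl (set ?R)) (of_nat (c j) * (Xv j * (Xv j * (\<Prod>i\<in>?V. Xv j ^ 2 - Xv i ^ 2))))"
      using c(1) j by (intro nzd_mult[OF nzd_of_nat nzd_mult]) blast+
    then show ?thesis by (simp add: power2_eq_square mult.assoc)
  qed
  from nzd_cong[OF this F] have "regular (psum n (Suc m) # ?R)" using reg by simp
  moreover have "\<forall>s\<in>set (psum n (Suc m) # ?R). pos_hom s"
    using eliminates_pos_hom[OF Suc.prems(1)] pos_hom_psum by auto
  ultimately show ?case by (rule regular_perm[rotated]) simp
qed

text \<open>The index sets are a parameter because two choices occur: \<open>{1..<j} - J\<close> in
  the colon ideal and one constant set in the interpolating forms.\<close>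

definition uprod :: "(nat \<Rightarrow> nat set) \<Rightarrow> nat \<Rightarrow> cpoly" where
  "uprod D j = Xv j * (\<Prod>l\<in>D j. Xv j ^ 2 - Xv l ^ 2)"

lemma pos_hom_uprod: "pos_hom (uprod D j)"
proof -
  have "hom_of_deg (1 + (\<Sum>l\<in>D j. 2 * 1)) (uprod D j)"
    unfolding uprod_def by (intro hom_mult hom_Xv hom_prod hom_diff hom_power)
  then show ?thesis unfolding pos_hom_def by (intro exI) auto
qed

text \<open>Each linear factor of \<open>uprod D j\<close> is an elimination step that removes
  \<open>j\<close> from \<open>T\<close>, so induction on \<open>js\<close> applies after a
  permutation. As the sets \<open>D\<close> avoid \<open>js\<close>, they stay inside the surviving
  indices.\<close>

lemma regular_uprod_eliminates_psum:
  "eliminates n T L \<Longrightarrow> distinct js \<Longrightarrow> set js \<subseteq> T \<Longrightarrow> \<forall>j\<in>set js. D j \<subseteq> T - set js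
    \<Longrightarrow> card T = length js + m \<Longrightarrow> regular (map (uprod D) js @ L @ map (psum n) [1..<Suc m])"
proof (induction js arbitrary: T L)
  case Nil
  then show ?case using regular_eliminates_psum by simp
next
  case (Cons j js)
  let ?R = "map (uprod D) js @ L @ map (psum n) [1..<Suc m]"
  have finT: "finite T" using eliminates_subset[OF Cons.prems(1)] finite_subset by blast
  have j: "j \<in> T" using Cons.prems by simp
  have ph: "\<forall>s\<in>set ?R. pos_hom s"
    using eliminates_pos_hom[OF Cons.prems(1)] pos_hom_psum pos_hom_uprod by auto
  have r: "regular ((Xv j - q) # ?R)" if q: "q \<in> insert 0 (\<Union>i\<in>T - {j}. {Xv i, - Xv i})" for q
  proof -
    let ?M = "map (uprod D) js @ ((Xv j - q) # L) @ map (psum n) [1..<Suc m]"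
    have "regular ?M"
    proof (rule Cons.IH[OF eliminates.step[OF Cons.prems(1) j q]])
      show "card (T - {j}) = length js + m" using Cons.prems(5) j finT by simp
    qed (use Cons.prems in auto)
    moreover have "pos_hom (Xv j - q)" using hom_linear_form[OF q] by (auto simp: pos_hom_def)
    then have "\<forall>s\<in>set ?M. pos_hom s" using ph by auto
    ultimately show ?thesis by (rule regular_perm[rotated]) simp
  qed
  have "nzd (idl (set ?R)) (Xv j * (\<Prod>l\<in>D j. Xv j ^ 2 - Xv l ^ 2))"
  proof (rule nzd_linear_forms)
    show "finite (D j)" using Cons.prems(4) finT finite_subset by (metis finite_Diff list.set_intros(1))
    fix q assume "q \<in> insert 0 (\<Union>i\<in>D j. {Xv i, - Xv i})"
    then have "q \<in> insert 0 (\<Union>i\<in>T - {j}. {Xv i, - Xv i})" using Cons.prems(4) by auto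
    from r[OF this] show "nzd (idl (set ?R)) (Xv j - q)" by simp
  qed
  then have "nzd (idl (set ?R)) (uprod D j)" by (simp only: uprod_def)
  then show ?case using r[of 0] by simp
qed

section \<open>Generators of an ideal containing the colon ideal\<close>

definition colon_gens :: "nat \<Rightarrow> nat set \<Rightarrow> cpoly set" where
  "colon_gens n J = psum n ` {1..n - card J} \<union> uprod (\<lambda>j. {1..<j} - J) ` J"

text \<open>Insert the largest element \<open>b\<close> and let \<open>f\<close> be its factor in
  \<open>fJ\<close>. With \<open>f * g = m * psum n N\<close> and
  \<open>psum n N = f * uprod D b\<close> modulo \<open>S\<close>, cancelling \<open>f\<close> gives
  \<open>g = m * uprod D b\<close> modulo \<open>S\<close>.\<close>

theorem colon_fJ_subset:
  assumes "J \<subseteq> {1..n}" "fJ n J * g \<in> idl (psum n ` {1..n})"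
  shows "g \<in> idl (colon_gens n J)"
proof -
  have "finite J" using assms(1) finite_subset by blast
  then show ?thesis using assms
  proof (induction J arbitrary: g rule: finite_linorder_max_induct)
    case empty
    then show ?case by (simp add: fJ_def colon_gens_def)
  next
    case (insert b A)
    define N where "N = n - card A"
    define D where "D = (\<lambda>j. {1..<j} - A)"
    have bA: "b \<notin> A" and bn: "b \<in> {1..n}" using insert by auto
    have "card (insert b A) \<le> n" using insert.prems(1) card_mono[of "{1..n}" "insert b A"] by simp
    then have cA: "card A < n" using insert.hyps(1) bA by simp
    have N: "N > 0" "n - card (insert b A) = N - 1" using cA insert.hyps(1) bA by (auto simp: N_def)
    define f where "f = Xv b * (\<Prod>i\<in>{b<..n}. Xv b ^ 2 - Xv i ^ 2)"
    define S where "S = psum n ` {1..N - 1} \<union> uprod D ` A"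
    let ?u = "uprod D b"
    have "{1..N} = insert N {1..N - 1}" using N by auto
    then have gA: "colon_gens n A = insert (psum n N) S"
      by (simp add: colon_gens_def N_def[symmetric] S_def D_def)
    \<comment> \<open>No \<open>j\<close> in \<open>insert b A\<close> exceeds \<open>b\<close>, so
      \<open>b\<close> is absent from \<open>{1..<j}\<close> and removing it changes
      nothing.\<close>
    have "uprod (\<lambda>j. {1..<j} - insert b A) j = uprod D j" if "j \<in> insert b A" for j
    proof -
      have "{1..<j} - insert b A = {1..<j} - A" using that insert.hyps(2) by fastforce
      then show ?thesis by (simp add: uprod_def D_def)
    qed
    then have gbA: "colon_gens n (insert b A) = insert ?u S"
      unfolding colon_gens_def N(2) S_def by (auto simp: image_def)
    have "fJ n (insert b A) * g = fJ n A * (f * g)"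
      using insert.hyps(1) bA by (simp add: fJ_def f_def mult_ac)
    then have "fJ n A * (f * g) \<in> idl (psum n ` {1..n})" using insert.prems(2) by metis
    then have "f * g \<in> idl (insert (psum n N) S)"
      using insert.IH[of "f * g"] insert.prems(1) gA by simp
    then obtain m where m: "f * g - m * psum n N \<in> idl S" using idl_insert_iff by blast
    have pN: "psum n N - f * ?u \<in> idl S"
    proof -
      \<comment> \<open>\<open>?V\<close> has \<open>N - 1\<close> elements, hence the interpolation
        identity reaches exactly \<open>psum n N\<close>. The summand of \<open>b\<close> is
        \<open>f * ?u\<close>, those of \<open>?V\<close> vanish and those of \<open>A\<close> lie
        in the ideal of \<open>S\<close>.\<close>
      let ?V = "{1..n} - A - {b}"
      let ?h = "\<lambda>t. Xv t ^ 2 * (\<Prod>i\<in>?V. Xv t ^ 2 - Xv i ^ 2)"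
      have fV: "finite ?V" by simp
      have An: "A \<subseteq> {1..n}" using insert.prems by simp
      have cV: "card ?V = N - 1" using An bA bn by (simp add: card_Diff_subset N_def finite_subset[OF An])
      have "idl ((\<lambda>s. \<Sum>t\<in>{1..n}. 1 * (Xv t ^ 2) ^ s) ` {1..card ?V}) \<subseteq> idl S"
        unfolding cV by (rule idl_mono) (auto simp: S_def psum_def power_mult)
      moreover have "(\<Sum>t\<in>{1..n}. 1 * (Xv t ^ 2) ^ Suc (card ?V)) = psum n N"
        unfolding cV using N by (simp add: psum_def power_mult)
      ultimately have "psum n N - (\<Sum>t\<in>{1..n}. ?h t) \<in> idl S"
        using weighted_power_sum_mem[OF fV, of "\<lambda>_. 1" "\<lambda>t. Xv t ^ 2" "{1..n}"] by auto
      moreover have "(\<Sum>t\<in>{1..n}. ?h t) - f * ?u \<in> idl S"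
      proof -
        have "{1..n} = insert b (?V \<union> A)" using An bn by auto
        then have "(\<Sum>t\<in>{1..n}. ?h t) = ?h b + (\<Sum>t\<in>?V \<union> A. ?h t)"
          using bA insert.hyps(1) fV by (metis (no_types, lifting) Diff_iff UnE finite_UnI insertI1 sum.insert)
        also have "(\<Sum>t\<in>?V \<union> A. ?h t) = (\<Sum>t\<in>?V. ?h t) + (\<Sum>t\<in>A. ?h t)"
          using insert.hyps(1) by (intro sum.union_disjoint) auto
        also have "(\<Sum>t\<in>?V. ?h t) = 0"
        proof (rule sum.neutral, rule ballI)
          fix t assume "t \<in> ?V"
          then have "(\<Prod>i\<in>?V. Xv t ^ 2 - Xv i ^ 2) = 0" using fV by (intro prod_zero) auto
          then show "?h t = 0" by simp
        qed
        also have "?h b = f * ?u"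
        proof -
          have V: "?V = {b<..n} \<union> D b" using bn bA insert.hyps(2) by (auto simp: D_def)
          have "(\<Prod>i\<in>?V. Xv b ^ 2 - Xv i ^ 2) = (\<Prod>i\<in>{b<..n}. Xv b ^ 2 - Xv i ^ 2) * (\<Prod>i\<in>D b. Xv b ^ 2 - Xv i ^ 2)"
            unfolding V by (intro prod.union_disjoint) (auto simp: D_def)
          then show ?thesis by (simp add: f_def uprod_def power2_eq_square mult_ac)
        qed
        finally have "(\<Sum>t\<in>{1..n}. ?h t) - f * ?u = (\<Sum>t\<in>A. ?h t)" by simp
        moreover have "?h t \<in> idl S" if t: "t \<in> A" for t
        proof -
          \<comment> \<open>All elements of \<open>D t\<close> are below \<open>t < b\<close> and
            outside \<open>A\<close>, so \<open>uprod D t\<close> divides the summand.\<close>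
          have "D t \<subseteq> ?V" using t insert.hyps(2) bn by (force simp: D_def)
          then have "(\<Prod>i\<in>D t. Xv t ^ 2 - Xv i ^ 2) dvd (\<Prod>i\<in>?V. Xv t ^ 2 - Xv i ^ 2)"
            by (rule prod_dvd_prod_subset[OF fV])
          then have "uprod D t dvd ?h t"
            unfolding uprod_def power2_eq_square by (intro mult_dvd_mono) auto
          moreover have "uprod D t \<in> idl S" using t by (intro idl_base) (simp add: S_def)
          ultimately show ?thesis using idl_dvd by blast
        qed
        ultimately show ?thesis using idl_sum[of A ?h S] by simp
      qed
      ultimately have "(psum n N - (\<Sum>t\<in>{1..n}. ?h t)) + ((\<Sum>t\<in>{1..n}. ?h t) - f * ?u) \<in> idl S"
        by (rule idl_add)
      then show ?thesis by simp
    qed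
    have "nzd (idl S) f" unfolding f_def
    proof (rule nzd_linear_forms)
      fix q assume "q \<in> insert 0 (\<Union>i\<in>{b<..n}. {Xv i, - Xv i})"
      then have q: "q \<in> insert 0 (\<Union>i\<in>{1..n} - {b}. {Xv i, - Xv i})" by fastforce
      \<comment> \<open>A linear factor of \<open>f\<close> eliminates \<open>Xv b\<close>; the
        remaining \<open>n - 1\<close> indices split into \<open>card A\<close> for the products and
        \<open>N - 1\<close> for the power sums.\<close>
      have e: "eliminates n ({1..n} - {b}) [Xv b - q]"
        using eliminates.step[OF eliminates.base bn q] by simp
      let ?js = "sorted_list_of_set A" and ?P = "map (psum n) [1..<Suc (N - 1)]"
      have js: "set ?js = A" "distinct ?js" "length ?js = card A" using insert.hyps(1) by auto
      let ?M = "map (uprod D) ?js @ [Xv b - q] @ ?P"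
      have "regular ?M"
      proof (rule regular_uprod_eliminates_psum[OF e])
        show "\<forall>j\<in>set ?js. D j \<subseteq> {1..n} - {b} - set ?js"
          using js insert.hyps(2) bn by (force simp: D_def)
        show "card ({1..n} - {b}) = length ?js + (N - 1)" using js bn cA by (simp add: N_def)
      qed (use js insert.prems bA in auto)
      moreover have "\<forall>s\<in>set ?M. pos_hom s"
        using eliminates_pos_hom[OF e] pos_hom_psum pos_hom_uprod by auto
      ultimately have "regular ((Xv b - q) # map (uprod D) ?js @ ?P)" by (rule regular_perm[rotated]) simp
      moreover have "set (map (uprod D) ?js @ ?P) = S"
        using js by (auto simp: S_def)
      ultimately show "nzd (idl S) (Xv b - q)" by (metis regular.simps(2))
    qed simp
    moreover have "f * (g - m * ?u) \<in> idl S"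
    proof -
      have "f * (g - m * ?u) = (f * g - m * psum n N) + m * (psum n N - f * ?u)"
        by (simp add: algebra_simps)
      then show ?thesis using m pN by (metis idl_add idl_mult_left)
    qed
    ultimately have "g - m * ?u \<in> idl S" by (simp add: nzd_def)
    then show ?case unfolding gbA using idl_insert_iff by blast
  qed
qed

section \<open>Invariant polynomials\<close>

text \<open>For \<open>r > n\<close> the product over all \<open>n\<close> indices vanishes at each
  of them, so the interpolation identity with weights of exponent \<open>k\<close> expresses
  \<open>psum n r\<close> by the preceding \<open>n\<close> power sums, whose exponents are still
  positive.\<close>

lemma psum_mem:
  assumes "r > 0" shows "psum n r \<in> idl (psum n ` {1..n})"
  using assms
proof (induction r rule: less_induct)
  case (less r)
  show ?case
  proof (cases "r \<le> n")
    case True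
    then show ?thesis using less.prems by (intro idl_base) auto
  next
    case False
    define k where "k = r - Suc n"
    have r: "r = k + Suc n" using False by (simp add: k_def)
    let ?w = "\<lambda>t. (Xv t ^ 2) ^ k"
    have z: "(\<Sum>t\<in>{1..n}. ?w t * (Xv t ^ 2 * (\<Prod>i\<in>{1..n}. Xv t ^ 2 - Xv i ^ 2))) = 0"
    proof (rule sum.neutral, rule ballI)
      fix t assume "t \<in> {1..n}"
      then have "(\<Prod>i\<in>{1..n}. Xv t ^ 2 - Xv i ^ 2) = 0" by (intro prod_zero) auto
      then show "?w t * (Xv t ^ 2 * (\<Prod>i\<in>{1..n}. Xv t ^ 2 - Xv i ^ 2)) = 0" by simp
    qed
    have p: "(\<Sum>t\<in>{1..n}. ?w t * (Xv t ^ 2) ^ s) = psum n (k + s)" for s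
      by (simp only: psum_def power_mult power_add)
    have "psum n r \<in> idl ((\<lambda>s. psum n (k + s)) ` {1..n})"
      using weighted_power_sum_mem[of "{1..n}" ?w "\<lambda>t. Xv t ^ 2" "{1..n}"]
      unfolding p z r by simp
    moreover have "idl ((\<lambda>s. psum n (k + s)) ` {1..n}) \<subseteq> idl (psum n ` {1..n})"
      by (intro idl_subset image_subsetI less.IH) (auto simp: r)
    ultimately show ?thesis by blast
  qed
qed

section \<open>Signed permutations and orbit sums\<close>

lemma signed_perms_range: "\<pi> \<in> signed_perms n \<Longrightarrow> i \<in> {1..n} \<Longrightarrow> nat \<bar>\<pi> i\<bar> \<in> {1..n}"
  unfolding signed_perms_def by (auto dest: bij_betwE)

lemma finite_signed_perms: "finite (signed_perms n)"
proof -
  \<comment> \<open>Subtracting the identity gives functions that vanish outside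
    \<open>{1..n}\<close> and have bounded values, of which there are finitely many.\<close>
  let ?h = "\<lambda>\<pi> i. \<pi> i - int i"
  have "?h ` signed_perms n \<subseteq> {f. \<forall>i. (i \<in> {1..n} \<longrightarrow> f i \<in> {- (2 * int n)..2 * int n}) \<and> (i \<notin> {1..n} \<longrightarrow> f i = 0)}"
  proof (clarify, intro conjI impI)
    fix \<pi> i assume \<pi>: "\<pi> \<in> signed_perms n"
    show "\<pi> i - int i \<in> {- (2 * int n)..2 * int n}" if "i \<in> {1..n}"
      using signed_perms_range[OF \<pi> that] that by auto
    show "\<pi> i - int i = 0" if "i \<notin> {1..n}" using \<pi> that by (auto simp: signed_perms_def)
  qed
  then have "finite (?h ` signed_perms n)"
    by (rule finite_subset) (intro finite_set_of_finite_funs, auto)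
  moreover have "inj_on ?h (signed_perms n)" by (rule inj_onI) (simp add: fun_eq_iff)
  ultimately show ?thesis by (rule finite_imageD)
qed

lemma id_signed_perms: "int \<in> signed_perms n"
  by (auto simp: signed_perms_def bij_betw_def)

lemma signed_perms_swap:
  assumes "\<pi> \<in> signed_perms n" "k \<in> {1..n}" "l \<in> {1..n}"
  shows "\<pi> \<circ> id(k := l, l := k) \<in> signed_perms n"
proof -
  let ?\<tau> = "id(k := l, l := k)"
  have "bij_betw ?\<tau> {1..n} {1..n}"
    by (rule bij_betw_byWitness[where f' = ?\<tau>]) (use assms in auto)
  moreover have "bij_betw (\<lambda>i. nat \<bar>\<pi> i\<bar>) {1..n} {1..n}" using assms by (simp add: signed_perms_def)
  ultimately have "bij_betw ((\<lambda>i. nat \<bar>\<pi> i\<bar>) \<circ> ?\<tau>) {1..n} {1..n}" by (rule bij_betw_trans)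
  then show ?thesis using assms by (auto simp: signed_perms_def o_def)
qed

lemma signed_perms_flip:
  assumes "\<pi> \<in> signed_perms n" "k \<in> {1..n}"
  shows "\<pi>(k := - \<pi> k) \<in> signed_perms n"
proof -
  have "(\<lambda>i. nat \<bar>(\<pi>(k := - \<pi> k)) i\<bar>) = (\<lambda>i. nat \<bar>\<pi> i\<bar>)" by auto
  then show ?thesis using assms by (simp add: signed_perms_def)
qed

lemma Xs_square: "Xs k ^ 2 = Xv (nat \<bar>k\<bar>) ^ 2"
  by (auto simp: Xs_def)

lemma Xs_neg: "k \<noteq> 0 \<Longrightarrow> Xs (- k) = - Xs k"
  by (auto simp: Xs_def)

lemma psum_perm:
  assumes "\<pi> \<in> signed_perms n" shows "psum n m = (\<Sum>l\<in>{1..n}. (Xs (\<pi> l) ^ 2) ^ m)"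
proof -
  have "bij_betw (\<lambda>i. nat \<bar>\<pi> i\<bar>) {1..n} {1..n}" using assms by (simp add: signed_perms_def)
  from sum.reindex_bij_betw[OF this, of "\<lambda>i. (Xv i ^ 2) ^ m"]
  show ?thesis by (simp add: psum_def power_mult Xs_square)
qed

text \<open>Induction on the size of \<open>U\<close>. Multiply the terms for \<open>U - {k}\<close>
  by the power sum of exponent \<open>b k\<close>: the indices inside \<open>U - {k}\<close> give
  sums over fewer variables with positive exponents, and all others give the wanted sum, by
  symmetry. A positive integer multiple of it thus lies in the ideal.\<close>

lemma orbit_sum_mem:
  assumes "finite U" "U \<subseteq> {1..n}" "U \<noteq> {}" "\<forall>i\<in>U. b i > 0"
  shows "(\<Sum>\<pi>\<in>signed_perms n. \<Prod>i\<in>U. (Xs (\<pi> i) ^ 2) ^ b i) \<in> idl (psum n ` {1..n})"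
  using assms
proof (induction "card U" arbitrary: U b)
  case (Suc m)
  then obtain k where k: "k \<in> U" by blast
  define U' where "U' = U - {k}"
  have U: "U = insert k U'" "k \<notin> U'" "finite U'" using k Suc.prems(1) by (auto simp: U'_def)
  have kn: "k \<in> {1..n}" and U'n: "U' \<subseteq> {1..n}" using Suc.prems(2) U by auto
  let ?G = "signed_perms n" and ?I = "idl (psum n ` {1..n})"
  define Q where "Q \<pi> = (\<Prod>i\<in>U'. (Xs (\<pi> i) ^ 2) ^ b i)" for \<pi>
  define S where "S l = (\<Sum>\<pi>\<in>?G. Q \<pi> * (Xs (\<pi> l) ^ 2) ^ b k)" for l
  have goal: "(\<Sum>\<pi>\<in>?G. \<Prod>i\<in>U. (Xs (\<pi> i) ^ 2) ^ b i) = S k"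
    unfolding S_def Q_def U(1) using U(2,3) by (simp add: mult.commute)
  have in1: "S l \<in> ?I" if l: "l \<in> U'" for l
  proof -
    let ?b = "b(l := b l + b k)"
    have "Q \<pi> * (Xs (\<pi> l) ^ 2) ^ b k = (\<Prod>i\<in>U'. (Xs (\<pi> i) ^ 2) ^ ?b i)" for \<pi>
    proof -
      have "(\<Prod>i\<in>U' - {l}. (Xs (\<pi> i) ^ 2) ^ ?b i) = (\<Prod>i\<in>U' - {l}. (Xs (\<pi> i) ^ 2) ^ b i)"
        by (rule prod.cong) auto
      then show ?thesis unfolding Q_def
        by (subst (1 2) prod.remove[OF U(3) l]) (simp add: power_add mult_ac)
    qed
    then have "S l = (\<Sum>\<pi>\<in>?G. \<Prod>i\<in>U'. (Xs (\<pi> i) ^ 2) ^ ?b i)" by (simp add: S_def)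
    also have "\<dots> \<in> ?I"
    proof (rule Suc.hyps(1))
      show "m = card U'" using Suc.hyps(2) U by simp
      show "\<forall>i\<in>U'. ?b i > 0" using Suc.prems(4) U(1) by auto
    qed (use U U'n l in auto)
    finally show ?thesis .
  qed
  have eq: "S l = S k" if l: "l \<in> {1..n} - U'" for l
  proof -
    \<comment> \<open>The transposition of \<open>k\<close> and \<open>l\<close> fixes
      \<open>U'\<close> pointwise, hence leaves \<open>Q\<close> unchanged and carries one sum into
      the other.\<close>
    define \<tau> where "\<tau> = id(k := l, l := k)"
    have inv: "\<tau> \<circ> \<tau> = id" by (auto simp: \<tau>_def)
    have "\<tau> i = i" if "i \<in> U'" for i using that l U(2) by (auto simp: \<tau>_def)
    then have Q\<tau>: "Q (\<pi> \<circ> \<tau>) = Q \<pi>" for \<pi> by (simp add: Q_def)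
    show ?thesis unfolding S_def
    proof (rule sum.reindex_bij_witness[where i = "\<lambda>\<pi>. \<pi> \<circ> \<tau>" and j = "\<lambda>\<pi>. \<pi> \<circ> \<tau>"])
      show "\<pi> \<circ> \<tau> \<circ> \<tau> = \<pi>" for \<pi> :: "nat \<Rightarrow> int" by (simp add: comp_assoc inv)
      then show "\<pi> \<circ> \<tau> \<circ> \<tau> = \<pi>" for \<pi> :: "nat \<Rightarrow> int" .
      show "\<pi> \<circ> \<tau> \<in> ?G" if "\<pi> \<in> ?G" for \<pi>
        unfolding \<tau>_def by (rule signed_perms_swap) (use that kn l in auto)
      then show "\<pi> \<circ> \<tau> \<in> ?G" if "\<pi> \<in> ?G" for \<pi> using that .
      show "Q (\<pi> \<circ> \<tau>) * (Xs ((\<pi> \<circ> \<tau>) k) ^ 2) ^ b k = Q \<pi> * (Xs (\<pi> l) ^ 2) ^ b k" for \<pi>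
        unfolding Q\<tau> by (simp add: \<tau>_def)
    qed
  qed
  have "(\<Sum>\<pi>\<in>?G. Q \<pi> * psum n (b k)) \<in> ?I"
    using Suc.prems(4) k by (intro idl_sum idl_mult_left psum_mem) auto
  also have "(\<Sum>\<pi>\<in>?G. Q \<pi> * psum n (b k)) = (\<Sum>\<pi>\<in>?G. \<Sum>l\<in>{1..n}. Q \<pi> * (Xs (\<pi> l) ^ 2) ^ b k)"
    by (intro sum.cong refl) (simp only: psum_perm sum_distrib_left)
  also have "\<dots> = (\<Sum>l\<in>{1..n}. S l)" unfolding S_def by (rule sum.swap)
  also have "\<dots> = (\<Sum>l\<in>U'. S l) + (\<Sum>l\<in>{1..n} - U'. S l)"
    using sum.subset_diff[OF U'n, of S] by (simp add: add.commute)
  also have "(\<Sum>l\<in>{1..n} - U'. S l) = of_nat (card ({1..n} - U')) * S k" using eq by simp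
  finally have "(\<Sum>l\<in>U'. S l) + of_nat (card ({1..n} - U')) * S k \<in> ?I" .
  from idl_diff[OF this idl_sum[of U' S, OF in1]]
  have "of_nat (card ({1..n} - U')) * S k \<in> ?I" by simp
  moreover have "card ({1..n} - U') > 0" using kn U(2) by (auto simp: card_gt_0_iff)
  ultimately show ?case unfolding goal using nzd_of_nat unfolding nzd_def by blast
qed simp

text \<open>Changing the sign of \<open>\<pi> i\<close> is an involution of the group that negates
  each term.\<close>

lemma orbit_sum_odd:
  assumes i: "i \<in> keys a" "odd (lookup a i)" and a: "keys a \<subseteq> {1..n}"
  shows "(\<Sum>\<pi>\<in>signed_perms n. act_mono \<pi> a) = 0"
proof -
  let ?G = "signed_perms n" and ?f = "\<lambda>\<pi> :: nat \<Rightarrow> int. \<pi>(i := - \<pi> i)"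
  have i_n: "i \<in> {1..n}" using i a by blast
  have "act_mono (?f \<pi>) a = - act_mono \<pi> a" if \<pi>: "\<pi> \<in> ?G" for \<pi>
  proof -
    \<comment> \<open>\<open>Xs\<close> is odd only away from zero: index 0 stands for the variable
      \<open>Xv 0\<close>.\<close>
    have "\<pi> i \<noteq> 0" using signed_perms_range[OF \<pi> i_n] by auto
    then have X: "Xs (- \<pi> i) ^ lookup a i = - (Xs (\<pi> i) ^ lookup a i)"
      using i(2) by (simp add: Xs_neg)
    have "(\<Prod>j\<in>keys a - {i}. Xs (?f \<pi> j) ^ lookup a j) = (\<Prod>j\<in>keys a - {i}. Xs (\<pi> j) ^ lookup a j)"
      by (rule prod.cong) auto
    then show ?thesis unfolding act_mono_def
      by (subst (1 2) prod.remove[OF finite_keys i(1)]) (simp add: X)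
  qed
  then have "- (\<Sum>\<pi>\<in>?G. act_mono \<pi> a) = (\<Sum>\<pi>\<in>?G. act_mono (?f \<pi>) a)"
    by (simp add: sum_negf)
  also have "\<dots> = (\<Sum>\<pi>\<in>?G. act_mono \<pi> a)"
    by (rule sum.reindex_bij_witness[where i = ?f and j = ?f]) (auto intro: signed_perms_flip[OF _ i_n])
  finally have neg: "- (\<Sum>\<pi>\<in>?G. act_mono \<pi> a) = (\<Sum>\<pi>\<in>?G. act_mono \<pi> a)" .
  have "2 * (\<Sum>\<pi>\<in>?G. act_mono \<pi> a) = (\<Sum>\<pi>\<in>?G. act_mono \<pi> a) + - (\<Sum>\<pi>\<in>?G. act_mono \<pi> a)"
    by (simp only: neg mult_2)
  then have "2 * (\<Sum>\<pi>\<in>?G. act_mono \<pi> a) = 0" by simp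
  then show ?thesis using mult_eq_0_iff[of "2 :: cpoly"] zero_neq_numeral[where 'a = cpoly] by metis
qed

definition invariants :: "nat \<Rightarrow> cpoly set" where
  "invariants n = {p \<in> Pn n. lookup p 0 = 0 \<and> (\<forall>\<pi>\<in>signed_perms n. pact \<pi> p = p)}"

text \<open>Averaging: \<open>card ?G\<close> times an invariant is a combination of the orbit sums
  of its monomials. Those with an odd exponent vanish, the others are covered by
  \<open>orbit_sum_mem\<close>.\<close>

lemma invariants_subset: "invariants n \<subseteq> idl (psum n ` {1..n})"
proof
  fix f assume f: "f \<in> invariants n"
  let ?G = "signed_perms n" and ?I = "idl (psum n ` {1..n})"
  have mon: "(\<Sum>\<pi>\<in>?G. act_mono \<pi> a) \<in> ?I" if a: "a \<in> keys f" for a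
  proof -
    have an: "keys a \<subseteq> {1..n}" using f a by (auto simp: invariants_def Pn_def)
    have a0: "keys a \<noteq> {}" using f a by (auto simp: invariants_def in_keys_iff)
    show ?thesis
    proof (cases "\<exists>i\<in>keys a. odd (lookup a i)")
      case True
      then show ?thesis using orbit_sum_odd an by (metis idl_zero)
    next
      case False
      have "act_mono \<pi> a = (\<Prod>i\<in>keys a. (Xs (\<pi> i) ^ 2) ^ (lookup a i div 2))" for \<pi>
        unfolding act_mono_def by (rule prod.cong) (use False in \<open>auto simp: power_mult[symmetric]\<close>)
      moreover have "lookup a i div 2 > 0" if "i \<in> keys a" for i
      proof -
        have "even (lookup a i)" "lookup a i \<noteq> 0" using False that by (auto simp: in_keys_iff)
        then show ?thesis by presburger
      qed
      ultimately show ?thesis using orbit_sum_mem[OF finite_keys an a0] by simp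
    qed
  qed
  have "of_nat (card ?G) * f = (\<Sum>\<pi>\<in>?G. pact \<pi> f)" using f by (simp add: invariants_def)
  also have "\<dots> = (\<Sum>a\<in>keys f. cconst (lookup f a) * (\<Sum>\<pi>\<in>?G. act_mono \<pi> a))"
    unfolding pact_def by (subst sum.swap) (simp add: sum_distrib_left)
  also have "\<dots> \<in> ?I" by (intro idl_sum idl_mult_left mon)
  finally have "of_nat (card ?G) * f \<in> ?I" .
  moreover have "card ?G > 0" using finite_signed_perms id_signed_perms card_gt_0_iff by blast
  ultimately show "f \<in> ?I" using nzd_of_nat unfolding nzd_def by blast
qed

lemma IB_eq: "IB n = idl (invariants n) \<inter> Pn n"
  unfolding IB_def invariants_def[symmetric] by (rule pideal_eq) (auto simp: invariants_def)

theorem colon_subset: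
  assumes "J \<subseteq> {1..n}" shows "colon n (IB n) (fJ n J) \<subseteq> idl (colon_gens n J)"
proof
  fix g assume "g \<in> colon n (IB n) (fJ n J)"
  then have "fJ n J * g \<in> idl (invariants n)" by (auto simp: colon_def IB_eq)
  also have "\<dots> \<subseteq> idl (psum n ` {1..n})" by (rule idl_subset[OF invariants_subset])
  finally show "g \<in> idl (colon_gens n J)" by (rule colon_fJ_subset[OF assms])
qed

section \<open>Exterior algebras over a commutative ring\<close>

text \<open>An element is the family of its coefficients with respect to the ordered monomials indexed by
  finite sets of naturals.\<close>
typedef (overloaded) 'a ext = "{f :: nat set \<Rightarrow> 'a::comm_ring_1. \<forall>K. infinite K \<longrightarrow> f K = 0}"
  morphisms coef Ext
  by (rule exI[of _ "\<lambda>_. 0"]) simp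

setup_lifting type_definition_ext

lemma coef_infinite: "infinite K \<Longrightarrow> coef f K = 0"
  using coef[of f] by simp

lemma ext_eqI:
  assumes "\<And>K. finite K \<Longrightarrow> coef f K = coef g K" shows "f = g"
proof -
  have "coef f K = coef g K" for K using assms[of K] coef_infinite[of K f] coef_infinite[of K g] by (cases "finite K") simp_all
  then show ?thesis by (simp add: coef_inject[symmetric] fun_eq_iff)
qed

definition esgn :: "nat set \<Rightarrow> nat set \<Rightarrow> 'a::comm_ring_1" where
  "esgn I J = (-1) ^ card {(i, j). i \<in> I \<and> j \<in> J \<and> j < i}"

lemma esgn_Un_left:
  assumes "finite A" "finite B" "finite C" "A \<inter> B = {}"
  shows "esgn (A \<union> B) C = esgn A C * esgn B C"
proof -
  let ?S = "\<lambda>I. {(i, j). i \<in> I \<and> j \<in> C \<and> j < i}"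
  have f: "finite (?S I)" if "finite I" for I
    by (rule finite_subset[of _ "I \<times> C"]) (use that assms in auto)
  have "?S (A \<union> B) = ?S A \<union> ?S B" by auto
  moreover have "?S A \<inter> ?S B = {}" using assms by auto
  ultimately have "card (?S (A \<union> B)) = card (?S A) + card (?S B)"
    using f assms by (simp add: card_Un_disjoint)
  then show ?thesis by (simp add: esgn_def power_add)
qed

lemma esgn_Un_right:
  assumes "finite A" "finite B" "finite C" "A \<inter> B = {}"
  shows "esgn C (A \<union> B) = esgn C A * esgn C B"
proof -
  let ?S = "\<lambda>I. {(i, j). i \<in> C \<and> j \<in> I \<and> j < i}"
  have f: "finite (?S I)" if "finite I" for I
    by (rule finite_subset[of _ "C \<times> I"]) (use that assms in auto)
  have "?S (A \<union> B) = ?S A \<union> ?S B" by auto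
  moreover have "?S A \<inter> ?S B = {}" using assms by auto
  ultimately have "card (?S (A \<union> B)) = card (?S A) + card (?S B)"
    using f assms by (simp add: card_Un_disjoint)
  then show ?thesis by (simp add: esgn_def power_add)
qed

lemma esgn_less: "(\<And>i j. i \<in> I \<Longrightarrow> j \<in> J \<Longrightarrow> \<not> j < i) \<Longrightarrow> esgn I J = 1"
proof -
  assume "\<And>i j. i \<in> I \<Longrightarrow> j \<in> J \<Longrightarrow> \<not> j < i"
  then have "{(i, j). i \<in> I \<and> j \<in> J \<and> j < i} = {}" by auto
  then show ?thesis unfolding esgn_def by (simp only: card.empty power_0)
qed

lemma esgn_empty [simp]: "esgn {} J = 1" "esgn I {} = 1"
  by (rule esgn_less; simp)+

lemma esgn_greater: "b < m \<Longrightarrow> esgn {m} {b} = -1"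
proof -
  assume "b < m"
  then have "{(i, j). i \<in> {m} \<and> j \<in> {b} \<and> j < i} = {(m, b)}" by auto
  then show ?thesis by (simp add: esgn_def)
qed

instantiation ext :: (comm_ring_1) ring_1
begin

lift_definition zero_ext :: "'a ext" is "\<lambda>_. 0" by simp
lift_definition one_ext :: "'a ext" is "\<lambda>K. if K = {} then 1 else 0" by auto
lift_definition plus_ext :: "'a ext \<Rightarrow> 'a ext \<Rightarrow> 'a ext" is "\<lambda>f g K. f K + g K" by simp
lift_definition uminus_ext :: "'a ext \<Rightarrow> 'a ext" is "\<lambda>f K. - f K" by simp
lift_definition minus_ext :: "'a ext \<Rightarrow> 'a ext \<Rightarrow> 'a ext" is "\<lambda>f g K. f K - g K" by simp
lift_definition times_ext :: "'a ext \<Rightarrow> 'a ext \<Rightarrow> 'a ext" is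
  "\<lambda>f g K. if finite K then \<Sum>I\<in>Pow K. esgn I (K - I) * f I * g (K - I) else 0" by simp

instance
proof
  fix a b c :: "'a ext"
  show "a * b * c = a * (b * c)"
  proof (transfer, rule ext)
    fix f g h :: "nat set \<Rightarrow> 'a" and K
    let ?m = "\<lambda>f g K. if finite K then \<Sum>I\<in>Pow K. esgn I (K - I) * f I * g (K - I) else (0 :: 'a)"
    show "?m (?m f g) h K = ?m f (?m g h) K"
    proof (cases "finite K")
      case True
      have fA: "finite A" if "A \<in> Pow K" for A using that True finite_subset by auto
      have "?m (?m f g) h K = (\<Sum>A\<in>Pow K. \<Sum>I\<in>Pow A.
          esgn A (K - A) * (esgn I (A - I) * f I * g (A - I)) * h (K - A))"
        using True fA by (auto simp: sum_distrib_left sum_distrib_right intro!: sum.cong)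
      also have "\<dots> = (\<Sum>(A, I)\<in>Sigma (Pow K) Pow.
          esgn A (K - A) * (esgn I (A - I) * f I * g (A - I)) * h (K - A))"
        using True fA by (intro sum.Sigma) auto
      \<comment> \<open>Both triple products are sums over ordered partitions of \<open>K\<close>
        into three blocks: a chain \<open>I \<subseteq> A \<subseteq> K\<close> corresponds to the
        pair \<open>(I, A - I)\<close>.\<close>
      also have "\<dots> = (\<Sum>(I, B)\<in>Sigma (Pow K) (\<lambda>I. Pow (K - I)).
          esgn I (K - I) * f I * (esgn B (K - I - B) * g B * h (K - I - B)))"
      proof (rule sum.reindex_bij_witness[where i = "\<lambda>(I, B). (I \<union> B, I)" and j = "\<lambda>(A, I). (I, A - I)"], goal_cases)
        \<comment> \<open>On either side the sign is the product of the three signs between pairs of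
          blocks.\<close>
        case (5 p)
        obtain A I where p: "p = (A, I)" by fastforce
        have AI: "A \<subseteq> K" "I \<subseteq> A" using 5 p by auto
        let ?B = "A - I" and ?C = "K - A"
        have fin: "finite I" "finite ?B" "finite ?C" using True AI by (auto intro: finite_subset)
        have A: "A = I \<union> ?B" using AI by auto
        have s1: "esgn A ?C = esgn I ?C * (esgn ?B ?C :: 'a)"
          using esgn_Un_left[of I ?B ?C] fin A by auto
        have KI: "K - I = ?B \<union> ?C" "K - I - ?B = ?C" using AI by auto
        have s2: "esgn I (K - I) = esgn I ?B * (esgn I ?C :: 'a)"
          unfolding KI(1) by (rule esgn_Un_right) (use fin in auto)
        show ?case unfolding p using s1 s2 KI(2) by (simp add: mult_ac)
      qed auto
      also have "\<dots> = (\<Sum>I\<in>Pow K. \<Sum>B\<in>Pow (K - I).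
          esgn I (K - I) * f I * (esgn B (K - I - B) * g B * h (K - I - B)))"
        using True by (intro sum.Sigma[symmetric]) auto
      also have "\<dots> = ?m f (?m g h) K"
        using True by (auto simp: sum_distrib_left intro!: sum.cong)
      finally show ?thesis .
    qed simp
  qed
  show "1 * a = a"
  proof (transfer, rule ext)
    fix f :: "nat set \<Rightarrow> 'a" and K assume f: "\<forall>K. infinite K \<longrightarrow> f K = 0"
    have "(\<Sum>I\<in>Pow K. esgn I (K - I) * (if I = {} then 1 else 0) * f (K - I)) = f K" if "finite K"
    proof -
      have "(\<Sum>I\<in>Pow K. esgn I (K - I) * (if I = {} then 1 else 0) * f (K - I))
        = (\<Sum>I\<in>Pow K. if I = {} then f K else 0)" by (intro sum.cong) auto
      then show ?thesis using that by (simp add: sum.delta)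
    qed
    then show "(if finite K then \<Sum>I\<in>Pow K. esgn I (K - I) * (if I = {} then 1 else 0) * f (K - I) else 0) = f K"
      using f by auto
  qed
  show "a * 1 = a"
  proof (transfer, rule ext)
    fix f :: "nat set \<Rightarrow> 'a" and K assume f: "\<forall>K. infinite K \<longrightarrow> f K = 0"
    have "(\<Sum>I\<in>Pow K. esgn I (K - I) * f I * (if K - I = {} then 1 else 0)) = f K" if "finite K"
    proof -
      have "(\<Sum>I\<in>Pow K. esgn I (K - I) * f I * (if K - I = {} then 1 else 0))
        = (\<Sum>I\<in>Pow K. if I = K then f K else 0)" by (intro sum.cong) auto
      then show ?thesis using that by (simp add: sum.delta)
    qed
    then show "(if finite K then \<Sum>I\<in>Pow K. esgn I (K - I) * f I * (if K - I = {} then 1 else 0) else 0) = f K"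
      using f by auto
  qed
  show "(a + b) * c = a * c + b * c"
    by transfer (auto simp: fun_eq_iff algebra_simps sum.distrib)
  show "a * (b + c) = a * b + a * c"
    by transfer (auto simp: fun_eq_iff algebra_simps sum.distrib)
  show "(0 :: 'a ext) \<noteq> 1" by transfer (auto simp: fun_eq_iff)
qed (transfer; simp add: fun_eq_iff algebra_simps)+

end

section \<open>Scalars, monomials and supports\<close>

lift_definition scale :: "'a::comm_ring_1 \<Rightarrow> 'a ext \<Rightarrow> 'a ext" (infixr "\<cdot>" 75) is "\<lambda>c f K. c * f K"
  by simp

lift_definition eps :: "nat set \<Rightarrow> 'a::comm_ring_1 ext" is "\<lambda>J K. if K = J \<and> finite J then 1 else 0"
  by auto

lemma coef_simps [simp]:
  "coef 0 K = 0" "coef (f + g) K = coef f K + coef g K" "coef (- f) K = - coef f K"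
  "coef (f - g) K = coef f K - coef g K" "coef (c \<cdot> f) K = c * coef f K"
  by (transfer; simp)+

lemma coef_one: "coef 1 K = (if K = {} then 1 else 0)"
  by transfer simp

lemma coef_eps: "coef (eps J) K = (if K = J \<and> finite J then 1 else 0)"
  by transfer simp

lemma coef_mult:
  "finite K \<Longrightarrow> coef (f * g) K = (\<Sum>I\<in>Pow K. esgn I (K - I) * coef f I * coef g (K - I))"
  by transfer simp

lemma coef_sum: "coef (sum f A) K = (\<Sum>i\<in>A. coef (f i) K)"
  by (induction A rule: infinite_finite_induct) simp_all

lemma scale_simps:
  "c \<cdot> (f + g) = c \<cdot> f + c \<cdot> g" "(c + d) \<cdot> f = c \<cdot> f + d \<cdot> f" "c \<cdot> (d \<cdot> f) = (c * d) \<cdot> f"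
  "1 \<cdot> f = f" "0 \<cdot> f = 0" "c \<cdot> 0 = 0" "(- c) \<cdot> f = - (c \<cdot> f)" "c \<cdot> (- f) = - (c \<cdot> f)"
  by (rule ext_eqI; simp add: algebra_simps)+

lemma scale_mult_left: "(c \<cdot> f) * g = c \<cdot> (f * g)"
  by (rule ext_eqI) (simp add: coef_mult sum_distrib_left mult_ac)

lemma scale_mult_right: "f * (c \<cdot> g) = c \<cdot> (f * g)"
  by (rule ext_eqI) (simp add: coef_mult sum_distrib_left mult_ac)

lemma scale_sum_right: "c \<cdot> sum f A = (\<Sum>i\<in>A. c \<cdot> f i)"
  by (induction A rule: infinite_finite_induct) (simp_all add: scale_simps)

lemma scale_sum_left: "sum c A \<cdot> f = (\<Sum>i\<in>A. c i \<cdot> f)"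
  by (induction A rule: infinite_finite_induct) (simp_all add: scale_simps)

lemma eps_empty [simp]: "eps {} = 1"
  by (rule ext_eqI) (simp add: coef_eps coef_one)

lemma eps_mult:
  assumes "finite I" "finite J"
  shows "eps I * eps J = (if I \<inter> J = {} then esgn I J \<cdot> eps (I \<union> J) else 0)"
proof (rule ext_eqI)
  fix K :: "nat set" assume K: "finite K"
  have "coef (eps I * eps J :: 'a ext) K = (\<Sum>A\<in>Pow K. if A = I then (if K - I = J then esgn I J else 0) else 0)"
    unfolding coef_mult[OF K] using assms by (intro sum.cong) (auto simp: coef_eps)
  also have "\<dots> = (if I \<subseteq> K \<and> K - I = J then esgn I J else 0)" using K by (simp add: sum.delta)
  also have "I \<subseteq> K \<and> K - I = J \<longleftrightarrow> I \<inter> J = {} \<and> K = I \<union> J" by auto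
  finally show "coef (eps I * eps J :: 'a ext) K = coef (if I \<inter> J = {} then esgn I J \<cdot> eps (I \<union> J) else 0) K"
    using assms by (simp add: coef_eps)
qed

definition supported :: "nat set \<Rightarrow> 'a::comm_ring_1 ext \<Rightarrow> bool" where
  "supported U f \<longleftrightarrow> (\<forall>K. coef f K \<noteq> 0 \<longrightarrow> K \<subseteq> U)"

lemma supported_add: "supported U f \<Longrightarrow> supported U g \<Longrightarrow> supported U (f + g)"
  unfolding supported_def by (metis add_0 coef_simps(2))

lemma supported_0: "supported U 0"
  by (simp add: supported_def)

lemma supported_1: "supported U 1"
  by (simp add: supported_def coef_one)

lemma supported_scale: "supported U f \<Longrightarrow> supported U (c \<cdot> f)"
  unfolding supported_def by (metis coef_simps(5) mult_zero_right)

lemma supported_eps: "J \<subseteq> U \<Longrightarrow> supported U (eps J)"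
  by (simp add: supported_def coef_eps)

lemma supported_sum: "(\<And>i. i \<in> A \<Longrightarrow> supported U (f i)) \<Longrightarrow> supported U (sum f A)"
  by (induction A rule: infinite_finite_induct) (auto intro: supported_add supported_0)

lemma supported_mult:
  assumes "supported U f" "supported U g" shows "supported U (f * g)"
  unfolding supported_def
proof (intro allI impI)
  fix K assume K: "coef (f * g) K \<noteq> 0"
  then have "finite K" using coef_infinite by blast
  then obtain I where "I \<subseteq> K" "coef f I \<noteq> 0" "coef g (K - I) \<noteq> 0"
    using K unfolding coef_mult[OF \<open>finite K\<close>]
    by (metis (no_types, lifting) PowD mult_zero_left mult_zero_right sum.neutral)
  then show "K \<subseteq> U" using assms unfolding supported_def by blast
qed

lemma eps_expand:
  assumes "finite U" "supported U f" shows "f = (\<Sum>J\<in>Pow U. coef f J \<cdot> eps J)"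
proof (rule ext_eqI)
  fix K :: "nat set" assume K: "finite K"
  have "coef (\<Sum>J\<in>Pow U. coef f J \<cdot> eps J) K = (\<Sum>J\<in>Pow U. if J = K then coef f K else 0)"
    unfolding coef_sum using K by (intro sum.cong) (auto simp: coef_eps)
  then show "coef f K = coef (\<Sum>J\<in>Pow U. coef f J \<cdot> eps J) K"
    using assms by (auto simp: sum.delta supported_def)
qed

section \<open>Degree-one elements and their ordered products\<close>

definition odd1 :: "'a::comm_ring_1 ext \<Rightarrow> bool" where
  "odd1 v \<longleftrightarrow> (\<forall>K. coef v K \<noteq> 0 \<longrightarrow> (\<exists>r. K = {r}))"

lemma odd1_add: "odd1 v \<Longrightarrow> odd1 w \<Longrightarrow> odd1 (v + w)"
  unfolding odd1_def by (metis add_0 coef_simps(2))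

lemma odd1_scale: "odd1 v \<Longrightarrow> odd1 (c \<cdot> v)"
  unfolding odd1_def by (metis coef_simps(5) mult_zero_right)

lemma odd1_eps: "odd1 (eps {r})"
  by (simp add: odd1_def coef_eps)

lemma odd1_0: "odd1 0"
  by (simp add: odd1_def)

lemma odd1_sum: "(\<And>i. i \<in> A \<Longrightarrow> odd1 (f i)) \<Longrightarrow> odd1 (sum f A)"
  by (induction A rule: infinite_finite_induct) (auto intro: odd1_add odd1_0)

lemma coef_odd1_mult:
  assumes v: "odd1 v" and J: "finite J"
  shows "coef (v * G) J = (\<Sum>j\<in>J. esgn {j} (J - {j}) * coef v {j} * coef G (J - {j}))"
proof -
  have "coef (v * G) J = (\<Sum>I\<in>(\<lambda>j. {j}) ` J. esgn I (J - I) * coef v I * coef G (J - I))"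
    unfolding coef_mult[OF J]
  proof (rule sum.mono_neutral_right)
    show "\<forall>I\<in>Pow J - (\<lambda>j. {j}) ` J. esgn I (J - I) * coef v I * coef G (J - I) = 0"
    proof
      fix I assume I: "I \<in> Pow J - (\<lambda>j. {j}) ` J"
      have "coef v I = 0"
      proof (rule ccontr)
        assume "coef v I \<noteq> 0"
        then obtain r where "I = {r}" using v by (auto simp: odd1_def)
        then show False using I by auto
      qed
      then show "esgn I (J - I) * coef v I * coef G (J - I) = 0" by simp
    qed
  qed (use J in auto)
  then show ?thesis by (simp add: sum.reindex)
qed

text \<open>Only coefficients at two-element sets could survive, and there the two summands carry
  opposite signs. No division by two is involved.\<close>

lemma odd1_square:
  fixes v :: "'a::comm_ring_1 ext"
  assumes v: "odd1 v" shows "v * v = 0"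
proof (rule ext_eqI)
  fix J :: "nat set" assume J: "finite J"
  show "coef (v * v) J = coef 0 J"
  proof (cases "\<exists>a b. a < b \<and> J = {a, b}")
    case True
    then obtain a b where ab: "a < b" "J = {a, b}" by blast
    have "J - {a} = {b}" "J - {b} = {a}" using ab by auto
    moreover have "esgn {a} {b} = (1 :: 'a)" using ab(1) by (intro esgn_less) auto
    ultimately show ?thesis unfolding coef_odd1_mult[OF v J] using ab
      by (simp add: esgn_greater mult.commute)
  next
    case False
    have "coef v (J - {j}) = 0" if j: "j \<in> J" for j
    proof (rule ccontr)
      assume "coef v (J - {j}) \<noteq> 0"
      then obtain r where r: "J - {j} = {r}" using v by (auto simp: odd1_def)
      then have "J = {j, r}" "J = {r, j}" "r \<noteq> j" using j by auto
      then show False using False by (metis linorder_neqE_nat)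
    qed
    then show ?thesis unfolding coef_odd1_mult[OF v J] by simp
  qed
qed

lemma odd1_anticommute:
  assumes "odd1 v" "odd1 w" shows "v * w = - (w * v)"
proof -
  have "(v + w) * (v + w) = v * v + w * w + (v * w + w * v)" by (simp add: algebra_simps)
  then have "v * w + w * v = 0" using odd1_square odd1_add assms by (metis add_0)
  then show ?thesis by (simp add: eq_neg_iff_add_eq_0)
qed

definition vprod :: "(nat \<Rightarrow> 'a::comm_ring_1 ext) \<Rightarrow> nat set \<Rightarrow> 'a ext" where
  "vprod v J = prod_list (map v (sorted_list_of_set J))"

lemma vprod_empty [simp]: "vprod v {} = 1"
  by (simp add: vprod_def)

lemma vprod_singleton [simp]: "vprod v {i} = v i"
  by (simp add: vprod_def)

lemma vprod_insert:
  assumes "finite J" "\<forall>j\<in>J. m < j" shows "vprod v (insert m J) = v m * vprod v J"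
proof -
  have "m \<notin> J" using assms by auto
  then have "sorted_list_of_set (insert m J) = insort m (sorted_list_of_set J)"
    using assms by (simp add: sorted_list_of_set_insert_remove)
  also have "\<dots> = m # sorted_list_of_set J"
    using assms by (intro insort_is_Cons) (auto simp: less_imp_le)
  finally show ?thesis by (simp add: vprod_def)
qed

text \<open>\<open>v m\<close> is moved past the smaller factors one by one, each exchange
  contributing a sign, until it reaches its place or meets itself and gives zero.\<close>

lemma mult_vprod:
  assumes v: "\<And>i. odd1 (v i)" and J: "finite J"
  shows "v m * vprod v J = (if m \<in> J then 0 else esgn {m} J \<cdot> vprod v (insert m J))"
  using J
proof (induction J rule: finite_linorder_min_induct)
  case empty
  then show ?case by (simp add: scale_simps)
next
  case (insert b A)
  have bA: "vprod v (insert b A) = v b * vprod v A" using insert by (intro vprod_insert) auto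
  consider "m < b" | "m = b" | "b < m" by linarith
  then show ?case
  proof cases
    case 1
    then have m: "\<forall>j\<in>insert b A. m < j" using insert by fastforce
    then have "esgn {m} (insert b A) = (1::'a)" by (intro esgn_less) force
    then show ?thesis using vprod_insert[of "insert b A" m v] insert m by (auto simp: scale_simps)
  next
    case 2
    then show ?thesis using odd1_square[OF v] by (simp add: bA mult.assoc[symmetric])
  next
    case 3
    have "v m * vprod v (insert b A) = - (v b * (v m * vprod v A))"
      unfolding bA using odd1_anticommute[OF v v, of m b] by (simp add: mult.assoc[symmetric])
    also have "\<dots> = (if m \<in> A then 0 else - (esgn {m} A \<cdot> (v b * vprod v (insert m A))))"
      by (simp add: insert.IH scale_mult_right)
    also have "\<dots> = (if m \<in> insert b A then 0 else esgn {m} (insert b A) \<cdot> vprod v (insert m (insert b A)))"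
    proof -
      have "b \<notin> A" using insert by auto
      then have "esgn {m} (insert b A) = - (esgn {m} A :: 'a)"
        using esgn_Un_right[of "{b}" A "{m}", where 'a = 'a] insert.hyps(1) esgn_greater[OF 3, where 'a = 'a] by simp
      moreover have "vprod v (insert b (insert m A)) = v b * vprod v (insert m A)"
        using insert 3 by (intro vprod_insert) auto
      ultimately show ?thesis using 3 by (simp add: scale_simps insert_commute)
    qed
    finally show ?thesis .
  qed
qed

text \<open>Degree-one elements obey the multiplication table of the monomials \<open>eps\<close>;
  this makes \<open>esubst\<close> multiplicative.\<close>

lemma vprod_mult:
  assumes v: "\<And>i. odd1 (v i)" and I: "finite I" and J: "finite J"
  shows "vprod v I * vprod v J = (if I \<inter> J = {} then esgn I J \<cdot> vprod v (I \<union> J) else 0)"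
  using I
proof (induction I rule: finite_linorder_min_induct)
  case empty
  then show ?case by (simp add: scale_simps)
next
  case (insert m A)
  have mA: "m \<notin> A" using insert by auto
  have "vprod v (insert m A) * vprod v J = v m * (vprod v A * vprod v J)"
    using vprod_insert[of A m v] insert by (simp add: mult.assoc)
  also have "\<dots> = (if A \<inter> J = {} then esgn A J \<cdot> (v m * vprod v (A \<union> J)) else 0)"
    by (simp add: insert.IH scale_mult_right)
  also have "\<dots> = (if insert m A \<inter> J = {} then (esgn A J * esgn {m} (A \<union> J)) \<cdot> vprod v (insert m A \<union> J) else 0)"
    using mult_vprod[of v "A \<union> J" m, OF v] insert.hyps(1) J mA by (auto simp: scale_simps)
  also have "\<dots> = (if insert m A \<inter> J = {} then esgn (insert m A) J \<cdot> vprod v (insert m A \<union> J) else 0)"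
  proof (cases "insert m A \<inter> J = {}")
    case True
    have "esgn {m} (A \<union> J) = esgn {m} A * (esgn {m} J :: 'a)"
      using True insert.hyps(1) J by (intro esgn_Un_right) auto
    moreover have "esgn {m} A = (1::'a)" using insert.hyps(2) by (intro esgn_less) force
    moreover have "esgn (insert m A) J = esgn {m} J * (esgn A J :: 'a)"
      using esgn_Un_left[of "{m}" A J, where 'a = 'a] insert.hyps(1) J mA by simp
    ultimately show ?thesis by (simp add: mult_ac)
  qed auto
  finally show ?case .
qed

text \<open>The algebra homomorphism that sends the generator with index \<open>i \<in> U\<close> to \<open>v i\<close>.\<close>
definition esubst :: "nat set \<Rightarrow> (nat \<Rightarrow> 'a::comm_ring_1 ext) \<Rightarrow> 'a ext \<Rightarrow> 'a ext" where
  "esubst U v f = (\<Sum>J\<in>Pow U. coef f J \<cdot> vprod v J)"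

lemma esubst_add: "esubst U v (f + g) = esubst U v f + esubst U v g"
  by (simp add: esubst_def scale_simps sum.distrib)

lemma esubst_scale: "esubst U v (c \<cdot> f) = c \<cdot> esubst U v f"
  by (simp add: esubst_def scale_simps scale_sum_right)

lemma esubst_0 [simp]: "esubst U v 0 = 0"
  by (simp add: esubst_def scale_simps)

lemma esubst_sum: "esubst U v (sum f A) = (\<Sum>i\<in>A. esubst U v (f i))"
  by (induction A rule: infinite_finite_induct) (simp_all add: esubst_add)

lemma esubst_eps:
  assumes "finite U" "J \<subseteq> U" shows "esubst U v (eps J) = vprod v J"
proof -
  have "finite J" using assms finite_subset by blast
  then have "esubst U v (eps J) = (\<Sum>K\<in>Pow U. if K = J then vprod v J else 0)"
    unfolding esubst_def by (intro sum.cong) (auto simp: coef_eps scale_simps)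
  then show ?thesis using assms by (simp add: sum.delta)
qed

lemma esubst_1: "finite U \<Longrightarrow> esubst U v 1 = 1"
  using esubst_eps[of U "{}" v] by simp

text \<open>By bilinearity it suffices to compare monomials, where \<open>vprod_mult\<close> and
  \<open>eps_mult\<close> agree. Without the supports, \<open>esubst U\<close> would discard
  coefficients outside \<open>U\<close>.\<close>

lemma esubst_mult:
  assumes U: "finite U" and v: "\<And>i. odd1 (v i)" and f: "supported U f" and g: "supported U g"
  shows "esubst U v (f * g) = esubst U v f * esubst U v g"
proof -
  have e: "esubst U v (eps I * eps J) = vprod v I * vprod v J" if "I \<subseteq> U" "J \<subseteq> U" for I J
  proof -
    have fin: "finite I" "finite J" using that U finite_subset by auto
    show ?thesis using that unfolding vprod_mult[of v, OF v fin] eps_mult[OF fin]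
      by (simp add: esubst_scale esubst_eps[OF U])
  qed
  have "f * g = (\<Sum>I\<in>Pow U. \<Sum>J\<in>Pow U. (coef f I * coef g J) \<cdot> (eps I * eps J))"
    by (subst eps_expand[OF U f], subst eps_expand[OF U g])
      (simp add: sum_product scale_mult_left scale_mult_right scale_simps mult.commute)
  then have "esubst U v (f * g) = (\<Sum>I\<in>Pow U. \<Sum>J\<in>Pow U. (coef f I * coef g J) \<cdot> (vprod v I * vprod v J))"
    by (simp add: esubst_sum esubst_scale e)
  also have "\<dots> = esubst U v f * esubst U v g"
    by (simp add: esubst_def sum_product scale_mult_left scale_mult_right scale_simps mult.commute)
  finally show ?thesis .
qed

lemma esubst_prod_list:
  assumes U: "finite U" and v: "\<And>i. odd1 (v i)" and L: "\<And>x. x \<in> set L \<Longrightarrow> supported U x"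
  shows "esubst U v (prod_list L) = prod_list (map (esubst U v) L)"
proof -
  have "supported U (prod_list L) \<and> ?thesis" using L
  proof (induction L)
    case (Cons x L)
    then show ?case using esubst_mult[of U v x "prod_list L", OF U v] by (auto intro: supported_mult)
  qed (simp add: supported_1 esubst_1[OF U])
  then show ?thesis by simp
qed

lemma esubst_vprod:
  assumes U: "finite U" and w: "\<And>i. odd1 (w i)" and v: "\<And>j. j \<in> J \<Longrightarrow> supported U (v j)" and J: "finite J"
  shows "esubst U w (vprod v J) = vprod (\<lambda>j. esubst U w (v j)) J"
proof -
  let ?L = "map v (sorted_list_of_set J)"
  have "esubst U w (prod_list ?L) = prod_list (map (esubst U w) ?L)"
    by (rule esubst_prod_list[OF U w]) (use v J in auto)
  then show ?thesis by (simp add: vprod_def o_def)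
qed

lemma vprod_cong: "finite J \<Longrightarrow> (\<And>j. j \<in> J \<Longrightarrow> v j = w j) \<Longrightarrow> vprod v J = vprod w J"
  unfolding vprod_def by (metis map_cong set_sorted_list_of_set)

lemma esubst_esubst:
  assumes U: "finite U" and w: "\<And>i. odd1 (w i)" and v: "\<And>j. j \<in> U \<Longrightarrow> supported U (v j)"
  shows "esubst U w (esubst U v f) = esubst U (\<lambda>j. esubst U w (v j)) f"
proof -
  have "esubst U w (vprod v J) = vprod (\<lambda>j. esubst U w (v j)) J" if "J \<in> Pow U" for J
    using esubst_vprod[of U w J v, OF U w] v that U finite_subset by (metis PowD subsetD)
  then show ?thesis unfolding esubst_def[of U v] esubst_def[of U "\<lambda>j. esubst U w (v j)"]
    by (simp add: esubst_sum esubst_scale)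
qed

section \<open>Superspace as an exterior algebra\<close>

text \<open>Collects, for each \<open>J\<close>, the terms with that index set into one polynomial
  coefficient, so that the calculus takes place over the commutative ring of polynomials.\<close>

definition to_ext :: "omega \<Rightarrow> cpoly ext" where
  "to_ext f = Ext (\<lambda>J. if finite J then Poly_Mapping.map_key (\<lambda>a. (a, J)) f else 0)"

lemma lookup_to_ext: "finite J \<Longrightarrow> lookup (coef (to_ext f) J) a = lookup f (a, J)"
proof -
  assume J: "finite J"
  have "inj (\<lambda>a :: mono. (a, J))" by (rule injI) simp
  then show ?thesis using J by (simp add: to_ext_def Ext_inverse map_key.rep_eq)
qed

lemma to_ext_eqI:
  assumes "\<And>a J. finite J \<Longrightarrow> lookup f (a, J) = lookup (coef F J) a" shows "to_ext f = F"
  by (rule ext_eqI, rule poly_mapping_eqI) (simp add: lookup_to_ext assms)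

lemma to_ext_add: "to_ext (f + g) = to_ext f + to_ext g"
  by (rule to_ext_eqI) (simp add: lookup_add lookup_to_ext)

lemma to_ext_diff: "to_ext (f - g) = to_ext f - to_ext g"
  by (rule to_ext_eqI) (simp add: lookup_minus lookup_to_ext)

lemma to_ext_uminus: "to_ext (- f) = - to_ext f"
  by (rule to_ext_eqI) (simp add: lookup_to_ext)

lemma to_ext_0 [simp]: "to_ext 0 = 0"
  by (rule to_ext_eqI) simp

lemma to_ext_sum: "to_ext (sum f A) = (\<Sum>i\<in>A. to_ext (f i))"
  by (induction A rule: infinite_finite_induct) (simp_all add: to_ext_add)

lemma to_ext_single: "finite J \<Longrightarrow> to_ext (single (a, J) c) = single a c \<cdot> eps J"
  by (rule to_ext_eqI) (auto simp: lookup_single coef_eps when_def)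

text \<open>The type \<open>omega\<close> admits terms with infinite index sets, which
  \<open>to_ext\<close> forgets. On elements without such terms it is injective and
  multiplicative.\<close>

definition finO :: "omega \<Rightarrow> bool" where
  "finO f \<longleftrightarrow> (\<forall>m\<in>keys f. finite (snd m))"

lemma finO_add: "finO f \<Longrightarrow> finO g \<Longrightarrow> finO (f + g)"
  using keys_add[of f g] by (auto simp: finO_def)

lemma finO_uminus: "finO f \<Longrightarrow> finO (- f)"
  by (auto simp: finO_def in_keys_iff)

lemma finO_0: "finO 0"
  by (simp add: finO_def)

lemma finO_sum: "(\<And>i. i \<in> A \<Longrightarrow> finO (f i)) \<Longrightarrow> finO (sum f A)"
  by (induction A rule: infinite_finite_induct) (auto intro: finO_add finO_0)

lemma finO_single: "finite J \<Longrightarrow> finO (single (a, J) c)"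
  by (simp add: finO_def)

lemma to_ext_inj:
  assumes "finO f" "finO g" "to_ext f = to_ext g" shows "f = g"
proof (rule poly_mapping_eqI)
  fix m :: "mono \<times> nat set"
  obtain a J where m: "m = (a, J)" by fastforce
  show "lookup f m = lookup g m"
  proof (cases "finite J")
    case True
    then show ?thesis using lookup_to_ext[of J f a] lookup_to_ext[of J g a] assms(3) m by simp
  next
    case False
    then have "m \<notin> keys f" "m \<notin> keys g" using assms m by (auto simp: finO_def)
    then show ?thesis by (simp add: in_keys_iff)
  qed
qed

lemma to_ext_expand:
  assumes "finO f" shows "to_ext f = (\<Sum>m\<in>keys f. single (fst m) (lookup f m) \<cdot> eps (snd m))"
proof -
  have "to_ext f = (\<Sum>m\<in>keys f. to_ext (single m (lookup f m)))"
    by (subst poly_mapping_sum_singles[of f]) (rule to_ext_sum)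
  also have "\<dots> = (\<Sum>m\<in>keys f. single (fst m) (lookup f m) \<cdot> eps (snd m))"
  proof (rule sum.cong)
    fix m assume m: "m \<in> keys f"
    then show "to_ext (single m (lookup f m)) = single (fst m) (lookup f m) \<cdot> eps (snd m)"
      using to_ext_single[of "snd m" "fst m" "lookup f m"] assms by (simp add: finO_def)
  qed simp
  finally show ?thesis .
qed

lemma cconst_wsign: "cconst (wsign I J) = esgn I J"
proof -
  have "cconst ((-1) ^ k) = (-1) ^ k" for k
    by (induction k) (simp_all add: cconst_mult cconst_def single_uminus)
  then show ?thesis by (simp add: wsign_def esgn_def)
qed

lemma map_mono_mul:
  "Poly_Mapping.map (\<lambda>c. x * c) (mono_mul (a, I) (b, J)) =
    (if I \<inter> J = {} then single (a + b, I \<union> J) (x * wsign I J) else 0)"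
  by (rule poly_mapping_eqI) (auto simp: mono_mul_def lookup_single when_def Poly_Mapping.map.rep_eq)

lemma finO_omul:
  assumes "finO f" "finO g" shows "finO (f \<star> g)"
  unfolding omul_def
proof (intro finO_sum)
  fix m m' assume m: "m \<in> keys f" "m' \<in> keys g"
  obtain a I b J where mm: "m = (a, I)" "m' = (b, J)" by fastforce
  have "finite I" "finite J" using m mm assms by (auto simp: finO_def)
  then show "finO (Poly_Mapping.map ((*) (lookup f m * lookup g m')) (mono_mul m m'))"
    by (simp add: mm map_mono_mul finO_0 finO_single)
qed

lemma to_ext_omul:
  assumes "finO f" "finO g" shows "to_ext (f \<star> g) = to_ext f * to_ext g"
proof -
  have "to_ext (Poly_Mapping.map (\<lambda>c. lookup f m * lookup g m' * c) (mono_mul m m'))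
      = (single (fst m) (lookup f m) \<cdot> eps (snd m)) * (single (fst m') (lookup g m') \<cdot> eps (snd m'))"
    if m: "m \<in> keys f" "m' \<in> keys g" for m m'
  proof -
    obtain a I b J where mm: "m = (a, I)" "m' = (b, J)" by fastforce
    have fin: "finite I" "finite J" using m mm assms by (auto simp: finO_def)
    define x y where "x = lookup f m" and "y = lookup g m'"
    have s: "single (a + b) (x * y * wsign I J) = single b y * single a x * esgn I J"
      unfolding cconst_wsign[symmetric] cconst_def mult_single by (simp add: ac_simps)
    have "to_ext (Poly_Mapping.map (\<lambda>c. x * y * c) (mono_mul (a, I) (b, J)))
        = (single a x \<cdot> eps I) * (single b y \<cdot> eps J)"
      unfolding map_mono_mul using fin
      by (simp add: scale_mult_left scale_mult_right eps_mult scale_simps to_ext_single s)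
    then show ?thesis by (simp add: mm x_def y_def)
  qed
  then show ?thesis
    unfolding omul_def to_ext_expand[OF assms(1)] to_ext_expand[OF assms(2)]
    by (simp add: to_ext_sum sum_product)
qed

lemma to_ext_times_theta: "finite J \<Longrightarrow> to_ext (times_theta p J) = p \<cdot> eps J"
proof -
  assume J: "finite J"
  have "to_ext (times_theta p J) = (\<Sum>a\<in>keys p. single a (lookup p a) \<cdot> eps J)"
    using J by (simp add: times_theta_def to_ext_sum to_ext_single)
  also have "\<dots> = p \<cdot> eps J"
    unfolding scale_sum_left[symmetric] using poly_mapping_sum_singles[of p] by simp
  finally show ?thesis .
qed

lemma finO_times_theta: "finite J \<Longrightarrow> finO (times_theta p J)"
  by (auto simp: times_theta_def intro: finO_sum finO_single)

lemma emb_eq_times_theta: "emb p = times_theta p {}"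
  by (simp add: emb_def times_theta_def)

lemma to_ext_oconst: "to_ext (oconst c) = cconst c \<cdot> 1"
  by (simp add: oconst_def to_ext_single cconst_def)

lemma finO_oconst: "finO (oconst c)"
  by (simp add: oconst_def finO_single)

section \<open>The action of signed permutations\<close>

definition theta_sgn :: "int \<Rightarrow> cpoly ext" where
  "theta_sgn k = (if k \<ge> 0 then eps {nat k} else - eps {nat (- k)})"

lemma to_ext_Ths: "to_ext (Ths k) = theta_sgn k" and finO_Ths: "finO (Ths k)"
proof -
  have "to_ext (Th i) = eps {i}" for i
    by (simp add: Th_def to_ext_single scale_simps)
  then show "to_ext (Ths k) = theta_sgn k" by (simp add: Ths_def theta_sgn_def to_ext_uminus)
  show "finO (Ths k)" by (auto simp: Ths_def Th_def intro: finO_uminus finO_single)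
qed

lift_definition xact :: "(nat \<Rightarrow> cpoly) \<Rightarrow> cpoly ext \<Rightarrow> cpoly ext" is "\<lambda>\<phi> F J. psubst \<phi> (F J)"
  by simp

lemma coef_xact [simp]: "coef (xact \<phi> F) J = psubst \<phi> (coef F J)"
  by transfer simp

lemma xact_add: "xact \<phi> (F + G) = xact \<phi> F + xact \<phi> G"
  by (rule ext_eqI) (simp add: psubst_add)

lemma xact_0 [simp]: "xact \<phi> 0 = 0"
  by (rule ext_eqI) simp

lemma xact_sum: "xact \<phi> (sum F A) = (\<Sum>i\<in>A. xact \<phi> (F i))"
  by (induction A rule: infinite_finite_induct) (simp_all add: xact_add)

lemma xact_scale: "xact \<phi> (c \<cdot> F) = psubst \<phi> c \<cdot> xact \<phi> F"
  by (rule ext_eqI) (simp add: psubst_mult)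

lemma psubst_esgn: "psubst \<phi> (esgn I J) = esgn I J"
  by (simp add: cconst_wsign[symmetric])

lemma xact_eps: "xact \<phi> (eps J) = eps J"
  by (rule ext_eqI) (simp add: coef_eps)

lemma xact_1: "xact \<phi> 1 = 1"
  using xact_eps[of \<phi> "{}"] by simp

lemma xact_mult: "xact \<phi> (F * G) = xact \<phi> F * xact \<phi> G"
  by (rule ext_eqI) (simp add: coef_mult psubst_sum psubst_mult psubst_esgn)

lemma xact_vprod: "xact \<phi> (vprod v J) = vprod (\<lambda>j. xact \<phi> (v j)) J"
proof -
  have "xact \<phi> (prod_list L) = prod_list (map (xact \<phi>) L)" for L
    by (induction L) (simp_all add: xact_1 xact_mult)
  then show ?thesis by (simp add: vprod_def o_def)
qed

lemma xact_esubst: "xact \<phi> (esubst U v F) = esubst U (\<lambda>j. xact \<phi> (v j)) (xact \<phi> F)"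
  by (simp add: esubst_def xact_sum xact_scale xact_vprod)

abbreviation perm_subst :: "(nat \<Rightarrow> int) \<Rightarrow> nat \<Rightarrow> cpoly" where
  "perm_subst \<pi> \<equiv> (\<lambda>i. Xs (\<pi> i))"

text \<open>Acts first on the coefficients, then on the generators. The index set starts at 0 so
  that the same \<open>{0..n}\<close> also contains the indices \<open>r < n\<close> of the
  generators introduced by \<open>Efield\<close>; the \<theta> themselves use only
  \<open>{1..n}\<close>.\<close>

definition eact :: "nat \<Rightarrow> (nat \<Rightarrow> int) \<Rightarrow> cpoly ext \<Rightarrow> cpoly ext" where
  "eact n \<pi> F = esubst {0..n} (\<lambda>j. theta_sgn (\<pi> j)) (xact (perm_subst \<pi>) F)"

lemma foldr_Ths:
  "finO (foldr (\<lambda>j r. Ths (\<pi> j) \<star> r) L (oconst 1)) \<and>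
   to_ext (foldr (\<lambda>j r. Ths (\<pi> j) \<star> r) L (oconst 1)) = prod_list (map (\<lambda>j. theta_sgn (\<pi> j)) L)"
  by (induction L) (simp_all add: finO_oconst to_ext_oconst scale_simps finO_omul finO_Ths to_ext_omul to_ext_Ths)

lemma finO_Omega: "f \<in> Omega n \<Longrightarrow> finO f"
  unfolding Omega_def finO_def using finite_subset by fastforce

lemma oact_term:
  assumes "finite J"
  shows "finO (oconst c \<star> (emb p \<star> foldr (\<lambda>j r. Ths (\<pi> j) \<star> r) (sorted_list_of_set J) (oconst 1)))"
    and "to_ext (oconst c \<star> (emb p \<star> foldr (\<lambda>j r. Ths (\<pi> j) \<star> r) (sorted_list_of_set J) (oconst 1)))
      = (cconst c * p) \<cdot> vprod (\<lambda>j. theta_sgn (\<pi> j)) J"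
  using foldr_Ths[of \<pi> "sorted_list_of_set J"]
  by (simp_all add: emb_eq_times_theta finO_omul finO_oconst finO_times_theta to_ext_omul to_ext_oconst
      to_ext_times_theta scale_mult_left scale_simps vprod_def)

lemma finO_oact: "f \<in> Omega n \<Longrightarrow> finO (oact \<pi> f)"
  unfolding oact_def using finO_Omega[of f n]
  by (intro finO_sum) (auto simp: finO_def[of f] intro!: oact_term)

lemma to_ext_oact:
  assumes f: "f \<in> Omega n" shows "to_ext (oact \<pi> f) = eact n \<pi> (to_ext f)"
proof -
  let ?w = "\<lambda>j. theta_sgn (\<pi> j)"
  have "to_ext (oact \<pi> f) = (\<Sum>m\<in>keys f. (cconst (lookup f m) * act_mono \<pi> (fst m)) \<cdot> vprod ?w (snd m))"
    unfolding oact_def to_ext_sum using finO_Omega[OF f]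
    by (intro sum.cong refl) (auto simp: finO_def oact_term)
  moreover have "eact n \<pi> (single (fst m) (lookup f m) \<cdot> eps (snd m))
      = (cconst (lookup f m) * act_mono \<pi> (fst m)) \<cdot> vprod ?w (snd m)" if "m \<in> keys f" for m
  proof -
    have "snd m \<subseteq> {0..n}" using f that unfolding Omega_def by fastforce
    then show ?thesis
      by (simp add: eact_def xact_scale xact_eps esubst_scale esubst_eps psubst_single act_mono_def)
  qed
  moreover have "eact n \<pi> (to_ext f) = (\<Sum>m\<in>keys f. eact n \<pi> (single (fst m) (lookup f m) \<cdot> eps (snd m)))"
    unfolding to_ext_expand[OF finO_Omega[OF f]] eact_def by (simp add: xact_sum esubst_sum)
  ultimately show ?thesis by simp
qed

section \<open>Superspace and its invariant ideal inside the exterior algebra\<close>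

definition ext_Omega :: "nat \<Rightarrow> cpoly ext set" where
  "ext_Omega n = {F. supported {1..n} F \<and> (\<forall>J. coef F J \<in> Pn n)}"

lemma to_ext_Omega: "f \<in> Omega n \<Longrightarrow> to_ext f \<in> ext_Omega n"
proof -
  assume f: "f \<in> Omega n"
  have "J \<subseteq> {1..n} \<and> keys a \<subseteq> {1..n}" if "a \<in> keys (coef (to_ext f) J)" for a J
  proof -
    have "finite J" using that coef_infinite[of J "to_ext f"] by (cases "finite J") auto
    then have "(a, J) \<in> keys f" using that by (simp add: in_keys_iff lookup_to_ext)
    then show ?thesis using f by (auto simp: Omega_def)
  qed
  then show ?thesis by (force simp: ext_Omega_def supported_def Pn_def poly_mapping_eq_iff fun_eq_iff in_keys_iff)
qed

lemma to_ext_Omega_iff: "f \<in> Omega n \<longleftrightarrow> finO f \<and> to_ext f \<in> ext_Omega n"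
proof
  assume f: "finO f \<and> to_ext f \<in> ext_Omega n"
  have "keys a \<subseteq> {1..n} \<and> J \<subseteq> {1..n}" if "(a, J) \<in> keys f" for a J
  proof -
    have "finite J" using f that by (auto simp: finO_def)
    then have a: "a \<in> keys (coef (to_ext f) J)" using that by (simp add: in_keys_iff lookup_to_ext)
    then have "coef (to_ext f) J \<noteq> 0" by auto
    then show ?thesis using f a by (auto simp: ext_Omega_def supported_def Pn_def)
  qed
  then show "f \<in> Omega n" by (auto simp: Omega_def)
qed (auto intro: finO_Omega to_ext_Omega)

lemma ext_Omega_surj:
  assumes F: "F \<in> ext_Omega n" shows "\<exists>f\<in>Omega n. to_ext f = F"
proof -
  define f where "f = (\<Sum>J\<in>Pow {1..n}. times_theta (coef F J) J)"
  have fin: "finite J" if "J \<in> Pow {1..n}" for J using that finite_subset by auto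
  have "to_ext f = (\<Sum>J\<in>Pow {1..n}. coef F J \<cdot> eps J)"
    unfolding f_def to_ext_sum by (intro sum.cong refl) (auto simp: to_ext_times_theta fin)
  then have "to_ext f = F" using eps_expand[of "{1..n}" F] F by (simp add: ext_Omega_def)
  moreover have "finO f" unfolding f_def by (intro finO_sum finO_times_theta fin)
  ultimately show ?thesis using F to_ext_Omega_iff by blast
qed

lemma ext_Omega_add: "F \<in> ext_Omega n \<Longrightarrow> G \<in> ext_Omega n \<Longrightarrow> F + G \<in> ext_Omega n"
  by (auto simp: ext_Omega_def intro: supported_add Pn_add)

lemma ext_Omega_0: "0 \<in> ext_Omega n"
  by (auto simp: ext_Omega_def supported_0)

lemma ext_Omega_scale: "p \<in> Pn n \<Longrightarrow> F \<in> ext_Omega n \<Longrightarrow> p \<cdot> F \<in> ext_Omega n"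
  by (auto simp: ext_Omega_def intro: supported_scale Pn_mult)

lemma ext_Omega_eps: "J \<subseteq> {1..n} \<Longrightarrow> eps J \<in> ext_Omega n"
  by (auto simp: ext_Omega_def coef_eps intro: supported_eps)

lemma ext_Omega_1: "1 \<in> ext_Omega n"
  using ext_Omega_eps[of "{}" n] by simp

lemma ext_Omega_sum: "(\<And>i. i \<in> A \<Longrightarrow> F i \<in> ext_Omega n) \<Longrightarrow> sum F A \<in> ext_Omega n"
  by (induction A rule: infinite_finite_induct) (auto intro: ext_Omega_add ext_Omega_0)

lemma esgn_Pn: "esgn I J \<in> Pn n"
  by (simp add: cconst_wsign[symmetric])

lemma coef_mult_Pn:
  assumes "\<And>J. coef F J \<in> Pn n" "\<And>J. coef G J \<in> Pn n" shows "coef (F * G) J \<in> Pn n"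
proof (cases "finite J")
  case True
  then show ?thesis unfolding coef_mult[OF True] by (intro Pn_sum Pn_mult esgn_Pn assms)
qed (simp add: coef_infinite)

lemma ext_Omega_mult: "F \<in> ext_Omega n \<Longrightarrow> G \<in> ext_Omega n \<Longrightarrow> F * G \<in> ext_Omega n"
  by (auto simp: ext_Omega_def intro: supported_mult coef_mult_Pn)

definition ext_invariants :: "nat \<Rightarrow> cpoly ext set" where
  "ext_invariants n = {F \<in> ext_Omega n. lookup (coef F {}) 0 = 0 \<and> (\<forall>\<pi>\<in>signed_perms n. eact n \<pi> F = F)}"

text \<open>The two-sided ideal, built by adding one term at a time; this matches the finite sums in
  \<open>oideal\<close>.\<close>

inductive_set ext_SIB :: "nat \<Rightarrow> cpoly ext set" for n where
  zero: "0 \<in> ext_SIB n"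
| step: "c \<in> ext_Omega n \<Longrightarrow> s \<in> ext_invariants n \<Longrightarrow> d \<in> ext_Omega n \<Longrightarrow> F \<in> ext_SIB n
    \<Longrightarrow> c * s * d + F \<in> ext_SIB n"

lemma ext_SIB_add: "F \<in> ext_SIB n \<Longrightarrow> G \<in> ext_SIB n \<Longrightarrow> F + G \<in> ext_SIB n"
  by (induction F rule: ext_SIB.induct) (auto simp: add.assoc intro: ext_SIB.step)

lemma ext_SIB_gen: "c \<in> ext_Omega n \<Longrightarrow> s \<in> ext_invariants n \<Longrightarrow> d \<in> ext_Omega n \<Longrightarrow> c * s * d \<in> ext_SIB n"
  using ext_SIB.step[OF _ _ _ ext_SIB.zero, of c n s d] by simp

lemma ext_SIB_sum: "(\<And>i. i \<in> A \<Longrightarrow> F i \<in> ext_SIB n) \<Longrightarrow> sum F A \<in> ext_SIB n"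
  by (induction A rule: infinite_finite_induct) (auto intro: ext_SIB_add ext_SIB.zero)

lemma ext_SIB_mult_left: "F \<in> ext_SIB n \<Longrightarrow> c \<in> ext_Omega n \<Longrightarrow> c * F \<in> ext_SIB n"
proof (induction F rule: ext_SIB.induct)
  case (step b s d F)
  then have "(c * b) * s * d + c * F \<in> ext_SIB n" by (intro ext_SIB.step ext_Omega_mult)
  then show ?case by (simp add: distrib_left mult.assoc)
qed (simp add: ext_SIB.zero)

lemma ext_SIB_mult_right: "F \<in> ext_SIB n \<Longrightarrow> c \<in> ext_Omega n \<Longrightarrow> F * c \<in> ext_SIB n"
proof (induction F rule: ext_SIB.induct)
  case (step b s d F)
  then have "b * s * (d * c) + F * c \<in> ext_SIB n" by (intro ext_SIB.step ext_Omega_mult)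
  then show ?case by (simp add: distrib_right mult.assoc)
qed (simp add: ext_SIB.zero)

lemma ext_SIB_scale: "F \<in> ext_SIB n \<Longrightarrow> p \<in> Pn n \<Longrightarrow> p \<cdot> F \<in> ext_SIB n"
  using ext_SIB_mult_left[OF _ ext_Omega_scale[OF _ ext_Omega_1], of F n p]
  by (simp add: scale_mult_left)

lemma SIB_gens_iff:
  assumes "f \<in> Omega n"
  shows "(lookup f (0, {}) = 0 \<and> (\<forall>\<pi>\<in>signed_perms n. oact \<pi> f = f)) \<longleftrightarrow> to_ext f \<in> ext_invariants n"
proof -
  have "oact \<pi> f = f \<longleftrightarrow> eact n \<pi> (to_ext f) = to_ext f" for \<pi>
    using to_ext_inj[OF finO_oact[OF assms] finO_Omega[OF assms], of \<pi>] to_ext_oact[OF assms, of \<pi>] by auto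
  then show ?thesis using to_ext_Omega[OF assms] by (simp add: ext_invariants_def lookup_to_ext)
qed

lemma SIB_imp_ext_SIB: "f \<in> SIB n \<Longrightarrow> to_ext f \<in> ext_SIB n"
proof -
  assume "f \<in> SIB n"
  then obtain m c s d where f: "f = (\<Sum>k<(m::nat). c k \<star> s k \<star> d k)"
    and csd: "\<And>k. k < m \<Longrightarrow> c k \<in> Omega n \<and> s k \<in> Omega n \<and> lookup (s k) (0, {}) = 0
      \<and> (\<forall>\<pi>\<in>signed_perms n. oact \<pi> (s k) = s k) \<and> d k \<in> Omega n"
    unfolding SIB_def oideal_def by blast
  show ?thesis unfolding f to_ext_sum
  proof (rule ext_SIB_sum)
    fix k assume "k \<in> {..<m}"
    then have k: "c k \<in> Omega n" "s k \<in> Omega n" "d k \<in> Omega n"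
      and i: "lookup (s k) (0, {}) = 0 \<and> (\<forall>\<pi>\<in>signed_perms n. oact \<pi> (s k) = s k)"
      using csd by auto
    from i have "to_ext (s k) \<in> ext_invariants n" unfolding SIB_gens_iff[OF k(2)] .
    with k show "to_ext (c k \<star> s k \<star> d k) \<in> ext_SIB n"
      using finO_Omega by (simp add: to_ext_omul finO_omul ext_SIB_gen to_ext_Omega)
  qed
qed

lemma ext_SIB_imp_SIB:
  assumes "F \<in> ext_SIB n" shows "\<exists>f\<in>SIB n. finO f \<and> to_ext f = F"
  using assms
proof (induction F rule: ext_SIB.induct)
  case zero
  have "0 \<in> SIB n" unfolding SIB_def oideal_def by (intro CollectI exI[of _ 0]) simp
  then show ?case using finO_0 by fastforce
next
  case (step c s d F)
  obtain c' s' d' where cd: "c' \<in> Omega n" "to_ext c' = c" "s' \<in> Omega n" "to_ext s' = s" "d' \<in> Omega n" "to_ext d' = d"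
    using ext_Omega_surj[OF step.hyps(1)] ext_Omega_surj[OF step.hyps(3)]
      ext_Omega_surj[of s n] step.hyps(2) unfolding ext_invariants_def by blast
  obtain f where f: "f \<in> SIB n" "finO f" "to_ext f = F" using step.IH by blast
  let ?S = "{f \<in> Omega n. lookup f (0, {}) = 0 \<and> (\<forall>\<pi>\<in>signed_perms n. oact \<pi> f = f)}"
  have s': "s' \<in> ?S" using SIB_gens_iff[OF cd(3)] cd step.hyps(2) by simp
  obtain m a b e where fe: "f = (\<Sum>k<(m::nat). a k \<star> b k \<star> e k)"
    and abe: "\<And>k. k < m \<Longrightarrow> a k \<in> Omega n \<and> b k \<in> ?S \<and> e k \<in> Omega n"
    using f(1) unfolding SIB_def oideal_def by blast
  have "c' \<star> s' \<star> d' + f = (\<Sum>k<Suc m. (a(m := c')) k \<star> (b(m := s')) k \<star> (e(m := d')) k)"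
    by (simp add: fe add.commute)
  moreover have "\<forall>k<Suc m. (a(m := c')) k \<in> Omega n \<and> (b(m := s')) k \<in> ?S \<and> (e(m := d')) k \<in> Omega n"
    using abe cd s' by (auto simp: less_Suc_eq)
  ultimately have "c' \<star> s' \<star> d' + f \<in> SIB n" unfolding SIB_def oideal_def by blast
  moreover have "finO (c' \<star> s' \<star> d' + f)" "to_ext (c' \<star> s' \<star> d' + f) = c * s * d + F"
    using cd finO_Omega f by (simp_all add: finO_add finO_omul to_ext_add to_ext_omul)
  ultimately show ?case by blast
qed

lemma SIB_iff: "f \<in> SIB n \<longleftrightarrow> to_ext f \<in> ext_SIB n" if "finO f"
  using that SIB_imp_ext_SIB ext_SIB_imp_SIB to_ext_inj by metis

section \<open>Linear independence\<close>

definition coefs_in :: "cpoly set \<Rightarrow> cpoly ext \<Rightarrow> bool" where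
  "coefs_in S F \<longleftrightarrow> (\<forall>J. coef F J \<in> idl S)"

lemma coefs_in_add: "coefs_in S F \<Longrightarrow> coefs_in S G \<Longrightarrow> coefs_in S (F + G)"
  by (simp add: coefs_in_def idl_add)

lemma coefs_in_0: "coefs_in S 0"
  by (simp add: coefs_in_def idl_zero)

lemma coefs_in_mult_left: "coefs_in S F \<Longrightarrow> coefs_in S (c * F)"
  unfolding coefs_in_def
proof
  fix J assume F: "\<forall>J. coef F J \<in> idl S"
  show "coef (c * F) J \<in> idl S"
  proof (cases "finite J")
    case True
    show ?thesis unfolding coef_mult[OF True] by (intro idl_sum idl_mult_left) (use F in blast)
  qed (simp add: coef_infinite idl_zero)
qed

lemma coefs_in_mult_right: "coefs_in S F \<Longrightarrow> coefs_in S (F * c)"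
  unfolding coefs_in_def
proof
  fix J assume F: "\<forall>J. coef F J \<in> idl S"
  show "coef (F * c) J \<in> idl S"
  proof (cases "finite J")
    case True
    show ?thesis unfolding coef_mult[OF True]
      by (intro idl_sum idl_mult_right idl_mult_left) (use F in blast)
  qed (simp add: coef_infinite idl_zero)
qed

lemma coefs_in_esubst: "coefs_in S F \<Longrightarrow> coefs_in S (esubst U v F)"
  by (auto simp: coefs_in_def esubst_def coef_sum intro!: idl_sum idl_mult_right)

lemma esubst_cong:
  assumes "finite U" "supported A F" "\<And>j. j \<in> A \<Longrightarrow> v j = w j"
  shows "esubst U v F = esubst U w F"
  unfolding esubst_def
proof (rule sum.cong)
  fix J assume J: "J \<in> Pow U"
  show "coef F J \<cdot> vprod v J = coef F J \<cdot> vprod w J"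
  proof (cases "coef F J = 0")
    case False
    then have "J \<subseteq> A" using assms(2) by (simp add: supported_def)
    then have "vprod v J = vprod w J" using assms(1,3) J finite_subset by (intro vprod_cong) auto
    then show ?thesis by simp
  qed (simp add: scale_simps)
qed simp

text \<open>The substitution \<open>\<theta>\<^sub>i \<mapsto> Efield n i\<close> evaluates a form on all exterior products of the \<open>E\<^sub>r\<close> at once;
  the index \<open>r\<close> is recorded by the new generator \<open>eps {r}\<close>.\<close>
definition Efield :: "nat \<Rightarrow> nat \<Rightarrow> cpoly ext" where
  "Efield n i = (\<Sum>r<n. Xv i ^ Suc (2 * r) \<cdot> eps {r})"

lemma odd1_Efield: "odd1 (Efield n i)"
  unfolding Efield_def by (intro odd1_sum odd1_scale odd1_eps)

lemma supported_Efield: "supported {0..n} (Efield n i)"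
  unfolding Efield_def by (intro supported_sum supported_scale supported_eps) auto

text \<open>Every coefficient of \<open>Efield n m\<close> is divisible by \<open>Xv m\<close> and
  so has no constant term; factoring off the smallest index of \<open>K\<close> passes this to the
  product.\<close>

lemma lookup_0_vprod_Efield:
  assumes "finite K" "K \<noteq> {}" shows "lookup (coef (vprod (Efield n) K) J) 0 = 0"
proof (cases "finite J")
  case True
  define m where "m = Min K"
  have K: "K = insert m (K - {m})" "\<forall>j\<in>K - {m}. m < j"
    using assms Min_in Min_le by (auto simp: m_def order.not_eq_order_implies_strict)
  have vK: "vprod (Efield n) K = Efield n m * vprod (Efield n) (K - {m})"
    using vprod_insert[of "K - {m}" m "Efield n"] K assms(1) by (metis finite_Diff)
  have X: "lookup (Xv m) 0 = 0"
  proof -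
    have "single m (1::nat) \<noteq> 0" by (metis lookup_single_eq lookup_zero zero_neq_one)
    then show ?thesis by (simp add: Xv_def lookup_single when_def)
  qed
  have "lookup (coef (Efield n m) L) 0 = 0" for L
    unfolding Efield_def coef_sum lookup_sum by (intro sum.neutral) (simp add: lookup_mult_0 X)
  then show ?thesis
    unfolding vK coef_odd1_mult[OF odd1_Efield True] by (simp add: lookup_sum lookup_mult_0)
qed (simp add: coef_infinite)

text \<open>Equivariance of the fields: since the exponents are odd, the sign of
  \<open>\<pi> j\<close> leaves \<open>Xs (\<pi> j) ^ Suc (2 * r)\<close> as a single factor, just
  as it leaves the generator.\<close>

lemma theta_sgn_Efield:
  assumes "j \<in> {0..n}" "nat \<bar>\<pi> j\<bar> \<in> {0..n}"
  shows "esubst {0..n} (Efield n) (theta_sgn (\<pi> j)) = xact (perm_subst \<pi>) (Efield n j)"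
proof -
  let ?k = "nat \<bar>\<pi> j\<bar>"
  define \<sigma> :: cpoly where "\<sigma> = (if \<pi> j \<ge> 0 then 1 else -1)"
  have ss: "\<sigma> ^ Suc (2 * r) = \<sigma>" for r by (simp add: \<sigma>_def)
  have t: "theta_sgn (\<pi> j) = \<sigma> \<cdot> eps {?k}" by (auto simp: theta_sgn_def \<sigma>_def scale_simps)
  have X: "Xs (\<pi> j) = \<sigma> * Xv ?k" by (auto simp: Xs_def \<sigma>_def)
  have "esubst {0..n} (Efield n) (theta_sgn (\<pi> j)) = \<sigma> \<cdot> Efield n ?k"
    unfolding t using assms by (simp add: esubst_scale esubst_eps)
  also have "\<dots> = (\<Sum>r<n. (\<sigma> ^ Suc (2 * r) * Xv ?k ^ Suc (2 * r)) \<cdot> eps {r})"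
    unfolding ss Efield_def by (simp add: scale_sum_right scale_simps)
  also have "\<dots> = xact (perm_subst \<pi>) (Efield n j)"
    unfolding Efield_def xact_sum xact_scale xact_eps psubst_power psubst_Xv X power_mult_distrib ..
  finally show ?thesis .
qed

lemma supported_theta_sgn: "nat \<bar>k\<bar> \<in> U \<Longrightarrow> supported U (theta_sgn k)"
  using supported_scale[OF supported_eps, of "{nat \<bar>k\<bar>}" U "-1"]
  by (auto simp: theta_sgn_def scale_simps intro: supported_eps)

lemma supported_mono: "supported A F \<Longrightarrow> A \<subseteq> B \<Longrightarrow> supported B F"
  by (auto simp: supported_def)

lemma Pn_vprod:
  assumes "\<And>j L. j \<in> J \<Longrightarrow> coef (v j) L \<in> Pn n" "finite J" shows "coef (vprod v J) L \<in> Pn n"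
proof -
  have "set xs \<subseteq> J \<Longrightarrow> coef (prod_list (map v xs)) L \<in> Pn n" for xs L
    by (induction xs arbitrary: L) (auto simp: coef_one intro!: coef_mult_Pn assms(1))
  then show ?thesis using assms(2) by (simp add: vprod_def)
qed

text \<open>The recording generators are fixed by \<open>xact\<close>, so equivariance converts
  invariance of \<open>F\<close> into invariance of every coefficient polynomial of its evaluation.
  The constant term vanishes for \<open>K = {}\<close> by that of \<open>F\<close> and otherwise by
  the fields.\<close>

lemma esubst_Efield_invariant:
  assumes F: "F \<in> ext_invariants n" shows "coefs_in (invariants n) (esubst {0..n} (Efield n) F)"
proof -
  let ?T = "esubst {0..n} (Efield n)"
  have F': "F \<in> ext_Omega n" "supported {1..n} F" "\<And>J. coef F J \<in> Pn n" "lookup (coef F {}) 0 = 0"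
    "\<And>\<pi>. \<pi> \<in> signed_perms n \<Longrightarrow> eact n \<pi> F = F"
    using F by (auto simp: ext_invariants_def ext_Omega_def)
  have inv: "xact (perm_subst \<pi>) (?T F) = ?T F" if \<pi>: "\<pi> \<in> signed_perms n" for \<pi>
  proof -
    have rng: "nat \<bar>\<pi> j\<bar> \<in> {0..n}" if "j \<in> {0..n}" for j
    proof (cases "j = 0")
      case True
      then show ?thesis using \<pi> by (simp add: signed_perms_def)
    next
      case False
      then show ?thesis using signed_perms_range[OF \<pi>, of j] that by auto
    qed
    have "?T F = ?T (eact n \<pi> F)" using F'(5)[OF \<pi>] by simp
    also have "\<dots> = esubst {0..n} (\<lambda>j. ?T (theta_sgn (\<pi> j))) (xact (perm_subst \<pi>) F)"
      unfolding eact_def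
      by (rule esubst_esubst) (simp_all only: odd1_Efield supported_theta_sgn[OF rng] finite_atLeastAtMost)
    also have "\<dots> = esubst {0..n} (\<lambda>j. xact (perm_subst \<pi>) (Efield n j)) (xact (perm_subst \<pi>) F)"
    proof (rule esubst_cong[where A = "{0..n}"])
      show "supported {0..n} (xact (perm_subst \<pi>) F)"
        using supported_mono[OF F'(2), of "{0..n}"] unfolding supported_def coef_xact
        by (metis atLeastatMost_subset_iff le0 order_refl psubst_0)
    qed (simp_all only: theta_sgn_Efield rng finite_atLeastAtMost)
    finally show ?thesis unfolding xact_esubst by (rule sym)
  qed
  have "coef (?T F) J \<in> invariants n" for J
  proof -
    have "coef (?T F) J \<in> Pn n"
      unfolding esubst_def coef_sum coef_simps
    proof (intro Pn_sum)
      fix K assume K: "K \<in> Pow {0..n}"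
      show "coef F K * coef (vprod (Efield n) K) J \<in> Pn n"
      proof (cases "coef F K = 0")
        case False
        then have "K \<subseteq> {1..n}" using F'(2) by (simp add: supported_def)
        then have "coef (Efield n j) L \<in> Pn n" if "j \<in> K" for j L
          using that unfolding Efield_def coef_sum coef_simps
          by (intro Pn_sum Pn_mult Pn_power Pn_Xv) (auto simp: coef_eps)
        then show ?thesis using K finite_subset[of K "{0..n}"] by (intro Pn_mult F'(3) Pn_vprod) auto
      qed simp
    qed
    moreover have "lookup (coef (?T F) J) 0 = 0"
      unfolding esubst_def coef_sum coef_simps lookup_sum lookup_mult_0
    proof (rule sum.neutral, rule ballI)
      fix K assume K: "K \<in> Pow {0..n}"
      show "lookup (coef F K) 0 * lookup (coef (vprod (Efield n) K) J) 0 = 0"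
      proof (cases "K = {}")
        case True
        then show ?thesis using F'(4) by simp
      next
        case False
        then show ?thesis using lookup_0_vprod_Efield[of K n J] K finite_subset[of K "{0..n}"] by simp
      qed
    qed
    moreover have "pact \<pi> (coef (?T F) J) = coef (?T F) J" if "\<pi> \<in> signed_perms n" for \<pi>
      using inv[OF that] by (metis coef_xact pact_eq_psubst)
    ultimately show ?thesis by (simp add: invariants_def)
  qed
  then show ?thesis by (simp add: coefs_in_def idl_base)
qed

section \<open>Triangular combinations of the invariant fields\<close>

definition eta :: "nat \<Rightarrow> nat \<Rightarrow> nat \<Rightarrow> cpoly" where
  "eta n j i = Xv i * (\<Prod>m\<in>{j<..n}. Xv i ^ 2 - Xv m ^ 2)"

lemma fJ_eq_prod_eta: "fJ n J = (\<Prod>j\<in>J. eta n j j)"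
  by (simp add: fJ_def eta_def)

text \<open>Triangularity with respect to the sum of the elements, which grows when one element is
  replaced by a larger one.\<close>

definition triangular_to :: "nat set \<Rightarrow> cpoly \<Rightarrow> cpoly ext \<Rightarrow> bool" where
  "triangular_to K f F \<longleftrightarrow> coef F K = f \<and> (\<forall>J. coef F J \<noteq> 0 \<longrightarrow> J = K \<or> \<Sum>K < \<Sum>J)"

text \<open>A contribution to the coefficient at \<open>J\<close> takes some
  \<open>j \<ge> m\<close> from \<open>v\<close> and \<open>J - {j}\<close> from \<open>G\<close>.
  Both parts weakly raise the element sum, which stays minimal only for \<open>j = m\<close> and
  \<open>J - {j} = K\<close>.\<close>

lemma triangular_to_mult:
  assumes v: "odd1 v" and c: "coef v {m} = c" and lt: "\<And>j. coef v {j} \<noteq> 0 \<Longrightarrow> m \<le> j"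
    and K: "finite K" "\<forall>k\<in>K. m < k" and G: "triangular_to K f G"
  shows "triangular_to (insert m K) (c * f) (v * G)"
proof -
  have mK: "m \<notin> K" using K by auto
  have sK: "\<Sum>(insert m K) = m + \<Sum>K" using K mK by simp
  have key: "J = insert m K \<and> j = m \<or> \<Sum>(insert m K) < \<Sum>J"
    if J: "finite J" "j \<in> J" "coef v {j} \<noteq> 0" "coef G (J - {j}) \<noteq> 0" for j J
  proof -
    have sJ: "\<Sum>J = j + \<Sum>(J - {j})" using J by (simp add: sum.remove)
    have "J - {j} = K \<or> \<Sum>K < \<Sum>(J - {j})" using G J by (auto simp: triangular_to_def)
    moreover have "m \<le> j" using lt J by simp
    ultimately show ?thesis using sJ sK J(2) by (auto simp: insert_absorb)
  qed
  have "J = insert m K \<or> \<Sum>(insert m K) < \<Sum>J" if nz: "coef (v * G) J \<noteq> 0" for J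
  proof -
    have fin: "finite J" using nz coef_infinite by blast
    obtain j where "j \<in> J" "esgn {j} (J - {j}) * coef v {j} * coef G (J - {j}) \<noteq> 0"
      using nz unfolding coef_odd1_mult[OF v fin] by (meson sum.neutral)
    then show ?thesis using key[OF fin] by fastforce
  qed
  moreover have "coef (v * G) (insert m K) = c * f"
  proof -
    let ?J = "insert m K"
    have fin: "finite ?J" using K by simp
    have "coef (v * G) ?J = (\<Sum>j\<in>?J. if j = m then c * f else 0)"
      unfolding coef_odd1_mult[OF v fin]
    proof (rule sum.cong)
      fix j assume j: "j \<in> ?J"
      show "esgn {j} (?J - {j}) * coef v {j} * coef G (?J - {j}) = (if j = m then c * f else 0)"
      proof (cases "j = m")
        case True
        have "esgn {m} K = (1 :: cpoly)" using K by (intro esgn_less) auto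
        then show ?thesis using True mK c G by (simp add: triangular_to_def)
      next
        case False
        then have "coef v {j} = 0 \<or> coef G (?J - {j}) = 0" using key[OF fin j] by blast
        then show ?thesis using False by auto
      qed
    qed simp
    then show ?thesis using fin by (simp add: sum.delta)
  qed
  ultimately show ?thesis by (auto simp: triangular_to_def)
qed

text \<open>The substitution \<open>C\<close> passes from the fields E_r to the combinations
  \<eta>_j, with values \<open>eta n j i\<close>. These vanish for \<open>j < i \<le> n\<close>, and
  the diagonal ones are the factors of \<open>fJ\<close>. Being a substitution, \<open>C\<close>
  keeps coefficients inside the ideal.\<close>

lemma triangular_field:
  obtains v where "\<And>F. F \<in> ext_SIB n \<Longrightarrow> coefs_in (invariants n) (esubst {0..n} v F)"
    and "\<And>K. K \<subseteq> {1..n} \<Longrightarrow> triangular_to K (fJ n K) (vprod v K)"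
proof -
  have "\<forall>j. \<exists>a. \<forall>t. (\<Prod>m\<in>{j<..n}. t - Xv m ^ 2) = t ^ (n - j) + (\<Sum>r<n - j. a r * t ^ r)"
    using prod_diff_expand[of "{_<..n}" "\<lambda>m. Xv m ^ 2"] by simp
  from choice[OF this] obtain a where
    a': "\<forall>j t. (\<Prod>m\<in>{j<..n}. t - Xv m ^ 2) = t ^ (n - j) + (\<Sum>r<n - j. a j r * t ^ r)" ..
  note a = a'[rule_format]
  \<comment> \<open>Column \<open>j\<close> holds the coefficients of the monic polynomial of degree
    \<open>n - j\<close>; as \<open>j \<ge> 1\<close> this is below \<open>n\<close>, so the fields
    with \<open>r < n\<close> suffice.\<close>
  define c where "c r j = (if r = n - j then 1 else if r < n - j then a j r else 0)" for r j
  define C where "C r = (\<Sum>j\<in>{1..n}. c r j \<cdot> eps {j})" for r :: nat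
  have oC: "odd1 (C r)" for r unfolding C_def by (intro odd1_sum odd1_scale odd1_eps)
  define v where "v i = esubst {0..n} C (Efield n i)" for i
  have v_eq: "v i = (\<Sum>j\<in>{1..n}. eta n j i \<cdot> eps {j})" for i
  proof -
    have "v i = (\<Sum>r<n. Xv i ^ Suc (2 * r) \<cdot> C r)"
      unfolding v_def Efield_def esubst_sum esubst_scale by (intro sum.cong refl) (simp add: esubst_eps)
    also have "\<dots> = (\<Sum>j\<in>{1..n}. (\<Sum>r<n. Xv i ^ Suc (2 * r) * c r j) \<cdot> eps {j})"
      unfolding C_def scale_sum_right scale_sum_left scale_simps by (rule sum.swap)
    also have "\<dots> = (\<Sum>j\<in>{1..n}. eta n j i \<cdot> eps {j})"
    proof (rule sum.cong)
      fix j assume j: "j \<in> {1..n}"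
      have "(\<Sum>r<n. Xv i ^ Suc (2 * r) * c r j) = Xv i * (\<Sum>r<n. c r j * (Xv i ^ 2) ^ r)"
        by (simp add: sum_distrib_left power_mult[symmetric] mult_ac)
      also have "(\<Sum>r<n. c r j * (Xv i ^ 2) ^ r) = (\<Sum>r\<in>insert (n - j) {..<n - j}. c r j * (Xv i ^ 2) ^ r)"
        using j by (intro sum.mono_neutral_right) (auto simp: c_def)
      also have "\<dots> = (\<Prod>m\<in>{j<..n}. Xv i ^ 2 - Xv m ^ 2)"
        unfolding a by (simp add: c_def)
      finally show "(\<Sum>r<n. Xv i ^ Suc (2 * r) * c r j) \<cdot> eps {j} = eta n j i \<cdot> eps {j}"
        by (simp add: eta_def)
    qed simp
    finally show ?thesis .
  qed
  have ov: "odd1 (v i)" for i unfolding v_eq by (intro odd1_sum odd1_scale odd1_eps)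
  have cv: "coef (v i) {j} = (if j \<in> {1..n} then eta n j i else 0)" for i j
  proof -
    have "coef (v i) {j} = (\<Sum>k\<in>{1..n}. if k = j then eta n j i else 0)"
      unfolding v_eq coef_sum by (intro sum.cong) (auto simp: coef_eps)
    then show ?thesis by (simp add: sum.delta)
  qed
  show ?thesis
  proof (rule that)
    fix F assume "F \<in> ext_SIB n"
    \<comment> \<open>Evaluation is multiplicative, so only the invariant factor matters;
      multiplying by the images of the outer factors keeps the coefficients in the ideal.\<close>
    then have F: "F \<in> ext_SIB n \<and> coefs_in (invariants n) (esubst {0..n} (Efield n) F)"
    proof (induction F rule: ext_SIB.induct)
      case (step b s d F)
      have supp: "supported {0..n} G" if "G \<in> ext_Omega n" for G
        using that by (auto simp: ext_Omega_def intro: supported_mono)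
      have s: "s \<in> ext_Omega n" using step by (simp add: ext_invariants_def)
      let ?T = "esubst {0..n} (Efield n)"
      have "?T (b * s * d) = ?T b * ?T s * ?T d"
        using step s odd1_Efield by (simp add: esubst_mult supp supported_mult)
      moreover have "coefs_in (invariants n) (?T b * ?T s * ?T d)"
        by (intro coefs_in_mult_left coefs_in_mult_right esubst_Efield_invariant step)
      ultimately show ?case using step ext_SIB.step by (simp add: esubst_add coefs_in_add)
    qed (simp add: coefs_in_0 ext_SIB.zero)
    have "esubst {0..n} v F = esubst {0..n} C (esubst {0..n} (Efield n) F)"
      unfolding v_def by (rule esubst_esubst[symmetric]) (auto intro: oC supported_Efield)
    then show "coefs_in (invariants n) (esubst {0..n} v F)" using F coefs_in_esubst by simp
  next
    fix K :: "nat set" assume K: "K \<subseteq> {1..n}"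
    then have "finite K" using finite_subset by blast
    then show "triangular_to K (fJ n K) (vprod v K)" using K
    proof (induction K rule: finite_linorder_min_induct)
      case empty
      then show ?case by (simp add: triangular_to_def fJ_def coef_one)
    next
      case (insert m K)
      have "m \<le> j" if "coef (v m) {j} \<noteq> 0" for j
      proof (rule ccontr)
        assume "\<not> m \<le> j"
        then have "m \<in> {j<..n}" using insert.prems by auto
        then have "(\<Prod>l\<in>{j<..n}. Xv m ^ 2 - Xv l ^ 2) = 0" by (intro prod_zero) auto
        then show False using that by (simp add: cv eta_def split: if_splits)
      qed
      moreover have "coef (v m) {m} = eta n m m" using insert.prems by (simp add: cv)
      ultimately have "triangular_to (insert m K) (eta n m m * fJ n K) (v m * vprod v K)"
        using insert by (intro triangular_to_mult ov) auto
      moreover have "fJ n (insert m K) = eta n m m * fJ n K"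
        using insert.hyps by (subst (1 2) fJ_eq_prod_eta) (auto intro!: prod.insert)
      ultimately show ?case using vprod_insert[of K m v] insert.hyps by simp
    qed
  qed
qed

theorem independence:
  assumes B: "\<And>J. J \<subseteq> {1..n} \<Longrightarrow> B J \<subseteq> Pn n"
    and ind: "\<And>J F c. J \<subseteq> {1..n} \<Longrightarrow> finite F \<Longrightarrow> F \<subseteq> B J \<Longrightarrow>
      (\<Sum>b\<in>F. cconst (c b) * b) \<in> colon n (IB n) (fJ n J) \<Longrightarrow> \<forall>b\<in>F. c b = 0"
    and F: "finite F" "F \<subseteq> {(J, b). J \<subseteq> {1..n} \<and> b \<in> B J}"
    and mem: "(\<Sum>i\<in>F. (cconst (c i) * snd i) \<cdot> eps (fst i)) \<in> ext_SIB n"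
  shows "\<forall>i\<in>F. c i = 0"
proof (rule ccontr)
  assume "\<not> (\<forall>i\<in>F. c i = 0)"
  define A where "A = {i \<in> F. c i \<noteq> 0}"
  have A: "finite A" "A \<noteq> {}" using F(1) \<open>\<not> _\<close> by (auto simp: A_def)
  \<comment> \<open>Among the terms with nonzero coefficient choose one whose index set has least
    element sum. Evaluating at \<open>J0\<close> then annihilates all terms with another index
    set.\<close>
  obtain i0 where i0: "i0 \<in> A" "\<And>i. i \<in> A \<Longrightarrow> \<Sum>(fst i0) \<le> \<Sum>(fst i)"
    using arg_min_if_finite[OF A, of "\<lambda>i. \<Sum>(fst i)"] by (metis not_le)
  define J0 where "J0 = fst i0"
  have Fn: "fst i \<subseteq> {1..n}" "snd i \<in> B (fst i)" if "i \<in> F" for i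
    using subsetD[OF F(2) that] by (simp_all add: case_prod_beta)
  have J0n: "J0 \<subseteq> {1..n}" using i0(1) Fn by (simp add: A_def J0_def)
  obtain v where v: "\<And>F. F \<in> ext_SIB n \<Longrightarrow> coefs_in (invariants n) (esubst {0..n} v F)"
    "\<And>K. K \<subseteq> {1..n} \<Longrightarrow> triangular_to K (fJ n K) (vprod v K)"
    using triangular_field[of n] by blast
  define G where "G = {i \<in> F. fst i = J0}"
  have "esubst {0..n} v (\<Sum>i\<in>F. (cconst (c i) * snd i) \<cdot> eps (fst i))
      = (\<Sum>i\<in>F. (cconst (c i) * snd i) \<cdot> vprod v (fst i))"
    unfolding esubst_sum esubst_scale
  proof (intro sum.cong refl)
    fix i assume "i \<in> F"
    then have "fst i \<subseteq> {0..n}" using Fn(1)[of i] by auto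
    then show "(cconst (c i) * snd i) \<cdot> esubst {0..n} v (eps (fst i)) = (cconst (c i) * snd i) \<cdot> vprod v (fst i)"
      by (simp add: esubst_eps)
  qed
  then have "(\<Sum>i\<in>F. (cconst (c i) * snd i) * coef (vprod v (fst i)) J0) \<in> idl (invariants n)"
    using v(1)[OF mem] by (simp add: coefs_in_def coef_sum)
  also have "(\<Sum>i\<in>F. (cconst (c i) * snd i) * coef (vprod v (fst i)) J0)
      = (\<Sum>i\<in>F. if i \<in> G then (cconst (c i) * snd i) * fJ n J0 else 0)"
  proof (rule sum.cong)
    fix i assume i: "i \<in> F"
    have t: "triangular_to (fst i) (fJ n (fst i)) (vprod v (fst i))" using v(2) Fn(1)[OF i] .
    show "(cconst (c i) * snd i) * coef (vprod v (fst i)) J0 = (if i \<in> G then (cconst (c i) * snd i) * fJ n J0 else 0)"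
    proof (cases "c i = 0")
      case False
      then have "\<Sum>J0 \<le> \<Sum>(fst i)" using i0(2)[of i] i by (simp add: A_def J0_def)
      then show ?thesis using t i by (auto simp: triangular_to_def G_def)
    qed simp
  qed simp
  also have "\<dots> = (\<Sum>i\<in>G. (cconst (c i) * snd i) * fJ n J0)"
    using F(1) by (intro sum.mono_neutral_cong_right) (auto simp: G_def)
  also have "\<dots> = fJ n J0 * (\<Sum>i\<in>G. cconst (c i) * snd i)"
    by (simp add: sum_distrib_left mult.commute)
  also have "(\<Sum>i\<in>G. cconst (c i) * snd i) = (\<Sum>b\<in>snd ` G. cconst (c (J0, b)) * b)"
  proof -
    have "inj_on snd G" by (rule inj_onI) (auto simp: G_def prod_eq_iff)
    then have "(\<Sum>b\<in>snd ` G. cconst (c (J0, b)) * b) = (\<Sum>i\<in>G. cconst (c (J0, snd i)) * snd i)"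
      by (simp add: sum.reindex)
    also have "\<dots> = (\<Sum>i\<in>G. cconst (c i) * snd i)" by (rule sum.cong) (auto simp: G_def)
    finally show ?thesis by simp
  qed
  finally have m: "fJ n J0 * (\<Sum>b\<in>snd ` G. cconst (c (J0, b)) * b) \<in> idl (invariants n)" .
  have GB: "snd ` G \<subseteq> B J0" using Fn by (auto simp: G_def)
  have gP: "(\<Sum>b\<in>snd ` G. cconst (c (J0, b)) * b) \<in> Pn n"
    using GB B[OF J0n] by (intro Pn_sum Pn_mult Pn_cconst) auto
  have "fJ n J0 \<in> Pn n" unfolding fJ_def
    using J0n by (intro Pn_prod Pn_mult Pn_diff Pn_power Pn_Xv) auto
  then have "(\<Sum>b\<in>snd ` G. cconst (c (J0, b)) * b) \<in> colon n (IB n) (fJ n J0)"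
    using m gP by (simp add: colon_def IB_eq Pn_mult)
  then have "\<forall>b\<in>snd ` G. c (J0, b) = 0"
    using F(1) by (intro ind[OF J0n _ GB]) (auto simp: G_def)
  moreover have "i0 \<in> G" using i0(1) by (simp add: A_def G_def J0_def)
  ultimately have "c (J0, snd i0) = 0" by blast
  then show False using i0(1) by (simp add: A_def J0_def)
qed

section \<open>Spanning\<close>

text \<open>Up to the scalar \<open>2 * (r + 1)\<close>, this is the differential of
  \<open>psum n (r + 1)\<close>, with \<theta>_i in the role of dx_i.\<close>

definition odd_form :: "nat \<Rightarrow> nat \<Rightarrow> cpoly ext" where
  "odd_form n r = (\<Sum>i\<in>{1..n}. Xv i ^ Suc (2 * r) \<cdot> eps {i})"

text \<open>Coefficient and generator change sign together, so the signs cancel termwise.\<close>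

lemma ext_invariants_odd_form: "odd_form n r \<in> ext_invariants n"
proof -
  have "eact n \<pi> (odd_form n r) = odd_form n r" if \<pi>: "\<pi> \<in> signed_perms n" for \<pi>
  proof -
    have t: "Xs k ^ Suc (2 * r) \<cdot> theta_sgn k = Xv (nat \<bar>k\<bar>) ^ Suc (2 * r) \<cdot> eps {nat \<bar>k\<bar>}" for k
      by (auto simp: Xs_def theta_sgn_def scale_simps)
    have "eact n \<pi> (odd_form n r) = (\<Sum>i\<in>{1..n}. Xs (\<pi> i) ^ Suc (2 * r) \<cdot> theta_sgn (\<pi> i))"
      unfolding eact_def odd_form_def xact_sum esubst_sum xact_scale esubst_scale xact_eps psubst_power psubst_Xv
      by (intro sum.cong refl) (simp add: esubst_eps)
    also have "\<dots> = (\<Sum>i\<in>{1..n}. Xv (nat \<bar>\<pi> i\<bar>) ^ Suc (2 * r) \<cdot> eps {nat \<bar>\<pi> i\<bar>})"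
      unfolding t ..
    also have "\<dots> = odd_form n r"
      unfolding odd_form_def using \<pi> by (intro sum.reindex_bij_betw) (simp add: signed_perms_def)
    finally show ?thesis .
  qed
  moreover have "odd_form n r \<in> ext_Omega n"
    unfolding odd_form_def by (intro ext_Omega_sum ext_Omega_scale ext_Omega_eps Pn_power Pn_Xv) auto
  moreover have "coef (odd_form n r) {} = 0" by (simp add: odd_form_def coef_sum coef_eps)
  ultimately show ?thesis by (simp add: ext_invariants_def)
qed

lemma psum_Pn: "psum n m \<in> Pn n"
  unfolding psum_def by (intro Pn_sum Pn_power Pn_Xv)

lemma ext_invariants_psum:
  assumes "m > 0" shows "psum n m \<cdot> 1 \<in> ext_invariants n"
proof -
  have "psubst (perm_subst \<pi>) (psum n m) = psum n m" if "\<pi> \<in> signed_perms n" for \<pi>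
  proof -
    have "psubst (perm_subst \<pi>) (psum n m) = (\<Sum>l\<in>{1..n}. (Xs (\<pi> l) ^ 2) ^ m)"
      by (simp add: psum_def psubst_sum psubst_power power_mult)
    also have "\<dots> = psum n m" by (rule psum_perm[OF that, symmetric])
    finally show ?thesis .
  qed
  then have "eact n \<pi> (psum n m \<cdot> 1) = psum n m \<cdot> 1" if "\<pi> \<in> signed_perms n" for \<pi>
    using that by (simp add: eact_def xact_scale xact_1 esubst_scale esubst_1)
  moreover have "lookup (psum n m) 0 = 0"
    using hom_psum[of m n] assms by (force simp: hom_of_deg_def mdeg_def in_keys_iff)
  ultimately show ?thesis
    by (simp add: ext_invariants_def ext_Omega_scale ext_Omega_1 psum_Pn coef_one)
qed

text \<open>This is \<open>\<Theta>\<^sub>A = \<Sum>\<^sub>i x\<^sub>i A(x\<^sub>i\<^sup>2) \<theta>\<^sub>i\<close> for the polynomial \<open>A(t) = \<Prod>\<^sub>l (t - x\<^sub>l\<^sup>2)\<close>.\<close>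
lemma interpolation_form_mem:
  assumes D: "D \<subseteq> {1..n}"
  shows "(\<Sum>i\<in>{1..n}. uprod (\<lambda>_. D) i \<cdot> eps {i}) \<in> ext_SIB n"
proof -
  have "finite D" using D finite_subset by blast
  then obtain a where a: "\<And>t. (\<Prod>l\<in>D. t - Xv l ^ 2) = t ^ card D + (\<Sum>r<card D. a r * t ^ r)"
    using prod_diff_expand[of D "\<lambda>l. Xv l ^ 2"] by blast
  \<comment> \<open>The expansion is only known to have coefficients in the full ring;
    \<open>pproj n\<close> brings them into \<open>Pn n\<close>. At \<open>r = card D\<close> the
    leading coefficient is one.\<close>
  define b where "b r = (if r = card D then 1 else pproj n (a r))" for r
  have bP: "b r \<in> Pn n" for r by (simp add: b_def pproj_Pn)
  have eq: "uprod (\<lambda>_. D) i = (\<Sum>r\<le>card D. b r * Xv i ^ Suc (2 * r))" if i: "i \<in> {1..n}" for i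
  proof -
    have hom: "pproj n (p + q) = pproj n p + pproj n q" "pproj n (p * q) = pproj n p * pproj n q"
      "pproj n (sum f A) = (\<Sum>r\<in>A. pproj n (f r))" for p q f and A :: "nat set"
      by (simp_all add: pproj_def psubst_simps)
    have X: "pproj n (Xv i ^ k) = Xv i ^ k" for k by (intro pproj_id Pn_power Pn_Xv i)
    have "(\<Prod>l\<in>D. Xv i ^ 2 - Xv l ^ 2) \<in> Pn n"
      using i D by (intro Pn_prod Pn_diff Pn_power Pn_Xv) auto
    then have "(\<Prod>l\<in>D. Xv i ^ 2 - Xv l ^ 2) = pproj n (\<Prod>l\<in>D. Xv i ^ 2 - Xv l ^ 2)"
      by (simp add: pproj_id)
    also have "\<dots> = Xv i ^ (2 * card D) + (\<Sum>r<card D. pproj n (a r) * Xv i ^ (2 * r))"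
      unfolding a by (simp only: hom power_mult[symmetric] X)
    also have "\<dots> = (\<Sum>r\<le>card D. b r * Xv i ^ (2 * r))"
      by (simp add: b_def lessThan_Suc_atMost[symmetric])
    finally show ?thesis by (simp add: uprod_def sum_distrib_left mult_ac)
  qed
  have "(\<Sum>i\<in>{1..n}. uprod (\<lambda>_. D) i \<cdot> eps {i}) = (\<Sum>i\<in>{1..n}. \<Sum>r\<le>card D. b r \<cdot> (Xv i ^ Suc (2 * r) \<cdot> eps {i}))"
    by (intro sum.cong refl) (simp only: eq scale_sum_left scale_simps)
  also have "\<dots> = (\<Sum>r\<le>card D. b r \<cdot> odd_form n r)"
    unfolding odd_form_def scale_sum_right by (rule sum.swap)
  also have "\<dots> \<in> ext_SIB n"
  proof (intro ext_SIB_sum ext_SIB_scale bP)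
    show "odd_form n r \<in> ext_SIB n" for r
      using ext_SIB_gen[OF ext_Omega_1 ext_invariants_odd_form ext_Omega_1, of n r] by simp
  qed
  finally show ?thesis .
qed

text \<open>Multiply the interpolating form for \<open>D = {1..<j} - J\<close> by
  \<open>eps (J - {j})\<close>. Indices in \<open>J - {j}\<close> die in the product and indices in
  \<open>D\<close> are roots; \<open>j\<close> gives the leading term, and only indices above
  \<open>j\<close> outside \<open>J\<close> remain.\<close>

lemma uprod_theta_mem:
  assumes J: "J \<subseteq> {1..n}" and j: "j \<in> J"
  obtains h where "\<And>i. h i \<in> Pn n"
    and "uprod (\<lambda>j. {1..<j} - J) j \<cdot> eps J + (\<Sum>i\<in>{j<..n} - J. h i \<cdot> eps (insert i (J - {j}))) \<in> ext_SIB n"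
proof -
  define D where "D = {1..<j} - J"
  define K where "K = J - {j}"
  let ?u = "uprod (\<lambda>_. D)"
  have fJ: "finite J" "finite K" using J finite_subset by (auto simp: K_def)
  have jn: "j \<in> {1..n}" using J j by blast
  have Dn: "D \<subseteq> {1..n}" using jn by (auto simp: D_def)
  \<comment> \<open>A sign with square one, used to normalise the term of \<open>j\<close>.\<close>
  define \<sigma> where "\<sigma> = (esgn {j} K :: cpoly)"
  have \<sigma>: "\<sigma> * \<sigma> = 1" unfolding \<sigma>_def esgn_def by (simp add: power_add[symmetric] mult_2[symmetric])
  have \<sigma>P: "\<sigma> \<in> Pn n" by (simp add: \<sigma>_def esgn_Pn)
  have uP: "?u i \<in> Pn n" if "i \<in> {1..n}" for i
    unfolding uprod_def using that Dn by (intro Pn_mult Pn_prod Pn_diff Pn_power Pn_Xv) auto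
  \<comment> \<open>The value 0 outside \<open>{1..n}\<close> puts every \<open>h i\<close> into
    \<open>Pn n\<close>.\<close>
  define h where "h i = (if i \<in> {1..n} then \<sigma> * ?u i * esgn {i} K else 0)" for i
  have "\<sigma> \<cdot> ((\<Sum>i\<in>{1..n}. ?u i \<cdot> eps {i}) * eps K) \<in> ext_SIB n"
    using J by (intro ext_SIB_scale \<sigma>P ext_SIB_mult_right interpolation_form_mem[OF Dn] ext_Omega_eps) (auto simp: K_def)
  also have "\<sigma> \<cdot> ((\<Sum>i\<in>{1..n}. ?u i \<cdot> eps {i}) * eps K)
      = (\<Sum>i\<in>{1..n}. if i \<in> K then 0 else (\<sigma> * ?u i * esgn {i} K) \<cdot> eps (insert i K))"
    unfolding sum_distrib_right scale_mult_left scale_sum_right using fJ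
    by (intro sum.cong refl) (auto simp: eps_mult scale_simps)
  also have "\<dots> = (\<Sum>i\<in>insert j ({j<..n} - J). (\<sigma> * ?u i * esgn {i} K) \<cdot> eps (insert i K))"
  proof (rule sum.mono_neutral_cong_right)
    show "\<forall>i\<in>{1..n} - insert j ({j<..n} - J). (if i \<in> K then 0 else (\<sigma> * ?u i * esgn {i} K) \<cdot> eps (insert i K)) = 0"
    proof
      fix i assume i: "i \<in> {1..n} - insert j ({j<..n} - J)"
      have "?u i = 0" if "i \<notin> K"
      proof -
        have "i \<in> D" using i that by (auto simp: D_def K_def)
        then have "(\<Prod>l\<in>D. Xv i ^ 2 - Xv l ^ 2) = 0" by (intro prod_zero) (auto simp: D_def)
        then show ?thesis by (simp add: uprod_def)
      qed
      then show "(if i \<in> K then 0 else (\<sigma> * ?u i * esgn {i} K) \<cdot> eps (insert i K)) = 0"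
        by (simp add: scale_simps)
    qed
  qed (use jn in \<open>auto simp: K_def\<close>)
  also have "\<dots> = (\<sigma> * ?u j * \<sigma>) \<cdot> eps (insert j K)
      + (\<Sum>i\<in>{j<..n} - J. (\<sigma> * ?u i * esgn {i} K) \<cdot> eps (insert i K))"
    by (subst sum.insert) (auto simp: \<sigma>_def)
  also have "\<sigma> * ?u j * \<sigma> = uprod (\<lambda>j. {1..<j} - J) j"
    using \<sigma> by (simp add: uprod_def D_def mult_ac)
  also have "insert j K = J" using j by (auto simp: K_def)
  also have "(\<Sum>i\<in>{j<..n} - J. (\<sigma> * ?u i * esgn {i} K) \<cdot> eps (insert i K))
      = (\<Sum>i\<in>{j<..n} - J. h i \<cdot> eps (insert i K))"
    by (intro sum.cong refl) (auto simp: h_def)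
  finally have "uprod (\<lambda>j. {1..<j} - J) j \<cdot> eps J + (\<Sum>i\<in>{j<..n} - J. h i \<cdot> eps (insert i K)) \<in> ext_SIB n" .
  moreover have "h i \<in> Pn n" for i
    by (auto simp: h_def intro!: Pn_mult \<sigma>P uP esgn_Pn)
  ultimately show ?thesis using that unfolding K_def by blast
qed

section \<open>Reduction to the proposed basis\<close>

definition reducible :: "nat \<Rightarrow> (nat set \<Rightarrow> cpoly set) \<Rightarrow> cpoly ext set" where
  "reducible n B = {G. \<exists>F c. finite F \<and> F \<subseteq> {(J, b). J \<subseteq> {1..n} \<and> b \<in> B J} \<and>
    G - (\<Sum>i\<in>F. (cconst (c i) * snd i) \<cdot> eps (fst i)) \<in> ext_SIB n}"

lemma reducible_SIB: "G \<in> ext_SIB n \<Longrightarrow> G \<in> reducible n B"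
  unfolding reducible_def by (intro CollectI exI[of _ "{}"]) simp

lemma reducible_add:
  assumes "G \<in> reducible n B" "H \<in> reducible n B" shows "G + H \<in> reducible n B"
proof -
  let ?I = "{(J, b). J \<subseteq> {1..n} \<and> b \<in> B J}"
  obtain F c where F: "finite F" "F \<subseteq> ?I" "G - (\<Sum>i\<in>F. (cconst (c i) * snd i) \<cdot> eps (fst i)) \<in> ext_SIB n"
    using assms(1) unfolding reducible_def by blast
  obtain E d where E: "finite E" "E \<subseteq> ?I" "H - (\<Sum>i\<in>E. (cconst (d i) * snd i) \<cdot> eps (fst i)) \<in> ext_SIB n"
    using assms(2) unfolding reducible_def by blast
  \<comment> \<open>Coefficients are extended by zero to the union; on common indices they add
    up.\<close>
  define e where "e i = (if i \<in> F then c i else 0) + (if i \<in> E then d i else 0)" for i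
  have "(\<Sum>i\<in>F. (cconst (c i) * snd i) \<cdot> eps (fst i))
      = (\<Sum>i\<in>F \<union> E. (cconst (if i \<in> F then c i else 0) * snd i) \<cdot> eps (fst i))"
    using F(1) E(1) by (intro sum.mono_neutral_cong_left) (auto simp: scale_simps)
  moreover have "(\<Sum>i\<in>E. (cconst (d i) * snd i) \<cdot> eps (fst i))
      = (\<Sum>i\<in>F \<union> E. (cconst (if i \<in> E then d i else 0) * snd i) \<cdot> eps (fst i))"
    using F(1) E(1) by (intro sum.mono_neutral_cong_left) (auto simp: scale_simps)
  ultimately have "(\<Sum>i\<in>F \<union> E. (cconst (e i) * snd i) \<cdot> eps (fst i))
      = (\<Sum>i\<in>F. (cconst (c i) * snd i) \<cdot> eps (fst i)) + (\<Sum>i\<in>E. (cconst (d i) * snd i) \<cdot> eps (fst i))"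
    by (simp only: e_def cconst_add distrib_right scale_simps sum.distrib)
  then have "G + H - (\<Sum>i\<in>F \<union> E. (cconst (e i) * snd i) \<cdot> eps (fst i)) \<in> ext_SIB n"
    using ext_SIB_add[OF F(3) E(3)] by (simp add: algebra_simps)
  moreover have "finite (F \<union> E)" "F \<union> E \<subseteq> ?I" using F(1,2) E(1,2) by simp_all
  ultimately show ?thesis unfolding reducible_def
    by (intro CollectI exI[of _ "F \<union> E"] exI[of _ e] conjI)
qed

lemma reducible_sum: "(\<And>i. i \<in> A \<Longrightarrow> G i \<in> reducible n B) \<Longrightarrow> sum G A \<in> reducible n B"
  by (induction A rule: infinite_finite_induct) (auto intro: reducible_add reducible_SIB ext_SIB.zero)

lemma reducible_basis:
  assumes J: "J \<subseteq> {1..n}" and F: "finite F" "F \<subseteq> B J"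
  shows "(\<Sum>b\<in>F. cconst (c b) * b) \<cdot> eps J \<in> reducible n B"
proof -
  have "(\<Sum>i\<in>Pair J ` F. (cconst (c (snd i)) * snd i) \<cdot> eps (fst i)) = (\<Sum>b\<in>F. cconst (c b) * b) \<cdot> eps J"
    by (simp add: sum.reindex inj_on_def scale_sum_left)
  then have "(\<Sum>b\<in>F. cconst (c b) * b) \<cdot> eps J
      - (\<Sum>i\<in>Pair J ` F. (cconst (c (snd i)) * snd i) \<cdot> eps (fst i)) \<in> ext_SIB n"
    by (simp add: ext_SIB.zero)
  then show ?thesis unfolding reducible_def using F J
    by (intro CollectI exI[of _ "Pair J ` F"] exI[of _ "\<lambda>i. c (snd i)"] conjI) auto
qed

lemma colon_gens_Pn: "J \<subseteq> {1..n} \<Longrightarrow> colon_gens n J \<subseteq> Pn n"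
  unfolding colon_gens_def uprod_def
  by (auto intro!: psum_Pn Pn_mult Pn_prod Pn_diff Pn_power Pn_Xv)

text \<open>Induction upwards along the element sum of \<open>J\<close>, bounded by that of
  \<open>{1..n}\<close>. Modulo the span of \<open>B J\<close>, the polynomial \<open>g\<close> lies
  in the ideal of \<open>colon_gens n J\<close>; power sums are themselves invariant, and each
  \<open>uprod\<close> generator passes to index sets with larger sum.\<close>

lemma reducible_theta:
  assumes span: "\<And>J f. J \<subseteq> {1..n} \<Longrightarrow> f \<in> Pn n \<Longrightarrow>
      \<exists>F c. finite F \<and> F \<subseteq> B J \<and> f - (\<Sum>b\<in>F. cconst (c b) * b) \<in> colon n (IB n) (fJ n J)"
  shows "J \<subseteq> {1..n} \<Longrightarrow> g \<in> Pn n \<Longrightarrow> g \<cdot> eps J \<in> reducible n B"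
proof (induction "\<Sum>{1..n} - \<Sum>J" arbitrary: J g rule: less_induct)
  case less
  note J = less.prems(1)
  have higher: "p \<cdot> eps (insert i (J - {j})) \<in> reducible n B"
    if "j \<in> J" "i \<in> {j<..n} - J" "p \<in> Pn n" for i j p
  proof (rule less.hyps)
    let ?K = "insert i (J - {j})"
    have fin: "finite J" using J finite_subset by blast
    show K: "?K \<subseteq> {1..n}" using J that by auto
    have "\<Sum>J = j + \<Sum>(J - {j})" using that fin by (simp add: sum.remove)
    moreover have "\<Sum>?K = i + \<Sum>(J - {j})" using that fin by simp
    ultimately have "\<Sum>J < \<Sum>?K" using that by simp
    moreover have "\<Sum>?K \<le> \<Sum>{1..n}" using K by (intro sum_mono2) auto
    ultimately show "\<Sum>{1..n} - \<Sum>?K < \<Sum>{1..n} - \<Sum>J"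
      by (metis diff_less_mono2 order.strict_trans2)
  qed (rule that)
  have gen: "(c * s) \<cdot> eps J \<in> reducible n B" if c: "c \<in> Pn n" and s: "s \<in> colon_gens n J" for c s
  proof -
    consider m where "s = psum n m" "m > 0" | j where "j \<in> J" "s = uprod (\<lambda>j. {1..<j} - J) j"
      using s unfolding colon_gens_def by fastforce
    then show ?thesis
    proof cases
      case 1
      have "c \<cdot> (1 * (psum n m \<cdot> 1) * eps J) \<in> ext_SIB n"
        using J by (intro ext_SIB_scale ext_SIB_gen c ext_invariants_psum 1 ext_Omega_1 ext_Omega_eps)
      then show ?thesis using 1 by (intro reducible_SIB) (simp add: scale_mult_left scale_simps)
    next
      case 2
      obtain h where h: "\<And>i. h i \<in> Pn n"
        "uprod (\<lambda>j. {1..<j} - J) j \<cdot> eps J + (\<Sum>i\<in>{j<..n} - J. h i \<cdot> eps (insert i (J - {j}))) \<in> ext_SIB n"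
        by (rule uprod_theta_mem[OF J 2(1)]) (rule that)
      have "c \<cdot> (s \<cdot> eps J + (\<Sum>i\<in>{j<..n} - J. h i \<cdot> eps (insert i (J - {j})))) \<in> ext_SIB n"
        unfolding 2(2) by (rule ext_SIB_scale[OF h(2) c])
      moreover have "(\<Sum>i\<in>{j<..n} - J. (- (c * h i)) \<cdot> eps (insert i (J - {j}))) \<in> reducible n B"
        using 2 c h(1) by (intro reducible_sum higher Pn_uminus Pn_mult) auto
      ultimately have "c \<cdot> (s \<cdot> eps J + (\<Sum>i\<in>{j<..n} - J. h i \<cdot> eps (insert i (J - {j}))))
          + (\<Sum>i\<in>{j<..n} - J. (- (c * h i)) \<cdot> eps (insert i (J - {j}))) \<in> reducible n B"
        by (rule reducible_add[OF reducible_SIB])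
      then show ?thesis by (simp add: scale_simps scale_sum_right sum_negf)
    qed
  qed
  obtain F c where F: "finite F" "F \<subseteq> B J" "g - (\<Sum>b\<in>F. cconst (c b) * b) \<in> colon n (IB n) (fJ n J)"
    using span[OF J less.prems(2)] by blast
  let ?r = "g - (\<Sum>b\<in>F. cconst (c b) * b)"
  have "?r \<in> idl (colon_gens n J) \<inter> Pn n" using F(3) colon_subset[OF J] by (auto simp: colon_def)
  \<comment> \<open>Returning to \<open>pideal\<close> provides cofactors in \<open>Pn n\<close>, as
    \<open>gen\<close> demands.\<close>
  then have "?r \<in> pideal n (colon_gens n J)" using pideal_eq[OF colon_gens_Pn[OF J]] by blast
  then obtain m d s where r: "?r = (\<Sum>k<(m::nat). d k * s k)" "\<forall>k<m. d k \<in> Pn n \<and> s k \<in> colon_gens n J"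
    unfolding pideal_def by blast
  have "?r \<cdot> eps J \<in> reducible n B"
    unfolding r(1) scale_sum_left using r(2) by (intro reducible_sum gen) auto
  then have "?r \<cdot> eps J + (\<Sum>b\<in>F. cconst (c b) * b) \<cdot> eps J \<in> reducible n B"
    by (intro reducible_add reducible_basis J F)
  then show ?case by (simp add: scale_simps(2)[symmetric])
qed

theorem mainTheorem13:
  fixes n :: nat and B :: "nat set \<Rightarrow> cpoly set"
  assumes "\<And>J. J \<subseteq> {1..n} \<Longrightarrow> B J \<subseteq> Pn n \<and> (\<forall>b\<in>B J. homogeneous b)"
    and "\<And>J. J \<subseteq> {1..n} \<Longrightarrow> pbasis_mod (Pn n) (colon n (IB n) (fJ n J)) (\<lambda>b. b) (B J)"
  shows "obasis_mod (Omega n) (SIB n) (\<lambda>(J, b). times_theta b J)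
           {(J, b). J \<subseteq> {1..n} \<and> b \<in> B J}"
proof -
  let ?I = "{(J, b). J \<subseteq> {1..n} \<and> b \<in> B J}" and ?v = "\<lambda>(J, b). times_theta b J"
  have ind: "\<forall>b\<in>F. c b = 0" if "J \<subseteq> {1..n}" "finite F" "F \<subseteq> B J"
    "(\<Sum>b\<in>F. cconst (c b) * b) \<in> colon n (IB n) (fJ n J)" for J F c
    using assms(2)[OF that(1)] that(2-) unfolding pbasis_mod_def by blast
  have span: "\<exists>F c. finite F \<and> F \<subseteq> B J \<and> f - (\<Sum>b\<in>F. cconst (c b) * b) \<in> colon n (IB n) (fJ n J)"
    if "J \<subseteq> {1..n}" "f \<in> Pn n" for J f
    using assms(2)[OF that(1)] that(2) unfolding pbasis_mod_def by blast
  \<comment> \<open>Transport along \<open>to_ext\<close>: basis vectors become polynomial multiples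
    of \<open>eps\<close>, where \<open>independence\<close> and \<open>reducible_theta\<close>
    apply.\<close>
  have fin: "finO (?v i)" and ext: "to_ext (?v i) = snd i \<cdot> eps (fst i)" if i: "i \<in> ?I" for i
  proof -
    have "finite (fst i)" using i finite_subset[of "fst i" "{1..n}"] by auto
    then show "finO (?v i)" "to_ext (?v i) = snd i \<cdot> eps (fst i)"
      by (auto simp: case_prod_beta finO_times_theta to_ext_times_theta)
  qed
  have comb: "finO (\<Sum>i\<in>F. oconst (c i) \<star> ?v i)"
    "to_ext (\<Sum>i\<in>F. oconst (c i) \<star> ?v i) = (\<Sum>i\<in>F. (cconst (c i) * snd i) \<cdot> eps (fst i))"
    if "F \<subseteq> ?I" for F c
  proof -
    have i: "i \<in> ?I" if "i \<in> F" for i using \<open>F \<subseteq> ?I\<close> that by blast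
    show "finO (\<Sum>i\<in>F. oconst (c i) \<star> ?v i)" by (intro finO_sum finO_omul finO_oconst fin i)
    show "to_ext (\<Sum>i\<in>F. oconst (c i) \<star> ?v i) = (\<Sum>i\<in>F. (cconst (c i) * snd i) \<cdot> eps (fst i))"
      unfolding to_ext_sum
      by (intro sum.cong refl)
        (simp add: to_ext_omul[OF finO_oconst fin[OF i]] ext[OF i] to_ext_oconst scale_mult_left scale_simps)
  qed
  show ?thesis unfolding obasis_mod_def
  proof (intro conjI allI impI ballI)
    fix F c i assume F: "finite F" "F \<subseteq> ?I" "(\<Sum>i\<in>F. oconst (c i) \<star> ?v i) \<in> SIB n" and i: "i \<in> F"
    have "(\<Sum>i\<in>F. (cconst (c i) * snd i) \<cdot> eps (fst i)) \<in> ext_SIB n"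
      using SIB_imp_ext_SIB[OF F(3)] comb(2)[OF F(2), of c] by metis
    then have "\<forall>i\<in>F. c i = 0"
      using independence[of n B F c] assms(1) ind F(1,2) by blast
    then show "c i = 0" using i by blast
  next
    fix f assume f: "f \<in> Omega n"
    let ?F = "to_ext f"
    have FO: "supported {1..n} ?F" "\<And>J. coef ?F J \<in> Pn n"
      using to_ext_Omega[OF f] by (auto simp: ext_Omega_def)
    have "(\<Sum>J\<in>Pow {1..n}. coef ?F J \<cdot> eps J) \<in> reducible n B"
      using span FO(2) by (intro reducible_sum reducible_theta) auto
    then have "?F \<in> reducible n B" using eps_expand[OF _ FO(1)] by simp
    then obtain F c where F: "finite F" "F \<subseteq> ?I"
      "?F - (\<Sum>i\<in>F. (cconst (c i) * snd i) \<cdot> eps (fst i)) \<in> ext_SIB n"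
      unfolding reducible_def by blast
    have "to_ext (f - (\<Sum>i\<in>F. oconst (c i) \<star> ?v i)) \<in> ext_SIB n"
      using F(3) by (simp only: to_ext_diff comb(2)[OF F(2)])
    moreover have "finO (f - (\<Sum>i\<in>F. oconst (c i) \<star> ?v i))"
      using finO_add[OF finO_Omega[OF f] finO_uminus[OF comb(1)[OF F(2), of c]]] by simp
    ultimately have "f - (\<Sum>i\<in>F. oconst (c i) \<star> ?v i) \<in> SIB n" by (simp only: SIB_iff)
    then show "\<exists>F c. finite F \<and> F \<subseteq> ?I \<and> f - (\<Sum>i\<in>F. oconst (c i) \<star> ?v i) \<in> SIB n"
      using F(1,2) by (intro exI[of _ F] exI[of _ c] conjI)
  qed
qed

end
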